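(* Let $k,n\ge1$ be integers, let $\omega:[0,\infty)\to[0,\infty)$ be a continuous concave function with $\omega(0)=0$, $\omega\not\equiv0$, and let $\ell\ge 0$ be an integer. Let $S\subset\mathbb R^n$ be a finite set and let $G$ be a mapping which assigns to every $x\in S$ a convex set of polynomials $G(x)\subset\mathcal P_k$ of dimension at most $\ell$. Suppose that for every subset $S'\subset S$ consisting of at most $2^{\min\{\ell+1,\,\dim\mathcal P_k\}}$ points there exists a function $F_{S'}\in C^{k,\omega}(\mathbb R^n)$ such that $\|F_{S'}\|_{C^{k,\omega}(\mathbb R^n)}\le1$ and $T^k_x(F_{S'})\in G(x)$ for all $x\in S'$. Then there is a function $F\in C^{k,\omega}(\mathbb R^n)$ with $\|F\|_{C^{k,\omega}(\mathbb R^n)}\le\gamma$ and $$T^k_x(F)\in G(x)\quad\text{for all }x\in S,$$ where the constant $\gamma$ depends only on $k$, $n$ and $\operatorname{card}S$.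
   Context: $\mathcal P_k$ is the space of real polynomials on $\mathbb R^n$ of degree at most $k$. $\|\cdot\|$ on $\mathbb R^n$ is the Euclidean norm. $C^{k,\omega}(\mathbb R^n)$ is the space of functions $f:\mathbb R^n\to\mathbb R$ with continuous derivatives of all orders up to $k$ and finite norm $$\|f\|_{C^{k,\omega}(\mathbb R^n)}:=\sum_{|\alpha|\le k}\sup_{x\in\mathbb R^n}|D^\alpha f(x)|+\sum_{|\alpha|=k}\sup_{x,y\in\mathbb R^n,\,x\ne y}\frac{|D^\alpha f(x)-D^\alpha f(y)|}{\omega(\|x-y\|)}.$$ For a $k$-times differentiable $f$, $T^k_x(f)(y):=\sum_{|\alpha|\le k}\frac1{\alpha!}D^\alpha f(x)(y-x)^\alpha$ is its Taylor polynomial of degree at most $k$ at $x$. The dimension of a convex set is the dimension of its affine hull. *)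

theory Defs
  imports "HOL-Analysis.Analysis" "HOL-Library.Function_Algebras"
begin

text \<open>Real-valued functions form a real vector space pointwise.  This makes \<^const>\<open>span\<close>,
  \<^const>\<open>dim\<close>, \<^const>\<open>convex\<close> and \<^const>\<open>hull\<close> available for sets of polynomial functions.\<close>

instantiation "fun" :: (type, real_vector) real_vector
begin

definition scaleR_fun_def: "r *\<^sub>R f = (\<lambda>x. r *\<^sub>R f x)"

instance
  by standard (simp_all add: scaleR_fun_def plus_fun_def fun_eq_iff scaleR_add_right scaleR_add_left)

end

text \<open>The constant \<^const>\<open>aff_dim\<close> requires a Euclidean space, so for sets of functions the dimension
  of the affine hull is taken to be the dimension of its direction space.  As \<^const>\<open>dim\<close> is 0 for
  infinite-dimensional sets, this is meaningful only for subsets of finite-dimensional spaces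
  (the polynomial spaces below); it is 0 for the empty set.\<close>

definition affine_dimension :: "'a::real_vector set \<Rightarrow> nat" where
  "affine_dimension A = dim {p - q | p q. p \<in> affine hull A \<and> q \<in> affine hull A}"

text \<open>A multi-index over the coordinates of \<^typ>\<open>real ^ 'n\<close> is a function \<^typ>\<open>'n \<Rightarrow> nat\<close>.\<close>

definition mi_order :: "('n::finite \<Rightarrow> nat) \<Rightarrow> nat" where
  "mi_order \<alpha> = (\<Sum>i\<in>UNIV. \<alpha> i)"

definition mi_fact :: "('n::finite \<Rightarrow> nat) \<Rightarrow> real" where
  "mi_fact \<alpha> = (\<Prod>i\<in>UNIV. fact (\<alpha> i))"

definition mi_power :: "real ^ 'n \<Rightarrow> ('n::finite \<Rightarrow> nat) \<Rightarrow> real" where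
  "mi_power x \<alpha> = (\<Prod>i\<in>UNIV. (x $ i) ^ \<alpha> i)"

lemma mi_component_le_order: "\<alpha> i \<le> mi_order \<alpha>"
  unfolding mi_order_def by (rule member_le_sum) auto

lemma finite_mi_order_le: "finite {\<alpha> :: 'n::finite \<Rightarrow> nat. mi_order \<alpha> \<le> k}"
proof (rule finite_subset)
  show "{\<alpha> :: 'n \<Rightarrow> nat. mi_order \<alpha> \<le> k} \<subseteq> PiE UNIV (\<lambda>_. {..k})"
    using mi_component_le_order order_trans by (fastforce simp: PiE_def)
  show "finite (PiE (UNIV :: 'n set) (\<lambda>_. {..k}))"
    by (intro finite_PiE) auto
qed

lemma finite_mi_order_eq: "finite {\<alpha> :: 'n::finite \<Rightarrow> nat. mi_order \<alpha> = k}"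
  by (rule finite_subset[OF _ finite_mi_order_le[of k]]) auto

definition polys_upto :: "nat \<Rightarrow> (real ^ 'n::finite \<Rightarrow> real) set" where
  "polys_upto k = span {(\<lambda>y. mi_power y \<alpha>) | \<alpha>. mi_order \<alpha> \<le> k}"

definition partial_differentiable :: "'n::finite \<Rightarrow> (real ^ 'n \<Rightarrow> real) \<Rightarrow> real ^ 'n \<Rightarrow> bool" where
  "partial_differentiable i f x \<longleftrightarrow> (\<lambda>t. f (x + t *\<^sub>R axis i 1)) differentiable (at 0)"

definition partial_deriv :: "'n::finite \<Rightarrow> (real ^ 'n \<Rightarrow> real) \<Rightarrow> real ^ 'n \<Rightarrow> real" where
  "partial_deriv i f x = deriv (\<lambda>t. f (x + t *\<^sub>R axis i 1)) 0"

primrec Ck :: "nat \<Rightarrow> (real ^ 'n::finite \<Rightarrow> real) \<Rightarrow> bool" where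
  "Ck 0 f \<longleftrightarrow> continuous_on UNIV f"
| "Ck (Suc k) f \<longleftrightarrow> continuous_on UNIV f \<and>
     (\<forall>i. (\<forall>x. partial_differentiable i f x) \<and> Ck k (partial_deriv i f))"

primrec iter_partial :: "'n::finite list \<Rightarrow> (real ^ 'n \<Rightarrow> real) \<Rightarrow> real ^ 'n \<Rightarrow> real" where
  "iter_partial [] f = f"
| "iter_partial (i # js) f = iter_partial js (partial_deriv i f)"

text \<open>The coordinate type carries no order, so the partial derivatives making up $D^\alpha$ are taken
  in an arbitrary order.  The choice depends on \<open>\<alpha>\<close> only, and for a \<open>C\<^sup>k\<close> function and
  \<open>\<bar>\<alpha>\<bar> \<le> k\<close> all choices give the same function.\<close>

definition mi_list :: "('n::finite \<Rightarrow> nat) \<Rightarrow> 'n list" where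
  "mi_list \<alpha> = (SOME js. \<forall>i. count_list js i = \<alpha> i)"

lemma count_mi_list: "count_list (mi_list \<alpha>) i = \<alpha> i"
proof -
  have "\<exists>js. \<forall>i. count_list js i = \<alpha> i"
  proof -
    obtain js where "mset js = Abs_multiset \<alpha>"
      using ex_mset by blast
    then have "\<forall>i. count_list js i = \<alpha> i"
      by (metis count_mset count_Abs_multiset finite_code)
    then show ?thesis ..
  qed
  then have "\<forall>i. count_list (mi_list \<alpha>) i = \<alpha> i"
    unfolding mi_list_def by (rule someI_ex)
  then show ?thesis ..
qed

definition mi_deriv :: "('n::finite \<Rightarrow> nat) \<Rightarrow> (real ^ 'n \<Rightarrow> real) \<Rightarrow> real ^ 'n \<Rightarrow> real" where
  "mi_deriv \<alpha> f = iter_partial (mi_list \<alpha>) f"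

definition Ck_omega_norm :: "nat \<Rightarrow> (real \<Rightarrow> real) \<Rightarrow> (real ^ 'n::finite \<Rightarrow> real) \<Rightarrow> ennreal" where
  "Ck_omega_norm k \<omega> f =
     (\<Sum>\<alpha> | mi_order \<alpha> \<le> k. SUP x. ennreal \<bar>mi_deriv \<alpha> f x\<bar>) +
     (\<Sum>\<alpha> | mi_order \<alpha> = k. SUP (x, y)\<in>{(x, y). x \<noteq> y}.
        ennreal (\<bar>mi_deriv \<alpha> f x - mi_deriv \<alpha> f y\<bar> / \<omega> (norm (x - y))))"

definition Ck_omega :: "nat \<Rightarrow> (real \<Rightarrow> real) \<Rightarrow> (real ^ 'n::finite \<Rightarrow> real) set" where
  "Ck_omega k \<omega> = {f. Ck k f \<and> Ck_omega_norm k \<omega> f < \<infinity>}"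

definition taylor_poly :: "nat \<Rightarrow> real ^ 'n \<Rightarrow> (real ^ 'n::finite \<Rightarrow> real) \<Rightarrow> real ^ 'n \<Rightarrow> real" where
  "taylor_poly k x f = (\<lambda>y. \<Sum>\<alpha> | mi_order \<alpha> \<le> k. 1 / mi_fact \<alpha> * mi_deriv \<alpha> f x * mi_power (y - x) \<alpha>)"

end

theory Submission
  imports Defs
begin

text \<open>
  Replace \<open>\<omega>\<close> by \<open>w = min 1 \<omega>\<close> and choose \<open>t \<ge> 1\<close> with \<open>w t * t ^ k = 1\<close>. On a set of \<open>N\<close> points, the jets of a
  function of norm at most 1 are described, up to factors depending on \<open>k\<close>, \<open>n\<close> and \<open>N\<close>, by two kinds of
  inequalities: \<open>\<bar>D\<^sup>\<alpha> P\<^sub>x(x)\<bar> \<le> t\<^bsup>-\<bar>\<alpha>\<bar>\<^esup>\<close>, and \<open>\<bar>D\<^sup>\<alpha>(P\<^sub>x - P\<^sub>y)(x)\<bar> \<le> w(\<parallel>x - y\<parallel>) \<parallel>x - y\<parallel>\<^bsup>k - \<bar>\<alpha>\<bar>\<^esup>\<close>. Conversely a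
  family satisfying them is extended by adding the points one at a time, with a bump whose support avoids the earlier
  points. Inequalities of the first kind are absorbed into the convex sets \<open>G x\<close>, those of the second kind cut out a
  symmetric convex set \<open>K\<close> of jet families.

  If no selection lies in \<open>C * K\<close>, a hyperplane separates: there are functionals \<open>\<psi>\<^sub>x\<close> with
  \<open>\<Sum>\<^sub>x inf\<^bsub>G x\<^esub> \<psi>\<^sub>x \<ge> C * sup\<^sub>K \<Sum>\<^sub>x \<psi>\<^sub>x\<close> with a positive right hand side. The opposite inequality is proved by induction on the number of
  points in the support \<open>T\<close> of \<open>\<psi>\<close>; up to \<open>2 ^ m\<close> points it is the hypothesis. If there are more, repeated
  halving gives a chain of \<open>m\<close> clusters \<open>R\<^sub>i\<close> of points, where a cluster has diameter at most a constant times its distance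
  to the other points. For a cluster \<open>R\<close>, \<open>x \<in> R\<close> and \<open>q \<in> K\<close>, the family equal to \<open>q\<^sub>x - q\<^sub>y\<close> for \<open>y \<in> R\<close> and 0 elsewhere lies in a
  multiple of \<open>K\<close>. If \<open>m = l + 1\<close>, the functionals \<open>\<Sum>y\<in>R\<^sub>i \<inter> T. \<psi>\<^sub>y\<close> satisfy a linear relation on the directions of
  \<open>G x\<close> for a point \<open>x\<close> of the last cluster; if \<open>m = dim \<P>\<^sub>k\<close>, they satisfy one on all polynomials after \<open>{x}\<close> is
  appended to the chain. This relation splits \<open>\<psi>\<close> into two families with smaller supports.
\<close>

section \<open>Separation in finite-dimensional subspaces\<close>

text \<open>Since \<open>\<gamma>\<close> may not depend on \<open>\<omega>\<close>, the scale
  \<open>t\<close> has to be built into the bounds. A function bounded by 1 whose top derivatives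
  oscillate by at most \<open>w\<close> has derivatives of order \<open>j\<close> of size at most a
  constant times \<open>1 / t ^ j\<close>, which is \<open>w t * t ^ (k - j)\<close>. The one-point
  bounds thus have the form of a comparison with the zero jet at distance \<open>t\<close>, and one
  bump construction serves both kinds of inequality.

  The one-point bounds cannot be part of \<open>K\<close>. Truncation to a cluster puts the jet of
  \<open>q x\<close> at a point \<open>y\<close> that may be much farther than \<open>t\<close> from
  \<open>x\<close>, where it need not obey them. In \<open>G x\<close> they are harmless: they
  preserve convexity and do not raise the dimension.

  Passing to the dual side is what allows an induction. There is no evident way to glue selections
  for overlapping subsets of \<open>S\<close>, whereas a functional is a sum over points and can be
  cut into two functionals with smaller supports. The infimum over \<open>G x\<close> is not
  additive; the linear relation makes the correcting term constant on \<open>G x\<close>, so that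
  the infimum only shifts.\<close>

definition sublinear_on :: "'a::real_vector set \<Rightarrow> ('a \<Rightarrow> real) \<Rightarrow> bool" where
  "sublinear_on J p \<longleftrightarrow> (\<forall>x\<in>J. \<forall>y\<in>J. p (x + y) \<le> p x + p y) \<and>
     (\<forall>x\<in>J. \<forall>c\<ge>0. p (c *\<^sub>R x) = c * p x)"

lemma sublinear_onI:
  assumes J: "subspace J" and add: "\<And>x y. x \<in> J \<Longrightarrow> y \<in> J \<Longrightarrow> p (x + y) \<le> p x + p y"
    and zero: "p 0 = 0" and le: "\<And>x c. x \<in> J \<Longrightarrow> c > 0 \<Longrightarrow> p (c *\<^sub>R x) \<le> c * p x"
  shows "sublinear_on J p"
proof -
  have "p (c *\<^sub>R x) = c * p x" if x: "x \<in> J" and c: "c \<ge> 0" for c x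
  proof (cases "c = 0")
    case False
    then have c: "c > 0" using c by simp
    have "p ((1 / c) *\<^sub>R (c *\<^sub>R x)) \<le> (1 / c) * p (c *\<^sub>R x)"
      using c x J by (intro le) (auto simp: subspace_scale)
    then show ?thesis using le[OF x c] c by (simp add: field_simps)
  qed (simp add: zero)
  then show ?thesis using add by (simp add: sublinear_on_def)
qed

lemma sublinear_onD:
  assumes "sublinear_on J p"
  shows "x \<in> J \<Longrightarrow> y \<in> J \<Longrightarrow> p (x + y) \<le> p x + p y"
    and "x \<in> J \<Longrightarrow> c \<ge> 0 \<Longrightarrow> p (c *\<^sub>R x) = c * p x"
  using assms by (auto simp: sublinear_on_def)

lemma sublinear_on_zero: "sublinear_on J p \<Longrightarrow> x \<in> J \<Longrightarrow> p 0 = 0"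
  using sublinear_onD(2)[of J p x 0] by simp

lemma sublinear_on_minus:
  assumes "sublinear_on J p" "subspace J" "x \<in> J"
  shows "- p (- x) \<le> p x"
proof -
  have "p (x + - x) \<le> p x + p (- x)"
    using assms by (intro sublinear_onD(1)) (auto simp: subspace_neg)
  with sublinear_on_zero[OF assms(1,3)] show ?thesis by simp
qed

text \<open>Linearization along one vector, the elementary step of Hahn-Banach. Subadditivity bounds
  the infimum defining \<open>q x\<close> below by \<open>- p (- x)\<close>; the choice
  \<open>t = 1\<close> at \<open>- v\<close> gives the last claim, which together with
  \<open>q \<le> p\<close> forces \<open>q v = p v\<close>.\<close>

lemma sublinear_on_linearize:
  assumes p: "sublinear_on J p" and J: "subspace J" and v: "v \<in> J"
  obtains q where "sublinear_on J q" "\<And>x. x \<in> J \<Longrightarrow> q x \<le> p x" "q (- v) \<le> - p v"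
proof -
  define A where "A x = (\<lambda>t. p (x + t *\<^sub>R v) - t * p v) ` {0..}" for x
  define q where "q x = Inf (A x)" for x
  have mem: "x + t *\<^sub>R v \<in> J" if "x \<in> J" for x t
    using that v J by (simp add: subspace_add subspace_scale)
  have low: "- p (- x) \<le> p (x + t *\<^sub>R v) - t * p v" if "x \<in> J" "t \<ge> 0" for x t
  proof -
    have "p ((x + t *\<^sub>R v) + - x) \<le> p (x + t *\<^sub>R v) + p (- x)"
      using mem that J by (intro sublinear_onD(1)[OF p]) (auto simp: subspace_neg)
    then show ?thesis using sublinear_onD(2)[OF p v that(2)] by simp
  qed
  have bdd: "bdd_below (A x)" if "x \<in> J" for x
    unfolding A_def using low[OF that] by (intro bdd_belowI2[where m="- p (- x)"]) auto
  have le: "q x \<le> p (x + t *\<^sub>R v) - t * p v" if "x \<in> J" "t \<ge> 0" for x t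
    unfolding q_def by (rule cInf_lower[OF _ bdd[OF that(1)]]) (use that in \<open>auto simp: A_def\<close>)
  have ge: "b \<le> q x" if "\<And>t. t \<ge> 0 \<Longrightarrow> b \<le> p (x + t *\<^sub>R v) - t * p v" for b x
    unfolding q_def by (rule cInf_greatest) (use that in \<open>auto simp: A_def\<close>)
  have add: "q (x + y) \<le> q x + q y" if x: "x \<in> J" and y: "y \<in> J" for x y
  proof -
    have "q (x + y) - (p (y + u *\<^sub>R v) - u * p v) \<le> q x" if u: "u \<ge> 0" for u
    proof (rule ge)
      fix t :: real assume t: "t \<ge> 0"
      have "q (x + y) \<le> p ((x + y) + (t + u) *\<^sub>R v) - (t + u) * p v"
        using le[of "x + y" "t + u"] x y t u J by (simp add: subspace_add)
      also have "(x + y) + (t + u) *\<^sub>R v = (x + t *\<^sub>R v) + (y + u *\<^sub>R v)"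
        by (simp add: algebra_simps)
      also have "p \<dots> \<le> p (x + t *\<^sub>R v) + p (y + u *\<^sub>R v)"
        using x y by (intro sublinear_onD(1)[OF p] mem)
      finally show "q (x + y) - (p (y + u *\<^sub>R v) - u * p v) \<le> p (x + t *\<^sub>R v) - t * p v"
        by (simp add: algebra_simps)
    qed
    then have "q (x + y) - q x \<le> q y"
      by (intro ge) (simp add: algebra_simps)
    then show ?thesis by simp
  qed
  have le_scale: "q (c *\<^sub>R x) \<le> c * q x" if x: "x \<in> J" and c: "c > 0" for c x
  proof -
    have "q (c *\<^sub>R x) / c \<le> q x"
    proof (rule ge)
      fix t :: real assume t: "t \<ge> 0"
      have "q (c *\<^sub>R x) \<le> p (c *\<^sub>R x + (c * t) *\<^sub>R v) - (c * t) * p v"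
        using x t c J by (intro le) (auto simp: subspace_scale)
      also have "c *\<^sub>R x + (c * t) *\<^sub>R v = c *\<^sub>R (x + t *\<^sub>R v)"
        by (simp add: algebra_simps)
      also have "p \<dots> = c * p (x + t *\<^sub>R v)"
        using c mem[OF x] by (intro sublinear_onD(2)[OF p]) auto
      finally show "q (c *\<^sub>R x) / c \<le> p (x + t *\<^sub>R v) - t * p v"
        using c by (simp add: field_simps)
    qed
    then show ?thesis using c by (simp add: field_simps)
  qed
  have zero: "q 0 = 0"
  proof (rule antisym)
    show "q 0 \<le> 0"
      using le[of 0 0] sublinear_on_zero[OF p v] J by (simp add: subspace_0)
    show "0 \<le> q 0"
      by (rule ge) (use sublinear_onD(2)[OF p v] in simp)
  qed
  show ?thesis
  proof (rule that)
    show "sublinear_on J q" by (rule sublinear_onI[OF J add zero le_scale])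
    show "q x \<le> p x" if "x \<in> J" for x
      using le[OF that, of 0] by simp
    show "q (- v) \<le> - p v"
      using le[of "- v" 1] v J sublinear_on_zero[OF p v] by (simp add: subspace_neg)
  qed
qed

text \<open>Linearity gained along \<open>u\<close> survives any further decrease, because
  \<open>q u = - q (- u) \<le> - r (- u) \<le> r u \<le> q u\<close>. A finite spanning set thus
  takes the place of Zorn's lemma.\<close>

lemma sublinear_on_linearize_finite:
  assumes "finite V" "sublinear_on J p" "subspace J" "V \<subseteq> J"
  shows "\<exists>q. sublinear_on J q \<and> (\<forall>x\<in>J. q x \<le> p x) \<and> (\<forall>v\<in>V. q (- v) = - q v)"
  using assms
proof (induction V rule: finite_induct)
  case (insert v V)
  then obtain q where q: "sublinear_on J q" "\<forall>x\<in>J. q x \<le> p x" "\<forall>v\<in>V. q (- v) = - q v"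
    by auto
  from insert.prems have v: "v \<in> J" by simp
  obtain r where r: "sublinear_on J r" "\<And>x. x \<in> J \<Longrightarrow> r x \<le> q x" "r (- v) \<le> - q v"
    using sublinear_on_linearize[OF q(1) insert.prems(2) v] by blast
  have "r (- u) = - r u" if u: "u \<in> insert v V" for u
  proof -
    have uJ: "u \<in> J" "- u \<in> J" using u insert.prems by (auto simp: subspace_neg)
    have "r (- u) \<le> - q u"
      using u r(3) r(2)[OF uJ(2)] q(3) by auto
    then show ?thesis
      using r(2)[OF uJ(1)] sublinear_on_minus[OF r(1) insert.prems(2) uJ(1)] by linarith
  qed
  then show ?case using r q by (intro exI[of _ r]) (auto intro: order_trans)
qed auto

lemma hahn_banach_finite_dim:
  assumes p: "sublinear_on J p" and B: "finite B" "J = span B" and z: "z \<in> J"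
  shows "\<exists>f. linear f \<and> (\<forall>x\<in>J. f x \<le> p x) \<and> f z = p z"
proof -
  have J: "subspace J" using B by simp
  \<comment> \<open>Linearizing at \<open>z\<close> first pins the value: every sublinear functional
    below \<open>p1\<close> is at least \<open>p z\<close> at \<open>z\<close>.\<close>
  obtain p1 where p1: "sublinear_on J p1" "\<And>x. x \<in> J \<Longrightarrow> p1 x \<le> p x" "p1 (- z) \<le> - p z"
    using sublinear_on_linearize[OF p J z] by blast
  obtain q where q: "sublinear_on J q" "\<And>x. x \<in> J \<Longrightarrow> q x \<le> p1 x" "\<And>b. b \<in> B \<Longrightarrow> q (- b) = - q b"
    using sublinear_on_linearize_finite[OF B(1) p1(1) J] B(2) by (auto simp: span_superset)
  define L where "L = {x \<in> J. q (- x) = - q x}"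
  have Ladd: "q (x + y) = q x + q y" if "x \<in> L" "y \<in> L" for x y
  proof -
    have mem: "x \<in> J" "y \<in> J" "- x \<in> J" "- y \<in> J" "x + y \<in> J"
      and neg: "q (- x) = - q x" "q (- y) = - q y"
      using that J by (auto simp: L_def subspace_neg subspace_add)
    have "q (- x + - y) \<le> q (- x) + q (- y)"
      using mem by (intro sublinear_onD(1)[OF q(1)])
    moreover have "- q (- (x + y)) \<le> q (x + y)"
      by (rule sublinear_on_minus[OF q(1) J mem(5)])
    moreover have "q (x + y) \<le> q x + q y"
      using mem by (intro sublinear_onD(1)[OF q(1)])
    ultimately show ?thesis using neg by simp
  qed
  have Lscale: "q (c *\<^sub>R x) = c * q x" if "x \<in> L" for c x
  proof (cases "c \<ge> 0")
    case True
    then show ?thesis using that sublinear_onD(2)[OF q(1)] by (auto simp: L_def)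
  next
    case False
    then have "q ((- c) *\<^sub>R (- x)) = (- c) * q (- x)"
      using that J by (intro sublinear_onD(2)[OF q(1)]) (auto simp: L_def subspace_neg)
    then show ?thesis using that by (simp add: L_def)
  qed
  have L: "subspace L"
  proof (rule subspaceI)
    show "0 \<in> L" using sublinear_on_zero[OF q(1) z] J by (simp add: L_def subspace_0)
    fix x y assume xy: "x \<in> L" "y \<in> L"
    then have neg: "- x \<in> L" "- y \<in> L" using J by (auto simp: L_def subspace_neg)
    have "q (- (x + y)) = q (- x + - y)" by simp
    also have "\<dots> = - q (x + y)"
      using Ladd[OF xy] Ladd[OF neg] xy by (simp add: L_def)
    finally show "x + y \<in> L" using xy J by (simp add: L_def subspace_add)
  next
    fix c x assume x: "x \<in> L"
    then show "c *\<^sub>R x \<in> L"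
      using Lscale[OF x, of c] Lscale[OF x, of "- c"] J by (simp add: L_def subspace_scale)
  qed
  have "B \<subseteq> L" using q(3) B by (auto simp: L_def span_base)
  then have LJ: "J \<subseteq> L" using span_minimal[OF _ L] B by simp
  obtain C where C: "C \<subseteq> J" "independent C" "J \<subseteq> span C"
    using basis_exists[of J] by metis
  obtain f where f: "linear f" "\<And>x. x \<in> C \<Longrightarrow> f x = q x"
    using linear_independent_extend[OF C(2), of q] by auto
  have fq: "x \<in> J \<Longrightarrow> f x = q x" for x
  proof -
    assume "x \<in> J"
    then have "x \<in> span C" using C by blast
    then have "x \<in> L \<and> f x = q x"
    proof (induction rule: span_induct_alt)
      case base
      then show ?case using sublinear_on_zero[OF q(1) z] L linear_0[OF f(1)] by (simp add: subspace_0)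
    next
      case (step c x y)
      then have "x \<in> L" using C LJ by blast
      then show ?case
        using step f Ladd[of "c *\<^sub>R x" y] Lscale[of x c] L
        by (simp add: linear_add linear_scale subspace_add subspace_scale)
    qed
    then show ?thesis by simp
  qed
  have "p z \<le> q z"
  proof -
    have "q (- z) \<le> - p z" using q(2)[of "- z"] p1(3) z J by (simp add: subspace_neg)
    then show ?thesis using sublinear_on_minus[OF q(1) J z] by linarith
  qed
  then have "f z = p z" using fq[OF z] q(2)[OF z] p1(2)[OF z] by simp
  then show ?thesis using f(1) fq q(2) p1(2) by (metis order_trans)
qed

text \<open>Hahn-Banach for the Minkowski gauge of \<open>M\<close>, which is finite because
  \<open>M\<close> absorbs. A point outside a convex set containing 0 has gauge at least 1. No
  topology enters, and as \<open>M\<close> is not assumed closed, the separation is weak.\<close>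

lemma separate_point_from_absorbing_convex:
  assumes B: "finite B" "J = span B" and M: "convex M" "M \<subseteq> J"
    and absorb: "\<And>x. x \<in> J \<Longrightarrow> \<exists>e>0. e *\<^sub>R x \<in> M" and z: "z \<in> J" "z \<notin> M"
  shows "\<exists>f. linear f \<and> (\<forall>x\<in>M. f x \<le> (1::real)) \<and> f z \<ge> 1"
proof -
  have J: "subspace J" using B by simp
  have M0: "0 \<in> M" using absorb[of 0] J by (auto simp: subspace_0)
  define A where "A x = {t. t > 0 \<and> (1 / t) *\<^sub>R x \<in> M}" for x
  define p where "p x = Inf (A x)" for x
  have ne: "A x \<noteq> {}" if x: "x \<in> J" for x
  proof -
    obtain e where "e > 0" "e *\<^sub>R x \<in> M" using absorb[OF x] by blast
    then have "1 / e \<in> A x" by (simp add: A_def)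
    then show ?thesis by blast
  qed
  have bdd: "bdd_below (A x)" for x
    by (rule bdd_belowI[of _ 0]) (auto simp: A_def)
  have le: "t \<in> A x \<Longrightarrow> p x \<le> t" for t x
    unfolding p_def by (rule cInf_lower[OF _ bdd])
  have ge: "x \<in> J \<Longrightarrow> (\<And>t. t \<in> A x \<Longrightarrow> b \<le> t) \<Longrightarrow> b \<le> p x" for b x
    unfolding p_def by (rule cInf_greatest[OF ne])
  have addA: "t + u \<in> A (x + y)" if "t \<in> A x" "u \<in> A y" for t u x y
  proof -
    have pos: "t > 0" "u > 0" using that by (auto simp: A_def)
    have "(t / (t + u)) *\<^sub>R ((1 / t) *\<^sub>R x) + (u / (t + u)) *\<^sub>R ((1 / u) *\<^sub>R y) \<in> M"
      using that pos by (intro convexD[OF M(1)]) (auto simp: A_def add_divide_distrib[symmetric])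
    then show ?thesis using pos by (simp add: A_def scaleR_add_right)
  qed
  have scaleA: "c * t \<in> A (c *\<^sub>R x)" if "t \<in> A x" "c > 0" for c t x
    using that by (auto simp: A_def)
  have add: "p (x + y) \<le> p x + p y" if x: "x \<in> J" and y: "y \<in> J" for x y
  proof -
    have "p (x + y) - u \<le> p x" if u: "u \<in> A y" for u
      using le[OF addA[OF _ u]] by (intro ge[OF x]) (simp add: algebra_simps)
    then have "p (x + y) - p x \<le> p y"
      by (intro ge[OF y]) (simp add: algebra_simps)
    then show ?thesis by simp
  qed
  have zero: "p 0 = 0"
  proof (rule antisym)
    show "0 \<le> p 0" using J by (intro ge) (auto simp: A_def subspace_0)
    have "p 0 \<le> e" if "e > 0" for e :: real
      using le[of e 0] that M0 by (simp add: A_def)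
    then show "p 0 \<le> 0" using field_le_epsilon[of "p 0" 0] by simp
  qed
  have le_scale: "p (c *\<^sub>R x) \<le> c * p x" if x: "x \<in> J" and c: "c > 0" for c x
  proof -
    have "p (c *\<^sub>R x) / c \<le> p x"
      using le[OF scaleA[OF _ c]] c by (intro ge[OF x]) (simp add: field_simps)
    then show ?thesis using c by (simp add: field_simps)
  qed
  have p: "sublinear_on J p" by (rule sublinear_onI[OF J add zero le_scale])
  have "1 \<le> p z"
  proof (rule ge[OF z(1)], rule ccontr)
    fix t assume t: "t \<in> A z" "\<not> 1 \<le> t"
    then have "t *\<^sub>R ((1 / t) *\<^sub>R z) + (1 - t) *\<^sub>R 0 \<in> M"
      using M0 by (intro convexD[OF M(1)]) (auto simp: A_def)
    then show False using t z by (simp add: A_def)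
  qed
  moreover have "p x \<le> 1" if "x \<in> M" for x
    using le[of 1 x] that by (simp add: A_def)
  moreover obtain f where "linear f" "\<forall>x\<in>J. f x \<le> p x" "f z = p z"
    using hahn_banach_finite_dim[OF p B z(1)] by blast
  ultimately show ?thesis
    using M(2) by (intro exI[of _ f]) (auto intro: order_trans)
qed

section \<open>Selections and clusters\<close>

lemma sum_fun_apply: "(\<Sum>x\<in>A. f x) y = (\<Sum>x\<in>A. f x y)"
  by (induction A rule: infinite_finite_induct) auto

text \<open>Gaussian elimination in the unknowns \<open>c i\<close>, with one equation for each
  \<open>b\<close>. The values \<open>\<phi> i b\<close> are plain numbers; linearity enters only
  afterwards.\<close>

lemma homogeneous_system_nontrivial:
  fixes \<phi> :: "'i \<Rightarrow> 'b \<Rightarrow> real"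
  assumes "finite B" "finite I" "card B < card I"
  shows "\<exists>c. (\<exists>i\<in>I. c i \<noteq> 0) \<and> (\<forall>b\<in>B. (\<Sum>i\<in>I. c i * \<phi> i b) = 0)"
  using assms
proof (induction B arbitrary: I \<phi> rule: finite_induct)
  case empty
  then show ?case by (intro exI[of _ "\<lambda>_. 1"]) (auto simp: card_gt_0_iff)
next
  case (insert b B)
  show ?case
  proof (cases "\<exists>j\<in>I. \<phi> j b \<noteq> 0")
    case False
    have "card B < card I" using insert by simp
    then obtain c where "\<exists>i\<in>I. c i \<noteq> 0" "\<forall>b\<in>B. (\<Sum>i\<in>I. c i * \<phi> i b) = 0"
      using insert.IH[of I \<phi>] insert.prems(1) by blast
    then show ?thesis using False by (intro exI[of _ c]) auto
  next
    case True
    then obtain j where j: "j \<in> I" "\<phi> j b \<noteq> 0" by blast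
    define I' where "I' = I - {j}"
    \<comment> \<open>The unknown \<open>c j\<close> is solved from the equation at \<open>b\<close>
      and substituted into the others.\<close>
    define \<phi>' where "\<phi>' i x = \<phi> i x - \<phi> i b / \<phi> j b * \<phi> j x" for i x
    have I': "finite I'" "card B < card I'" "I = insert j I'" "j \<notin> I'"
      using insert j by (auto simp: I'_def)
    obtain c where c: "\<exists>i\<in>I'. c i \<noteq> 0" "\<forall>b\<in>B. (\<Sum>i\<in>I'. c i * \<phi>' i b) = 0"
      using insert.IH[OF I'(1,2)] by blast
    define d where "d = c(j := - (\<Sum>i\<in>I'. c i * \<phi> i b) / \<phi> j b)"
    have "(\<Sum>i\<in>I. d i * \<phi> i x) = (\<Sum>i\<in>I'. c i * \<phi>' i x)" for x
    proof -
      have "(\<Sum>i\<in>I. d i * \<phi> i x) = d j * \<phi> j x + (\<Sum>i\<in>I'. c i * \<phi> i x)"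
        using I' by (auto simp: d_def intro!: sum.cong)
      also have "d j * \<phi> j x = - (\<Sum>i\<in>I'. c i * (\<phi> i b / \<phi> j b * \<phi> j x))"
      proof -
        have "(\<Sum>i\<in>I'. c i * (\<phi> i b / \<phi> j b * \<phi> j x)) = (\<Sum>i\<in>I'. c i * \<phi> i b) / \<phi> j b * \<phi> j x"
          by (simp add: sum_divide_distrib sum_distrib_right mult.assoc)
        then show ?thesis by (simp add: d_def)
      qed
      finally show ?thesis
        by (simp add: \<phi>'_def right_diff_distrib sum_subtractf)
    qed
    moreover have "(\<Sum>i\<in>I'. c i * \<phi>' i b) = 0"
      using j by (simp add: \<phi>'_def)
    moreover have "\<exists>i\<in>I. d i \<noteq> 0" using c(1) I' by (auto simp: d_def)
    ultimately show ?thesis using c(2) by (intro exI[of _ d]) auto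
  qed
qed

text \<open>The coefficients are normalized so that the largest has absolute value 1. This keeps the
  spread of the weights built from them at least 1, so dividing by the spread later costs
  nothing.\<close>

lemma linear_functionals_relation:
  fixes \<phi> :: "nat \<Rightarrow> 'v::real_vector \<Rightarrow> real"
  assumes "finite B" "card B < M" and lin: "\<And>i. linear (\<phi> i)"
  shows "\<exists>c. (\<exists>i<M. \<bar>c i\<bar> = 1) \<and> (\<forall>i. \<bar>c i\<bar> \<le> 1) \<and>
    (\<forall>v\<in>span B. (\<Sum>i<M. c i * \<phi> i v) = 0)"
proof -
  obtain c where c: "\<exists>i\<in>{..<M}. c i \<noteq> 0" "\<forall>b\<in>B. (\<Sum>i<M. c i * \<phi> i b) = 0"
    using homogeneous_system_nontrivial[OF assms(1), of "{..<M}" \<phi>] assms(2) by auto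
  define m where "m = Max ((\<lambda>i. \<bar>c i\<bar>) ` {..<M})"
  have le: "\<bar>c i\<bar> \<le> m" if "i < M" for i
    unfolding m_def using that by (intro Max_ge) auto
  have "m > 0" using c(1) le by (force intro: less_le_trans)
  have "m \<in> (\<lambda>i. \<bar>c i\<bar>) ` {..<M}"
    unfolding m_def using c(1) by (intro Max_in) auto
  then obtain j where j: "j < M" "\<bar>c j\<bar> = m" by auto
  define d where "d i = (if i < M then c i / m else 0)" for i
  have lin': "linear (\<lambda>v. \<Sum>i<M. d i * \<phi> i v)"
    unfolding real_scaleR_def[symmetric]
    by (intro linear_compose_sum ballI linear_compose_scale_right lin)
  have "(\<Sum>i<M. d i * \<phi> i b) = 0" if "b \<in> B" for b
  proof -
    have "(\<Sum>i<M. d i * \<phi> i b) = (\<Sum>i<M. c i * \<phi> i b) / m"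
      by (simp add: d_def sum_divide_distrib)
    then show ?thesis using c(2) that by simp
  qed
  then have "\<forall>v\<in>span B. (\<Sum>i<M. d i * \<phi> i v) = 0"
    using linear_eq_0_on_span[OF lin'] by blast
  then show ?thesis
    using j \<open>m > 0\<close> le by (intro exI[of _ d]) (auto simp: d_def)
qed

text \<open>The value \<open>a = 0\<close> is included because the weights used later vanish at the
  point that is removed.\<close>

lemma Inf_affine_image:
  fixes f :: "'a \<Rightarrow> real"
  assumes "G \<noteq> {}" "bdd_below (f ` G)" "a \<ge> 0"
  shows "Inf ((\<lambda>g. a * f g + c) ` G) = a * Inf (f ` G) + c"
    and "bdd_below ((\<lambda>g. a * f g + c) ` G)"
proof -
  have low: "a * Inf (f ` G) + c \<le> a * f g + c" if "g \<in> G" for g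
    using cInf_lower[OF _ assms(2)] that assms(3) by (simp add: mult_left_mono)
  then show bdd: "bdd_below ((\<lambda>g. a * f g + c) ` G)"
    by (intro bdd_belowI2)
  show "Inf ((\<lambda>g. a * f g + c) ` G) = a * Inf (f ` G) + c"
  proof (rule antisym)
    show "a * Inf (f ` G) + c \<le> Inf ((\<lambda>g. a * f g + c) ` G)"
      using low assms(1) by (intro cInf_greatest) auto
    show "Inf ((\<lambda>g. a * f g + c) ` G) \<le> a * Inf (f ` G) + c"
    proof (cases "a = 0")
      case True
      then show ?thesis using assms(1) by (simp add: image_constant_conv)
    next
      case False
      then have a: "a > 0" using assms(3) by simp
      have "(Inf ((\<lambda>g. a * f g + c) ` G) - c) / a \<le> Inf (f ` G)"
      proof (rule cInf_greatest)
        fix y assume "y \<in> f ` G"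
        then obtain g where "g \<in> G" "y = f g" by blast
        then show "(Inf ((\<lambda>g. a * f g + c) ` G) - c) / a \<le> y"
          using cInf_lower[OF _ bdd, of "a * f g + c"] a by (simp add: field_simps)
      qed (use assms in simp)
      then show ?thesis using a by (simp add: field_simps)
    qed
  qed
qed

definition bounded_by :: "'i set \<Rightarrow> ('i \<Rightarrow> 'a \<Rightarrow> real) \<Rightarrow> ('i \<Rightarrow> real) \<Rightarrow> 'a set \<Rightarrow> 'a set" where
  "bounded_by I L b J = {q \<in> J. \<forall>i\<in>I. \<bar>L i q\<bar> \<le> b i}"

text \<open>Linearity is asked on \<open>J\<close> only: iterated partial derivatives are additive
  on smooth functions, not on all functions. The facts are applied both to families of jets with
  conditions on pairs of points and to single polynomials with bounds at a point.\<close>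

context
  fixes J :: "'a::real_vector set" and L :: "'i \<Rightarrow> 'a \<Rightarrow> real" and I :: "'i set"
  assumes J: "subspace J"
    and lin: "\<And>i p q u v. i \<in> I \<Longrightarrow> p \<in> J \<Longrightarrow> q \<in> J \<Longrightarrow> L i (u *\<^sub>R p + v *\<^sub>R q) = u * L i p + v * L i q"
begin

lemma bounded_by_scale: "i \<in> I \<Longrightarrow> q \<in> J \<Longrightarrow> L i (c *\<^sub>R q) = c * L i q"
  using lin[of i q q c 0] by simp

lemma convex_bounded_by: "convex (bounded_by I L b J)"
proof (rule convexI)
  fix p q and u v :: real
  assume p: "p \<in> bounded_by I L b J" and q: "q \<in> bounded_by I L b J" and uv: "0 \<le> u" "0 \<le> v" "u + v = 1"
  have "\<bar>L i (u *\<^sub>R p + v *\<^sub>R q)\<bar> \<le> b i" if i: "i \<in> I" for i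
  proof -
    have "\<bar>L i (u *\<^sub>R p + v *\<^sub>R q)\<bar> \<le> u * \<bar>L i p\<bar> + v * \<bar>L i q\<bar>"
      using p q i uv abs_triangle_ineq[of "u * L i p" "v * L i q"] by (simp add: bounded_by_def lin abs_mult)
    also have "\<dots> \<le> u * b i + v * b i"
      using p q i uv by (intro add_mono mult_left_mono) (auto simp: bounded_by_def)
    also have "\<dots> = b i" using uv by (simp flip: distrib_right)
    finally show ?thesis .
  qed
  then show "u *\<^sub>R p + v *\<^sub>R q \<in> bounded_by I L b J"
    using p q J by (simp add: bounded_by_def subspace_add subspace_scale)
qed

lemma uminus_bounded_by: "q \<in> bounded_by I L b J \<Longrightarrow> - q \<in> bounded_by I L b J"
  using J bounded_by_scale[of _ q "-1"] by (auto simp: bounded_by_def subspace_neg)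

lemma absorbing_bounded_by:
  assumes I: "finite I" and b: "\<And>i. i \<in> I \<Longrightarrow> b i > 0" and q: "q \<in> J"
  shows "\<exists>e>0. e *\<^sub>R q \<in> bounded_by I L b J"
proof -
  define e where "e = 1 / (1 + (\<Sum>i\<in>I. \<bar>L i q\<bar> / b i))"
  have "(\<Sum>i\<in>I. \<bar>L i q\<bar> / b i) \<ge> 0" using b by (intro sum_nonneg divide_nonneg_pos) auto
  then have e: "e > 0" by (simp add: e_def)
  have "\<bar>L i (e *\<^sub>R q)\<bar> \<le> b i" if i: "i \<in> I" for i
  proof -
    have "\<bar>L i q\<bar> / b i \<le> (\<Sum>i\<in>I. \<bar>L i q\<bar> / b i)"
      using b I i by (intro member_le_sum divide_nonneg_pos) auto
    also have "\<dots> \<le> 1 / e" by (simp add: e_def)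
    finally show ?thesis using e b[OF i] by (simp add: bounded_by_scale[OF i q] abs_mult field_simps)
  qed
  then show ?thesis using e q J by (intro exI[of _ e]) (simp add: bounded_by_def subspace_scale)
qed

end

section \<open>Abstract cluster systems and the dual estimate\<close>

text \<open>What the dual argument takes from geometry: clusters that split in two, and truncations
  to clusters that stay in \<open>K\<close> up to the factor \<open>A\<close>. Distances no longer
  occur. \<open>K\<close> may be unbounded; the estimates below assume a bound for the functional on
  it.\<close>

locale cluster_system =
  fixes S :: "'p set" and E :: "'v::real_vector set" and K :: "('p \<Rightarrow> 'v) set"
    and \<Q> :: "'p set set" and A :: real
  assumes finite_S: "finite S"
    and subspace_E: "subspace E"
    and convex_K: "convex K"
    and K_nonempty: "K \<noteq> {}"
    and uminus_K: "q \<in> K \<Longrightarrow> - q \<in> K"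
    and K_E: "q \<in> K \<Longrightarrow> x \<in> S \<Longrightarrow> q x \<in> E"
    and A_pos: "A > 0"
    and clusters: "Q \<in> \<Q> \<Longrightarrow> Q \<subseteq> S" "S \<in> \<Q>"
    and singleton_cluster: "x \<in> S \<Longrightarrow> {x} \<in> \<Q>"
    and split_cluster: "Q \<in> \<Q> \<Longrightarrow> 2 \<le> card Q \<Longrightarrow>
          \<exists>Q1\<in>\<Q>. \<exists>Q2\<in>\<Q>. Q1 \<noteq> {} \<and> Q2 \<noteq> {} \<and> Q1 \<inter> Q2 = {} \<and> Q1 \<union> Q2 = Q"
    and cluster_cut: "Q \<in> \<Q> \<Longrightarrow> x \<in> Q \<Longrightarrow> q \<in> K \<Longrightarrow>
          (1 / A) *\<^sub>R (\<lambda>y. if y \<in> Q then q x - q y else 0) \<in> K"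
begin

text \<open>A split of \<open>Q\<close> may leave all of \<open>Q \<inter> T\<close> on one side;
  then the descent continues inside that side. At the first split that really divides
  \<open>T\<close>, the larger part keeps at least half of the points.\<close>

lemma halve_cluster:
  assumes "Q \<in> \<Q>" "2 \<le> card (Q \<inter> T)"
  shows "\<exists>Q'\<in>\<Q>. Q' \<subseteq> Q \<and> Q' \<inter> T \<noteq> Q \<inter> T \<and> card (Q \<inter> T) \<le> 2 * card (Q' \<inter> T)"
  using assms
proof (induction "card Q" arbitrary: Q rule: less_induct)
  case less
  have fin: "finite Q" using clusters(1)[OF less.prems(1)] finite_S finite_subset by blast
  then have "card (Q \<inter> T) \<le> card Q" by (intro card_mono) auto
  then have "2 \<le> card Q" using less.prems(2) by simp
  then obtain Q1 Q2 where
    Q12: "Q1 \<in> \<Q>" "Q2 \<in> \<Q>" "Q1 \<noteq> {}" "Q2 \<noteq> {}" "Q1 \<inter> Q2 = {}" "Q1 \<union> Q2 = Q"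
    using split_cluster[OF less.prems(1)] by blast
  have fin12: "finite Q1" "finite Q2" using fin Q12 by auto
  have sum: "card (Q \<inter> T) = card (Q1 \<inter> T) + card (Q2 \<inter> T)"
    using Q12 fin12 by (subst card_Un_disjoint[symmetric]) (auto intro!: arg_cong[of _ _ card])
  have less12: "card Q1 < card Q" "card Q2 < card Q"
    using Q12 fin by (auto intro!: psubset_card_mono)
  consider "Q1 \<inter> T = {}" | "Q2 \<inter> T = {}" | "Q1 \<inter> T \<noteq> {}" "Q2 \<inter> T \<noteq> {}" by blast
  then show ?case
  proof cases
    case 1
    then have eq: "Q2 \<inter> T = Q \<inter> T" "Q2 \<subseteq> Q" using Q12 by auto
    then obtain Q' where "Q' \<in> \<Q>" "Q' \<subseteq> Q2" "Q' \<inter> T \<noteq> Q \<inter> T" "card (Q \<inter> T) \<le> 2 * card (Q' \<inter> T)"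
      using less.hyps[OF less12(2) Q12(2)] less.prems(2) unfolding eq by blast
    with eq(2) show ?thesis by blast
  next
    case 2
    then have eq: "Q1 \<inter> T = Q \<inter> T" "Q1 \<subseteq> Q" using Q12 by auto
    then obtain Q' where "Q' \<in> \<Q>" "Q' \<subseteq> Q1" "Q' \<inter> T \<noteq> Q \<inter> T" "card (Q \<inter> T) \<le> 2 * card (Q' \<inter> T)"
      using less.hyps[OF less12(1) Q12(1)] less.prems(2) unfolding eq by blast
    with eq(2) show ?thesis by blast
  next
    case 3
    then have "Q1 \<inter> T \<noteq> Q \<inter> T" "Q2 \<inter> T \<noteq> Q \<inter> T" using Q12 by auto
    moreover have "card (Q \<inter> T) \<le> 2 * card (Q1 \<inter> T) \<or> card (Q \<inter> T) \<le> 2 * card (Q2 \<inter> T)"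
      using sum by linarith
    ultimately show ?thesis using Q12 by blast
  qed
qed

text \<open>Each halving lowers the exponent in \<open>2 ^ m < card (Q \<inter> T)\<close> by one,
  so after \<open>m\<close> of them more than one point of \<open>T\<close> is left. Two points
  rather than one matter later, when the extremal points of the weights must avoid a chosen
  \<open>x\<close>.\<close>

lemma cluster_chain:
  assumes "Q \<in> \<Q>" "2 ^ m < card (Q \<inter> T)"
  shows "\<exists>R. R 0 = Q \<and> (\<forall>i\<le>m. R i \<in> \<Q>) \<and>
    (\<forall>i<m. R (Suc i) \<subseteq> R i \<and> R (Suc i) \<inter> T \<noteq> R i \<inter> T) \<and> 2 \<le> card (R m \<inter> T)"
  using assms
proof (induction m arbitrary: Q)
  case 0
  then show ?case by (intro exI[of _ "\<lambda>_. Q"]) auto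
next
  case (Suc m)
  have "(1::nat) \<le> 2 ^ m" by simp
  then have "2 \<le> card (Q \<inter> T)" using Suc.prems(2) unfolding power_Suc by linarith
  then obtain Q' where Q': "Q' \<in> \<Q>" "Q' \<subseteq> Q" "Q' \<inter> T \<noteq> Q \<inter> T" "card (Q \<inter> T) \<le> 2 * card (Q' \<inter> T)"
    using halve_cluster[OF Suc.prems(1)] by blast
  then have "2 ^ m < card (Q' \<inter> T)" using Suc.prems(2) by simp
  then obtain R where R: "R 0 = Q'" "\<forall>i\<le>m. R i \<in> \<Q>"
      "\<forall>i<m. R (Suc i) \<subseteq> R i \<and> R (Suc i) \<inter> T \<noteq> R i \<inter> T" "2 \<le> card (R m \<inter> T)"
    using Suc.IH[OF Q'(1)] by blast
  define R' where "R' = case_nat Q R"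
  have R'_simps: "R' 0 = Q" "\<And>i. R' (Suc i) = R i" by (simp_all add: R'_def)
  have "R' i \<in> \<Q>" if "i \<le> Suc m" for i
    using that Suc.prems R by (cases i) (auto simp: R'_simps)
  moreover have "R' (Suc i) \<subseteq> R' i \<and> R' (Suc i) \<inter> T \<noteq> R' i \<inter> T" if "i < Suc m" for i
    using that Q' R by (cases i) (auto simp: R'_simps)
  ultimately show ?case using R R'_simps by (intro exI[of _ R']) auto
qed

text \<open>The functional \<open>\<Sum>y\<in>T. \<psi> y\<close> is split into two summands which are controlled on \<open>K\<close> and
  have one point less in their supports. With \<open>\<eta> = (\<Sum>i<M. c i * (\<Sum>y\<in>R i \<inter> T. \<psi> y))\<close>
  and \<open>s y = (\<Sum>i | y \<in> R i. c i)\<close>, the family \<open>s y * \<psi> y\<close> minus \<open>\<eta>\<close> at the point \<open>x\<close>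
  evaluates at \<open>q\<close> as \<open>\<Sum>y. \<psi> y\<close> does at a combination of the truncations in
  assumption \<open>cluster_cut\<close>; it is normalized so that its weights range over \<open>[0, 1]\<close>.\<close>

lemma split_functional:
  fixes \<psi> :: "'p \<Rightarrow> 'v \<Rightarrow> real"
  assumes T: "T \<subseteq> S" and lin: "\<And>y. linear (\<psi> y)"
    and bound: "\<And>q. q \<in> K \<Longrightarrow> (\<Sum>y\<in>T. \<psi> y (q y)) \<le> \<nu>"
    and R: "\<And>i. i < M \<Longrightarrow> R i \<in> \<Q>" "\<And>i. i < M \<Longrightarrow> x \<in> R i" and x: "x \<in> T"
    and c: "\<And>i. \<bar>c i\<bar> \<le> 1"
    and \<eta>: "\<And>v. \<eta> v = (\<Sum>i<M. c i * (\<Sum>y\<in>R i \<inter> T. \<psi> y v))"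
    and s: "\<And>y. s y = (\<Sum>i<M. if y \<in> R i then c i else 0)"
    and y12: "y1 \<in> T" "y2 \<in> T" "\<And>y. y \<in> T \<Longrightarrow> s y1 \<le> s y \<and> s y \<le> s y2" "1 \<le> s y2 - s y1"
    and zero: "(y1 \<noteq> x \<and> y2 \<noteq> x) \<or> (\<forall>v\<in>E. \<eta> v = 0)"
  obtains a where "\<And>y. y \<in> T \<Longrightarrow> 0 \<le> a y \<and> a y \<le> 1" "a y1 = 0" "a y2 = 1"
    "\<And>q. q \<in> K \<Longrightarrow> (\<Sum>y\<in>T - {y1}. a y * \<psi> y (q y) - (if y = x then \<eta> (q y) / (s y2 - s y1) else 0)) \<le> real M * (A + 1) * \<nu>"
    "\<And>q. q \<in> K \<Longrightarrow> (\<Sum>y\<in>T - {y2}. (1 - a y) * \<psi> y (q y) + (if y = x then \<eta> (q y) / (s y2 - s y1) else 0)) \<le> real M * (A + 1) * \<nu>"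
proof -
  define D where "D = s y2 - s y1"
  have D: "D \<ge> 1" using y12 by (simp add: D_def)
  have finT: "finite T" using T finite_S finite_subset by blast
  define X where "X q = (\<Sum>y\<in>T. \<psi> y (q y))" for q :: "'p \<Rightarrow> 'v"
  define Y where "Y q = (\<Sum>y\<in>T. s y * \<psi> y (q y)) - \<eta> (q x)" for q :: "'p \<Rightarrow> 'v"
  have Xabs: "\<bar>X q\<bar> \<le> \<nu>" if "q \<in> K" for q
  proof -
    have "X (- q) = - X q"
      by (simp add: X_def linear_neg[OF lin] sum_negf)
    then show ?thesis using bound[OF that] bound[OF uminus_K[OF that]] by (simp add: X_def)
  qed
  have \<nu>: "\<nu> \<ge> 0" using K_nonempty Xabs by (metis abs_ge_zero ex_in_conv order_trans)
  have cut: "\<bar>\<Sum>y\<in>R i \<inter> T. \<psi> y (q x) - \<psi> y (q y)\<bar> \<le> A * \<nu>" if "i < M" "q \<in> K" for i q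
  proof -
    let ?q = "\<lambda>y. if y \<in> R i then q x - q y else 0"
    have "X ((1 / A) *\<^sub>R ?q) = (1 / A) * (\<Sum>y\<in>T. if y \<in> R i then \<psi> y (q x) - \<psi> y (q y) else 0)"
      unfolding X_def sum_distrib_left
      by (intro sum.cong) (auto simp: scaleR_fun_def linear_scale[OF lin] linear_diff[OF lin] linear_0[OF lin])
    also have "(\<Sum>y\<in>T. if y \<in> R i then \<psi> y (q x) - \<psi> y (q y) else 0) = (\<Sum>y\<in>R i \<inter> T. \<psi> y (q x) - \<psi> y (q y))"
      using finT by (subst sum.inter_restrict[symmetric]) (auto simp: Int_commute)
    finally have "(\<Sum>y\<in>R i \<inter> T. \<psi> y (q x) - \<psi> y (q y)) = A * X ((1 / A) *\<^sub>R ?q)"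
      using A_pos by simp
    then show ?thesis
      using Xabs[OF cluster_cut[OF R(1)[OF that(1)] R(2)[OF that(1)] that(2)]] A_pos
      by (simp add: abs_mult)
  qed
  have Yabs: "\<bar>Y q\<bar> \<le> real M * (A * \<nu>)" if "q \<in> K" for q
  proof -
    have "(\<Sum>y\<in>T. s y * \<psi> y (q y)) = (\<Sum>i<M. \<Sum>y\<in>T. if y \<in> R i then c i * \<psi> y (q y) else 0)"
      unfolding s sum_distrib_right by (subst sum.swap) (auto intro!: sum.cong)
    also have "\<dots> = (\<Sum>i<M. c i * (\<Sum>y\<in>R i \<inter> T. \<psi> y (q y)))"
      using finT by (auto simp: sum.inter_restrict sum_distrib_left Int_commute[of _ T] intro!: sum.cong)
    finally have "Y q = (\<Sum>i<M. c i * (\<Sum>y\<in>R i \<inter> T. \<psi> y (q y))) - (\<Sum>i<M. c i * (\<Sum>y\<in>R i \<inter> T. \<psi> y (q x)))"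
      by (simp add: Y_def \<eta>)
    also have "\<dots> = (\<Sum>i<M. - c i * (\<Sum>y\<in>R i \<inter> T. \<psi> y (q x) - \<psi> y (q y)))"
      by (simp add: sum_subtractf sum_negf right_diff_distrib)
    finally have "\<bar>Y q\<bar> \<le> (\<Sum>i<M. \<bar>- c i * (\<Sum>y\<in>R i \<inter> T. \<psi> y (q x) - \<psi> y (q y))\<bar>)"
      by (simp only: sum_abs)
    also have "\<dots> \<le> (\<Sum>i<M. 1 * (A * \<nu>))"
      unfolding abs_mult using c cut[OF _ that] by (intro sum_mono mult_mono) auto
    finally show ?thesis by simp
  qed
  have s_bound: "\<bar>s y\<bar> \<le> real M" for y
  proof -
    have "\<bar>s y\<bar> \<le> (\<Sum>i<M. \<bar>if y \<in> R i then c i else 0\<bar>)" unfolding s by (rule sum_abs)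
    also have "\<dots> \<le> (\<Sum>i<M. 1)" using c by (intro sum_mono) auto
    finally show ?thesis by simp
  qed
  define a where "a y = (s y - s y1) / D" for y
  \<comment> \<open>Subtracting \<open>s y0 * X q\<close> shifts the weights so that the one at
    \<open>y0\<close> vanishes: \<open>y0 = y1\<close> yields the weights \<open>a\<close>, and
    \<open>y0 = y2\<close> yields \<open>- (1 - a)\<close>. Dividing by \<open>D \<ge> 1\<close>
    does not worsen the bound.\<close>
  have fin: "\<bar>Y q - s y0 * X q\<bar> / D \<le> real M * (A + 1) * \<nu>" if q: "q \<in> K" for q y0
  proof -
    have "\<bar>Y q - s y0 * X q\<bar> \<le> \<bar>Y q\<bar> + \<bar>s y0\<bar> * \<bar>X q\<bar>"
      using abs_triangle_ineq4[of "Y q" "s y0 * X q"] by (simp add: abs_mult)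
    also have "\<dots> \<le> real M * (A * \<nu>) + real M * \<nu>"
      using Yabs[OF q] Xabs[OF q] s_bound by (intro add_mono mult_mono) auto
    finally have *: "\<bar>Y q - s y0 * X q\<bar> \<le> real M * (A + 1) * \<nu>" by (simp add: algebra_simps)
    have "\<bar>Y q - s y0 * X q\<bar> / D \<le> \<bar>Y q - s y0 * X q\<bar> / 1"
      using D by (intro divide_left_mono) auto
    then show ?thesis using * by simp
  qed
  have shift: "(Y q - s y0 * X q) / D = (\<Sum>y\<in>T. (s y - s y0) / D * \<psi> y (q y) - (if y = x then \<eta> (q y) / D else 0))" for q y0
  proof -
    have "(\<Sum>y\<in>T. (s y - s y0) / D * \<psi> y (q y) - (if y = x then \<eta> (q y) / D else 0))
        = (\<Sum>y\<in>T. (s y * \<psi> y (q y)) / D - s y0 * \<psi> y (q y) / D) - \<eta> (q x) / D"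
      using finT x by (simp add: sum_subtractf left_diff_distrib diff_divide_distrib)
    also have "\<dots> = (Y q - s y0 * X q) / D"
      by (simp add: Y_def X_def sum_subtractf diff_divide_distrib sum_divide_distrib sum_distrib_left)
    finally show ?thesis by simp
  qed
  have drop: "(\<Sum>y\<in>T. g y) = (\<Sum>y\<in>T - {y0}. g y)" if "y0 \<in> T" "g y0 = 0" for y0 and g :: "'p \<Rightarrow> real"
    using finT that by (simp add: sum.remove)
  \<comment> \<open>Dropping \<open>y1\<close> or \<open>y2\<close> from the support must not drop
    the correction sitting at \<open>x\<close>.\<close>
  have \<eta>0: "(if y = x then \<eta> (q y) / D else 0) = 0" if "y = y1 \<or> y = y2" "q \<in> K" for y q
    using that zero y12 T K_E by auto
  have 1: "(\<Sum>y\<in>T - {y1}. a y * \<psi> y (q y) - (if y = x then \<eta> (q y) / D else 0)) \<le> real M * (A + 1) * \<nu>" if q: "q \<in> K" for q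
  proof -
    have "(\<Sum>y\<in>T - {y1}. a y * \<psi> y (q y) - (if y = x then \<eta> (q y) / D else 0))
        = (\<Sum>y\<in>T. a y * \<psi> y (q y) - (if y = x then \<eta> (q y) / D else 0))"
      using \<eta>0[of y1 q] q y12 by (subst drop[of y1]) (auto simp: a_def)
    also have "\<dots> = (Y q - s y1 * X q) / D" unfolding shift a_def ..
    also have "\<dots> \<le> \<bar>Y q - s y1 * X q\<bar> / D" using D by (intro divide_right_mono) auto
    finally show ?thesis using fin[OF q] by (rule order_trans)
  qed
  have 2: "(\<Sum>y\<in>T - {y2}. (1 - a y) * \<psi> y (q y) + (if y = x then \<eta> (q y) / D else 0)) \<le> real M * (A + 1) * \<nu>" if q: "q \<in> K" for q
  proof -
    have a2: "1 - a y = - ((s y - s y2) / D)" for y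
      using D by (simp add: a_def D_def field_simps)
    have "(\<Sum>y\<in>T - {y2}. (1 - a y) * \<psi> y (q y) + (if y = x then \<eta> (q y) / D else 0))
        = (\<Sum>y\<in>T. (1 - a y) * \<psi> y (q y) + (if y = x then \<eta> (q y) / D else 0))"
      using \<eta>0[of y2 q] q y12 by (subst drop[of y2]) (auto simp: a2)
    also have "\<dots> = - (\<Sum>y\<in>T. (s y - s y2) / D * \<psi> y (q y) - (if y = x then \<eta> (q y) / D else 0))"
      unfolding a2 sum_negf[symmetric] by (intro sum.cong) auto
    also have "\<dots> = - ((Y q - s y2 * X q) / D)" unfolding shift ..
    also have "\<dots> \<le> \<bar>Y q - s y2 * X q\<bar> / D"
      unfolding minus_divide_left using D by (intro divide_right_mono) auto
    finally show ?thesis using fin[OF q] by (rule order_trans)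
  qed
  show ?thesis
  proof (rule that)
    show "0 \<le> a y \<and> a y \<le> 1" if "y \<in> T" for y
      using y12(3)[OF that] D by (auto simp: a_def D_def field_simps)
    show "a y1 = 0" "a y2 = 1" using D by (auto simp: a_def D_def)
  qed (use 1[unfolded D_def] 2[unfolded D_def] in blast)+
qed

text \<open>The index \<open>i\<close> is the depth of \<open>y\<close> in the chain. Nesting makes
  the weight a partial sum of the coefficients, so points at neighbouring depths have weights that
  differ by a single coefficient.\<close>

lemma chain_weight:
  fixes c :: "nat \<Rightarrow> real"
  assumes nested: "\<And>i. i < M \<Longrightarrow> R (Suc i) \<subseteq> R i" and i: "i \<le> M"
    and y: "y \<in> R i" "i < M \<Longrightarrow> y \<notin> R (Suc i)"
  shows "(\<Sum>j<M. if y \<in> R (Suc j) then c j else 0) = (\<Sum>j<i. c j)"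
proof -
  have mono: "R b \<subseteq> R a" if "a \<le> b" "b \<le> M" for a b
    using that nested by (induction b rule: dec_induct) (auto dest!: Suc_le_lessD)
  have "y \<in> R (Suc j) \<longleftrightarrow> j < i" if "j < M" for j
  proof (cases "j < i")
    case True
    then show ?thesis using mono[of "Suc j" i] y(1) i by auto
  next
    case False
    then show ?thesis using mono[of "Suc i" "Suc j"] y(2) that by auto
  qed
  then have "(\<Sum>j<M. if y \<in> R (Suc j) then c j else 0) = (\<Sum>j<M. if j < i then c j else 0)"
    by (intro sum.cong) auto
  also have "\<dots> = (\<Sum>j\<in>{..<M} \<inter> {..<i}. c j)"
    by (simp add: sum.inter_restrict)
  also have "{..<M} \<inter> {..<i} = {..<i}" using i by auto
  finally show ?thesis .
qed

text \<open>The induction step. \<open>\<psi>\<close> is written as \<open>Z1 + Z2\<close>, where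
  each summand gives up one point of the support and the term \<open>\<eta> / D\<close> is moved
  from one to the other at \<open>x\<close>. As \<open>\<eta>\<close> is constant on
  \<open>G x\<close>, the infima add up without loss.\<close>

lemma functional_bound_step:
  fixes \<psi> :: "'p \<Rightarrow> 'v \<Rightarrow> real"
  assumes T: "T \<subseteq> S" and lin: "\<And>y. linear (\<psi> y)"
    and bound: "\<And>q. q \<in> K \<Longrightarrow> (\<Sum>y\<in>T. \<psi> y (q y)) \<le> \<nu>"
    and G: "\<And>y. y \<in> T \<Longrightarrow> G y \<noteq> {} \<and> G y \<subseteq> E \<and> bdd_below (\<psi> y ` G y)"
    and R: "R 0 = S" "\<And>i. i \<le> M \<Longrightarrow> R i \<in> \<Q>"
      "\<And>i. i < M \<Longrightarrow> R (Suc i) \<subseteq> R i \<and> R (Suc i) \<inter> T \<noteq> R i \<inter> T"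
    and x: "x \<in> R M \<inter> T"
    and B: "finite B" "card B < M"
    and cases: "(2 \<le> card (R M \<inter> T) \<and> (\<forall>g\<in>G x. \<forall>g'\<in>G x. g - g' \<in> span B)) \<or> E \<subseteq> span B"
    and IH: "\<And>T' \<psi>' \<nu>'. T' \<subset> T \<Longrightarrow> (\<And>y. linear (\<psi>' y)) \<Longrightarrow>
        (\<And>q. q \<in> K \<Longrightarrow> (\<Sum>y\<in>T'. \<psi>' y (q y)) \<le> \<nu>') \<Longrightarrow>
        (\<And>y. y \<in> T' \<Longrightarrow> bdd_below (\<psi>' y ` G y)) \<Longrightarrow>
        (\<Sum>y\<in>T'. Inf (\<psi>' y ` G y)) \<le> C ^ card T' * \<nu>'"
  shows "(\<Sum>y\<in>T. Inf (\<psi> y ` G y)) \<le> 2 * C ^ (card T - 1) * (real M * (A + 1) * \<nu>)"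
proof -
  have finT: "finite T" using T finite_S finite_subset by blast
  \<comment> \<open>\<open>R 0 = S\<close> is left out, as it would give every point of
    \<open>T\<close> the same weight; the \<open>M\<close> functionals belong to
    \<open>R 1, ..., R M\<close>.\<close>
  define \<phi> where "\<phi> i v = (\<Sum>y\<in>R (Suc i) \<inter> T. \<psi> y v)" for i v
  have lin\<phi>: "linear (\<phi> i)" for i
    unfolding \<phi>_def by (intro linear_compose_sum ballI lin)
  obtain c where c: "\<exists>i<M. \<bar>c i\<bar> = 1" "\<And>i. \<bar>c i\<bar> \<le> 1"
      "\<And>v. v \<in> span B \<Longrightarrow> (\<Sum>i<M. c i * \<phi> i v) = 0"
    using linear_functionals_relation[of B M \<phi>, OF B lin\<phi>] by blast
  define \<eta> where "\<eta> v = (\<Sum>i<M. c i * (\<Sum>y\<in>R (Suc i) \<inter> T. \<psi> y v))" for v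
  have \<eta>_alt: "\<eta> = (\<lambda>v. \<Sum>i<M. c i * \<phi> i v)" by (simp add: fun_eq_iff \<eta>_def \<phi>_def)
  have lin\<eta>: "linear \<eta>"
    unfolding \<eta>_alt real_scaleR_def[symmetric]
    by (intro linear_compose_sum ballI linear_compose_scale_right lin\<phi>)
  have \<eta>0: "\<eta> v = 0" if "v \<in> span B" for v
    using c(3)[OF that] by (simp add: \<eta>_alt)
  define s where "s y = (\<Sum>i<M. if y \<in> R (Suc i) then c i else 0)" for y
  have weight: "s y = (\<Sum>j<i. c j)" if "i \<le> M" "y \<in> R i" "i < M \<Longrightarrow> y \<notin> R (Suc i)" for i y
    unfolding s_def by (rule chain_weight) (use R that in auto)
  have mono: "R b \<subseteq> R a" if "a \<le> b" "b \<le> M" for a b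
    using that R(3) by (induction b rule: dec_induct) (auto dest!: Suc_le_lessD)
  \<comment> \<open>Every step of the chain loses a point of \<open>T\<close>, so each depth up to
    \<open>M\<close> is occupied by a point of \<open>T\<close>.\<close>
  have attained: "\<exists>y\<in>T. s y = (\<Sum>j<i. c j)" if "i \<le> M" for i
  proof (cases "i = M")
    case True
    then show ?thesis using weight[of M x] x by auto
  next
    case False
    then have "i < M" using that by simp
    then obtain y where "y \<in> R i \<inter> T" "y \<notin> R (Suc i)" using R(3)[of i] by blast
    then show ?thesis using weight[of i y] that by auto
  qed
  obtain y1' where y1': "y1' \<in> T" "\<And>y. y \<in> T \<Longrightarrow> s y1' \<le> s y"
    using Min_in[of "s ` T"] Min_le[of "s ` T"] finT x by (metis IntD2 empty_iff finite_imageI image_iff image_is_empty)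
  obtain y2' where y2': "y2' \<in> T" "\<And>y. y \<in> T \<Longrightarrow> s y \<le> s y2'"
    using Max_in[of "s ` T"] Max_ge[of "s ` T"] finT x by (metis IntD2 empty_iff finite_imageI image_iff image_is_empty)
  \<comment> \<open>A second point of \<open>T\<close> in \<open>R M\<close> has the same weight as
    \<open>x\<close> and can replace it as an extremal point. If
    \<open>E \<subseteq> span B\<close>, the correction vanishes on \<open>E\<close> and
    \<open>x\<close> itself may be extremal.\<close>
  obtain x' where x': "x' \<in> T" "s x' = s x" "x' \<noteq> x \<or> E \<subseteq> span B"
  proof (cases "E \<subseteq> span B")
    case True
    then show ?thesis using that[of x] x by auto
  next
    case False
    then have "2 \<le> card (R M \<inter> T)" using cases by simp
    then have "R M \<inter> T \<noteq> {x}" by auto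
    then obtain x' where "x' \<in> R M \<inter> T" "x' \<noteq> x" using x by blast
    then show ?thesis using that[of x'] weight[of M x] weight[of M x'] x by auto
  qed
  define y1 where "y1 = (if y1' = x then x' else y1')"
  define y2 where "y2 = (if y2' = x then x' else y2')"
  have y12: "y1 \<in> T" "y2 \<in> T" "\<And>y. y \<in> T \<Longrightarrow> s y1 \<le> s y \<and> s y \<le> s y2"
    using y1' y2' x' by (auto simp: y1_def y2_def)
  \<comment> \<open>An index with \<open>\<bar>c i\<bar> = 1\<close> separates two neighbouring
    depths.\<close>
  have D: "1 \<le> s y2 - s y1"
  proof -
    obtain i where i: "i < M" "\<bar>c i\<bar> = 1" using c(1) by blast
    obtain u v where uv: "u \<in> T" "s u = (\<Sum>j<i. c j)" "v \<in> T" "s v = (\<Sum>j<Suc i. c j)"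
      using attained[of i] attained[of "Suc i"] i(1) by (auto simp: Suc_le_eq)
    then have "s v - s u = c i" by simp
    then show ?thesis using i(2) y12(3)[OF uv(1)] y12(3)[OF uv(3)] by linarith
  qed
  have zero: "(y1 \<noteq> x \<and> y2 \<noteq> x) \<or> (\<forall>v\<in>E. \<eta> v = 0)"
    using x'(3) \<eta>0 by (auto simp: y1_def y2_def)
  obtain a where a: "\<And>y. y \<in> T \<Longrightarrow> 0 \<le> a y \<and> a y \<le> 1" "a y1 = 0" "a y2 = 1"
    "\<And>q. q \<in> K \<Longrightarrow> (\<Sum>y\<in>T - {y1}. a y * \<psi> y (q y) - (if y = x then \<eta> (q y) / (s y2 - s y1) else 0)) \<le> real M * (A + 1) * \<nu>"
    "\<And>q. q \<in> K \<Longrightarrow> (\<Sum>y\<in>T - {y2}. (1 - a y) * \<psi> y (q y) + (if y = x then \<eta> (q y) / (s y2 - s y1) else 0)) \<le> real M * (A + 1) * \<nu>"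
  proof (rule split_functional[of T \<psi> \<nu> M "\<lambda>i. R (Suc i)" x c \<eta> s y1 y2])
    show "x \<in> R (Suc i)" if "i < M" for i using x mono[of "Suc i" M] that by auto
  qed (use T lin bound R x c \<eta>_def s_def y12 D zero in auto)
  define D where "D = s y2 - s y1"
  define Z1 where "Z1 y v = a y * \<psi> y v - (if y = x then \<eta> v / D else 0)" for y v
  define Z2 where "Z2 y v = (1 - a y) * \<psi> y v + (if y = x then \<eta> v / D else 0)" for y v
  have linZ: "linear (Z1 y)" "linear (Z2 y)" for y
  proof -
    have *: "linear (\<lambda>v. b * \<psi> y v)" "linear (\<lambda>v. if y = x then \<eta> v / D else 0)" for b
      using linear_compose_scale_right[OF lin[of y], of b] linear_compose_scale_right[OF lin\<eta>, of "1 / D"]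
      by (auto simp: linear_iff)
    show "linear (Z1 y)" "linear (Z2 y)"
      unfolding Z1_def Z2_def by (intro linear_compose_sub linear_compose_add *)+
  qed
  obtain g0 where g0: "g0 \<in> G x" using G x by blast
  have const: "\<eta> g = \<eta> g0" if "g \<in> G x" for g
  proof -
    from cases have "g - g0 \<in> span B"
    proof
      assume "E \<subseteq> span B"
      then have "g \<in> span B" "g0 \<in> span B" using that g0 G[of x] x by auto
      then show ?thesis by (rule span_diff)
    qed (use that g0 in blast)
    then show ?thesis using \<eta>0[of "g - g0"] by (simp add: linear_diff[OF lin\<eta>])
  qed
  \<comment> \<open>The shifts of the two infima by \<open>- e\<close> and \<open>e\<close> cancel
    in the sum.\<close>
  define e where "e y = (if y = x then \<eta> g0 / D else 0)" for y
  have im1: "Z1 y ` G y = (\<lambda>g. a y * \<psi> y g + - e y) ` G y" for y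
    using const by (intro image_cong) (auto simp: Z1_def e_def)
  have im2: "Z2 y ` G y = (\<lambda>g. (1 - a y) * \<psi> y g + e y) ` G y" for y
    using const by (intro image_cong) (auto simp: Z2_def e_def)
  have Inf1: "Inf (Z1 y ` G y) = a y * Inf (\<psi> y ` G y) + - e y" "bdd_below (Z1 y ` G y)" if "y \<in> T" for y
  proof -
    have *: "G y \<noteq> {}" "bdd_below (\<psi> y ` G y)" "0 \<le> a y" using G[OF that] a(1)[OF that] by auto
    show "Inf (Z1 y ` G y) = a y * Inf (\<psi> y ` G y) + - e y" "bdd_below (Z1 y ` G y)"
      unfolding im1 by (rule Inf_affine_image[OF *])+
  qed
  have Inf2: "Inf (Z2 y ` G y) = (1 - a y) * Inf (\<psi> y ` G y) + e y" "bdd_below (Z2 y ` G y)" if "y \<in> T" for y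
  proof -
    have *: "G y \<noteq> {}" "bdd_below (\<psi> y ` G y)" "0 \<le> 1 - a y" using G[OF that] a(1)[OF that] by auto
    show "Inf (Z2 y ` G y) = (1 - a y) * Inf (\<psi> y ` G y) + e y" "bdd_below (Z2 y ` G y)"
      unfolding im2 by (rule Inf_affine_image[OF *])+
  qed
  have e0: "e y1 = 0" "e y2 = 0"
    using zero G[of x] g0 x by (auto simp: e_def)
  have "(\<Sum>y\<in>T. Inf (\<psi> y ` G y)) = (\<Sum>y\<in>T. Inf (Z1 y ` G y)) + (\<Sum>y\<in>T. Inf (Z2 y ` G y))"
    unfolding sum.distrib[symmetric] by (intro sum.cong) (auto simp: Inf1 Inf2 algebra_simps)
  also have "(\<Sum>y\<in>T. Inf (Z1 y ` G y)) = (\<Sum>y\<in>T - {y1}. Inf (Z1 y ` G y))"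
    using finT y12(1) by (simp add: sum.remove[of T y1] Inf1 a(2) e0)
  also have "\<dots> \<le> C ^ card (T - {y1}) * (real M * (A + 1) * \<nu>)"
    using a(4)[folded D_def, folded Z1_def] y12(1) by (intro IH linZ Inf1(2)) auto
  also have "(\<Sum>y\<in>T. Inf (Z2 y ` G y)) = (\<Sum>y\<in>T - {y2}. Inf (Z2 y ` G y))"
    using finT y12(2) by (simp add: sum.remove[of T y2] Inf2 a(3) e0)
  also have "\<dots> \<le> C ^ card (T - {y2}) * (real M * (A + 1) * \<nu>)"
    using a(5)[folded D_def, folded Z2_def] y12(2) by (intro IH linZ Inf2(2)) auto
  finally show ?thesis using y12 finT by (simp add: mult_ac)
qed

text \<open>Beyond \<open>2 ^ m\<close> points, each reduction of the support costs a factor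
  \<open>2 * (m + 1) * (A + 1)\<close>: two summands, at most \<open>m + 1\<close> clusters, and
  \<open>A + 1\<close> for a truncation together with the shift of the weights.\<close>

lemma functional_bound:
  fixes \<psi> :: "'p \<Rightarrow> 'v \<Rightarrow> real"
  assumes G: "\<And>y. y \<in> S \<Longrightarrow> G y \<noteq> {} \<and> G y \<subseteq> E"
    and sel: "\<And>S'. S' \<subseteq> S \<Longrightarrow> card S' \<le> 2 ^ m \<Longrightarrow> \<exists>q\<in>K. \<forall>x\<in>S'. q x \<in> G x"
    and dim: "(\<forall>x\<in>S. \<exists>B. finite B \<and> card B < m \<and> (\<forall>g\<in>G x. \<forall>g'\<in>G x. g - g' \<in> span B)) \<or>
       (\<exists>B. finite B \<and> card B \<le> m \<and> E \<subseteq> span B)"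
    and "T \<subseteq> S" "\<And>y. linear (\<psi> y)"
    and "\<And>q. q \<in> K \<Longrightarrow> (\<Sum>y\<in>T. \<psi> y (q y)) \<le> \<nu>"
    and "\<And>y. y \<in> T \<Longrightarrow> bdd_below (\<psi> y ` G y)"
  shows "(\<Sum>y\<in>T. Inf (\<psi> y ` G y)) \<le> (2 * (real m + 1) * (A + 1)) ^ card T * \<nu>"
  using assms(4-)
proof (induction "card T" arbitrary: T \<psi> \<nu> rule: less_induct)
  case less
  define C where "C = 2 * (real m + 1) * (A + 1)"
  have finT: "finite T" using less.prems(1) finite_S finite_subset by blast
  have "1 * 1 \<le> (2 * (real m + 1)) * (A + 1)" using A_pos by (intro mult_mono) auto
  then have C1: "C \<ge> 1" by (simp add: C_def)
  have \<nu>: "\<nu> \<ge> 0"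
  proof -
    obtain q where q: "q \<in> K" using K_nonempty by blast
    have "(\<Sum>y\<in>T. \<psi> y ((- q) y)) = - (\<Sum>y\<in>T. \<psi> y (q y))"
      by (simp add: linear_neg[OF less.prems(2)] sum_negf)
    then show ?thesis using less.prems(3)[OF q] less.prems(3)[OF uminus_K[OF q]] by linarith
  qed
  have IH: "(\<Sum>y\<in>T'. Inf (\<psi>' y ` G y)) \<le> C ^ card T' * \<nu>'"
    if "T' \<subset> T" "\<And>y. linear (\<psi>' y)" "\<And>q. q \<in> K \<Longrightarrow> (\<Sum>y\<in>T'. \<psi>' y (q y)) \<le> \<nu>'"
      "\<And>y. y \<in> T' \<Longrightarrow> bdd_below (\<psi>' y ` G y)" for T' \<psi>' \<nu>'
    unfolding C_def using that less.prems(1) psubset_card_mono[OF finT that(1)]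
    by (intro less.hyps) auto
  show ?case
  proof (cases "card T \<le> 2 ^ m")
    case True
    then obtain q where q: "q \<in> K" "\<And>x. x \<in> T \<Longrightarrow> q x \<in> G x" using sel[OF less.prems(1)] by blast
    have "(\<Sum>y\<in>T. Inf (\<psi> y ` G y)) \<le> (\<Sum>y\<in>T. \<psi> y (q y))"
      using q less.prems(4) by (intro sum_mono cInf_lower) auto
    also have "\<dots> \<le> 1 * \<nu>" using less.prems(3)[OF q(1)] by simp
    also have "\<dots> \<le> C ^ card T * \<nu>"
      using C1 \<nu> by (intro mult_right_mono one_le_power)
    finally show ?thesis by (simp add: C_def)
  next
    case False
    have ST: "S \<inter> T = T" using less.prems(1) by blast
    obtain R where R: "R 0 = S" "\<forall>i\<le>m. R i \<in> \<Q>"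
      "\<forall>i<m. R (Suc i) \<subseteq> R i \<and> R (Suc i) \<inter> T \<noteq> R i \<inter> T" "2 \<le> card (R m \<inter> T)"
      using cluster_chain[OF clusters(2), of m T] False unfolding ST by auto
    have "R m \<inter> T \<noteq> {}" using R(4) by auto
    then obtain x where x: "x \<in> R m \<inter> T" by blast
    have xS: "x \<in> S" using x less.prems(1) by blast
    have bounds: "G y \<noteq> {} \<and> G y \<subseteq> E \<and> bdd_below (\<psi> y ` G y)" if "y \<in> T" for y
      using that G[of y] less.prems(1) less.prems(4)[OF that] by auto
    from dim have "\<exists>M\<le>m + 1. (\<Sum>y\<in>T. Inf (\<psi> y ` G y)) \<le> 2 * C ^ (card T - 1) * (real M * (A + 1) * \<nu>)"
    proof
      assume "\<forall>x\<in>S. \<exists>B. finite B \<and> card B < m \<and> (\<forall>g\<in>G x. \<forall>g'\<in>G x. g - g' \<in> span B)"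
      then obtain B where B: "finite B" "card B < m" "\<forall>g\<in>G x. \<forall>g'\<in>G x. g - g' \<in> span B"
        using xS by blast
      have "(\<Sum>y\<in>T. Inf (\<psi> y ` G y)) \<le> 2 * C ^ (card T - 1) * (real m * (A + 1) * \<nu>)"
        by (rule functional_bound_step[where R = R and x = x and B = B])
          (use less.prems bounds R x B IH in auto)
      then show ?thesis by (intro exI[of _ m]) auto
    next
      assume "\<exists>B. finite B \<and> card B \<le> m \<and> E \<subseteq> span B"
      then obtain B where B: "finite B" "card B \<le> m" "E \<subseteq> span B" by blast
      \<comment> \<open>Here \<open>B\<close> may have \<open>m\<close> elements, so
        \<open>m + 1\<close> functionals are needed while the chain supplies \<open>m\<close>. The
        singleton \<open>{x}\<close> is a strict further step because \<open>R m\<close> holds two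
        points of \<open>T\<close>.\<close>
      define R' where "R' = R(Suc m := {x})"
      have R': "R' i = R i" if "i \<le> m" for i using that by (auto simp: R'_def)
      have "card {x} \<noteq> card (R m \<inter> T)" using R(4) by simp
      then have "{x} \<noteq> R m \<inter> T" by metis
      then have last: "R' (Suc m) \<subseteq> R' m \<and> R' (Suc m) \<inter> T \<noteq> R' m \<inter> T" 
        using x by (auto simp: R'_def)
      have "R' (Suc i) \<subseteq> R' i \<and> R' (Suc i) \<inter> T \<noteq> R' i \<inter> T" if "i < Suc m" for i
        using that last R(3) R'[of i] R'[of "Suc i"] by (cases "i = m") auto
      moreover have "R' i \<in> \<Q>" if "i \<le> Suc m" for i
        using that R(2) R' singleton_cluster[OF xS] by (cases "i = Suc m") (auto simp: R'_def)
      ultimately have "(\<Sum>y\<in>T. Inf (\<psi> y ` G y)) \<le> 2 * C ^ (card T - 1) * (real (Suc m) * (A + 1) * \<nu>)"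
        by (intro functional_bound_step[where R = R' and x = x and B = B])
          (use less.prems bounds R R' x B IH in \<open>auto simp: R'_def\<close>)
      then show ?thesis by (intro exI[of _ "Suc m"]) auto
    qed
    then obtain M where M: "M \<le> m + 1"
      "(\<Sum>y\<in>T. Inf (\<psi> y ` G y)) \<le> 2 * C ^ (card T - 1) * (real M * (A + 1) * \<nu>)" by blast
    note M(2)
    also have "2 * C ^ (card T - 1) * (real M * (A + 1) * \<nu>)
        \<le> 2 * C ^ (card T - 1) * ((real m + 1) * (A + 1) * \<nu>)"
      using M(1) \<nu> A_pos C1 by (intro mult_left_mono mult_right_mono) auto
    also have "\<dots> = C ^ Suc (card T - 1) * \<nu>" by (simp add: C_def)
    also have "card T > 0" using x finT by (auto simp: card_gt_0_iff)
    then have "Suc (card T - 1) = card T" by simp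
    finally show ?thesis by (simp add: C_def)
  qed
qed

lemma selection_from_small_subsets:
  assumes J: "J = {q. (\<forall>x\<in>S. q x \<in> E) \<and> (\<forall>x. x \<notin> S \<longrightarrow> q x = 0)}"
    and fin_dim: "finite B0" "E = span B0"
    and K_J: "K \<subseteq> J"
    and absorbing: "\<And>q. q \<in> J \<Longrightarrow> \<exists>e>0. e *\<^sub>R q \<in> K"
    and G: "\<And>y. y \<in> S \<Longrightarrow> G y \<subseteq> E \<and> convex (G y)"
    and sel: "\<And>S'. S' \<subseteq> S \<Longrightarrow> card S' \<le> 2 ^ m \<Longrightarrow> \<exists>q\<in>K. \<forall>x\<in>S'. q x \<in> G x"
    and dim: "(\<forall>x\<in>S. \<exists>B. finite B \<and> card B < m \<and> (\<forall>g\<in>G x. \<forall>g'\<in>G x. g - g' \<in> span B)) \<or>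
       (\<exists>B. finite B \<and> card B \<le> m \<and> E \<subseteq> span B)"
    and C: "C > (2 * (real m + 1) * (A + 1)) ^ card S" "C > 0"
  shows "\<exists>q. (1 / C) *\<^sub>R q \<in> K \<and> (\<forall>x\<in>S. q x \<in> G x)"
proof (rule ccontr)
  assume none: "\<not> ?thesis"
  have Gne: "G y \<noteq> {}" if "y \<in> S" for y
    using sel[of "{y}"] that by auto
  define P where "P = {q \<in> J. \<forall>x\<in>S. q x \<in> G x}"
  \<comment> \<open>A selection without any compatibility between points; it serves as a base
    point.\<close>
  define sel0 where "sel0 y = (if y \<in> S then (SOME g. g \<in> G y) else 0)" for y
  have sel0: "sel0 \<in> P" using Gne G by (fastforce simp: P_def J sel0_def some_in_eq)
  define single where "single x v = (\<lambda>y. if y = x then v else 0)" for x :: 'p and v :: 'v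
  have Jsub: "subspace J"
    unfolding J using subspace_E by (auto simp: subspace_def scaleR_fun_def)
  have sum_single: "q = (\<Sum>x\<in>S. single x (q x))" if "q \<in> J" for q
    using that finite_S by (auto simp: fun_eq_iff J single_def sum_fun_apply)
  obtain B where B: "finite B" "J = span B"
  proof
    define B1 where "B1 = (\<lambda>(x, b). single x b) ` (S \<times> B0)"
    show "finite B1" using finite_S fin_dim by (simp add: B1_def)
    have lin_single: "linear (single x)" for x
      by (auto simp: linear_iff single_def fun_eq_iff scaleR_fun_def)
    have "single x v \<in> span B1" if "x \<in> S" "v \<in> E" for x v
    proof -
      have "single x v \<in> single x ` span B0" using that fin_dim by blast
      also have "\<dots> = span (single x ` B0)" by (rule linear_span_image[OF lin_single, symmetric])
      also have "\<dots> \<subseteq> span B1" using that by (intro span_mono) (auto simp: B1_def)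
      finally show ?thesis .
    qed
    then have "q \<in> span B1" if "q \<in> J" for q
      using that by (subst sum_single[OF that]) (auto simp: J intro!: span_sum)
    then have "J \<subseteq> span B1" by blast
    moreover have "span B1 \<subseteq> J"
      by (rule span_minimal[OF _ Jsub]) (use fin_dim subspace_0[OF subspace_E] in \<open>auto simp: B1_def J single_def span_base\<close>)
    ultimately show "J = span B1" by (rule equalityI)
  qed
  \<comment> \<open>No selection lies in \<open>C * K\<close>, that is, 0 is not in
    \<open>C * K - P\<close>. The shift by \<open>sel0\<close> puts \<open>C * K\<close> itself
    inside the set, so that it absorbs \<open>J\<close>.\<close>
  define N where "N = {C *\<^sub>R k - p + sel0 | k p. k \<in> K \<and> p \<in> P}"
  have CK: "C *\<^sub>R k \<in> N" if "k \<in> K" for k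
    using that sel0 unfolding N_def by force
  have Pconv: "convex P"
  proof (rule convexI)
    fix p q and u v :: real assume *: "p \<in> P" "q \<in> P" "0 \<le> u" "0 \<le> v" "u + v = 1"
    then have "u *\<^sub>R p + v *\<^sub>R q \<in> J" using Jsub by (simp add: P_def subspace_add subspace_scale)
    moreover have "u *\<^sub>R p x + v *\<^sub>R q x \<in> G x" if "x \<in> S" for x
      using * that G by (intro convexD) (auto simp: P_def)
    ultimately show "u *\<^sub>R p + v *\<^sub>R q \<in> P" by (simp add: P_def scaleR_fun_def)
  qed
  have Nconv: "convex N"
  proof (rule convexI)
    fix x y and u v :: real assume xy: "x \<in> N" "y \<in> N" and uv: "0 \<le> u" "0 \<le> v" "u + v = 1"
    then obtain k p k' p' where kp: "x = C *\<^sub>R k - p + sel0" "y = C *\<^sub>R k' - p' + sel0"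
      "k \<in> K" "p \<in> P" "k' \<in> K" "p' \<in> P" by (auto simp: N_def)
    have "u *\<^sub>R sel0 + v *\<^sub>R sel0 = sel0" using uv by (simp flip: scaleR_add_left)
    then have "u *\<^sub>R x + v *\<^sub>R y = C *\<^sub>R (u *\<^sub>R k + v *\<^sub>R k') - (u *\<^sub>R p + v *\<^sub>R p') + sel0"
      by (simp add: kp algebra_simps)
    moreover have "u *\<^sub>R k + v *\<^sub>R k' \<in> K" "u *\<^sub>R p + v *\<^sub>R p' \<in> P"
      using kp uv convex_K Pconv by (auto intro: convexD)
    ultimately show "u *\<^sub>R x + v *\<^sub>R y \<in> N" unfolding N_def by blast
  qed
  have PJ: "P \<subseteq> J" by (auto simp: P_def)
  have NJ: "N \<subseteq> J"
    using K_J PJ sel0 Jsub by (auto simp: N_def intro!: subspace_add subspace_diff subspace_scale)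
  have Nabs: "\<exists>e>0. e *\<^sub>R q \<in> N" if q: "q \<in> J" for q
  proof -
    obtain e where "e > 0" "e *\<^sub>R q \<in> K" using absorbing[OF q] by blast
    then show ?thesis using CK[of "e *\<^sub>R q"] C by (intro exI[of _ "C * e"]) auto
  qed
  have "sel0 \<notin> N"
  proof
    assume "sel0 \<in> N"
    then obtain k p where kp: "k \<in> K" "p \<in> P" "sel0 = C *\<^sub>R k - p + sel0" by (auto simp: N_def)
    then have "p = C *\<^sub>R k" by (simp add: algebra_simps)
    then have "(1 / C) *\<^sub>R p \<in> K" using kp C by simp
    then show False using none kp(2) by (auto simp: P_def)
  qed
  then obtain f where f: "linear f" "\<And>q. q \<in> N \<Longrightarrow> f q \<le> (1::real)" "f sel0 \<ge> 1"
    using separate_point_from_absorbing_convex[OF B Nconv NJ Nabs, of sel0] PJ sel0 by blast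
  have sep: "C * f k \<le> f p" if "k \<in> K" "p \<in> P" for k p
  proof -
    have "C *\<^sub>R k - p + sel0 \<in> N" using that by (auto simp: N_def)
    from f(2)[OF this] have "C * f k - f p + f sel0 \<le> 1"
      by (simp add: linear_add[OF f(1)] linear_diff[OF f(1)] linear_scale[OF f(1)])
    then show ?thesis using f(3) by simp
  qed
  define \<psi> where "\<psi> y v = f (single y v)" for y v
  have lin: "linear (\<psi> y)" for y
  proof -
    have "single y (u + v) = single y u + single y v" "single y (r *\<^sub>R u) = r *\<^sub>R single y u" for u v r
      by (auto simp: single_def fun_eq_iff scaleR_fun_def)
    then show ?thesis by (simp add: linear_iff \<psi>_def linear_add[OF f(1)] linear_scale[OF f(1)])
  qed
  have f_sum: "f q = (\<Sum>y\<in>S. \<psi> y (q y))" if "q \<in> J" for q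
    by (subst sum_single[OF that]) (simp add: \<psi>_def linear_sum[OF f(1)])
  \<comment> \<open>The supremum is finite since \<open>C * f k \<le> f sel0\<close> on
    \<open>K\<close>, and positive since \<open>f sel0 \<ge> 1\<close> and \<open>K\<close> absorbs
    \<open>sel0\<close>.\<close>
  define \<nu> where "\<nu> = (SUP k\<in>K. f k)"
  have bddK: "bdd_above (f ` K)"
    using sep[OF _ sel0] C by (intro bdd_aboveI2[where M = "f sel0 / C"]) (simp add: field_simps)
  have le\<nu>: "f k \<le> \<nu>" if "k \<in> K" for k
    unfolding \<nu>_def by (rule cSUP_upper[OF that bddK])
  have "\<nu> > 0"
  proof -
    obtain e where "e > 0" "e *\<^sub>R sel0 \<in> K" using absorbing PJ sel0 by blast
    then have "0 < e * f sel0" "e * f sel0 \<le> \<nu>"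
      using f(3) le\<nu>[of "e *\<^sub>R sel0"] by (auto simp: linear_scale[OF f(1)])
    then show ?thesis by linarith
  qed
  have C\<nu>: "C * \<nu> \<le> f p" if "p \<in> P" for p
  proof -
    have "\<nu> \<le> f p / C"
      unfolding \<nu>_def using K_nonempty sep[OF _ that] C by (intro cSUP_least) (auto simp: field_simps)
    then show ?thesis using C by (simp add: field_simps)
  qed
  \<comment> \<open>Changing a selection at a single point stays within \<open>P\<close>; this
    isolates \<open>\<psi> y\<close> and bounds it below on \<open>G y\<close>.\<close>
  have upd: "sel0(y := g) \<in> P" if "y \<in> S" "g \<in> G y" for y g
    using sel0 that G by (auto simp: P_def J)
  have f_upd: "f (p(y := g)) = f p - \<psi> y (p y) + \<psi> y g" if "p \<in> P" "p(y := g) \<in> P" "y \<in> S" for p y g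
  proof -
    have "(\<Sum>z\<in>S - {y}. \<psi> z ((p(y := g)) z)) = (\<Sum>z\<in>S - {y}. \<psi> z (p z))"
      by (intro sum.cong) auto
    then show ?thesis using that PJ finite_S by (simp add: f_sum subset_iff sum.remove[of S y])
  qed
  have bddG: "bdd_below (\<psi> y ` G y)" if "y \<in> S" for y
  proof (rule bdd_belowI2)
    fix g assume "g \<in> G y"
    then show "C * \<nu> - f sel0 + \<psi> y (sel0 y) \<le> \<psi> y g"
      using C\<nu>[OF upd[OF that]] f_upd[OF sel0 upd[OF that] that] by fastforce
  qed
  \<comment> \<open>The sets \<open>G y\<close> are independent of each other, so near-minimizers
    chosen point by point form an element of \<open>P\<close>.\<close>
  have "C * \<nu> \<le> (\<Sum>y\<in>S. Inf (\<psi> y ` G y))"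
  proof (rule field_le_epsilon)
    fix \<epsilon> :: real assume \<epsilon>: "\<epsilon> > 0"
    define \<delta> where "\<delta> = \<epsilon> / (real (card S) + 1)"
    have \<delta>: "\<delta> > 0" using \<epsilon> by (simp add: \<delta>_def)
    have "\<exists>g\<in>G y. \<psi> y g < Inf (\<psi> y ` G y) + \<delta>" if "y \<in> S" for y
      using cInf_lessD[of "\<psi> y ` G y" "Inf (\<psi> y ` G y) + \<delta>"] Gne[OF that] \<delta> by auto
    then obtain g where g: "\<And>y. y \<in> S \<Longrightarrow> g y \<in> G y \<and> \<psi> y (g y) < Inf (\<psi> y ` G y) + \<delta>" by metis
    define p where "p y = (if y \<in> S then g y else 0)" for y
    have p: "p \<in> P" using g G by (fastforce simp: P_def J p_def)
    have "C * \<nu> \<le> f p" by (rule C\<nu>[OF p])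
    also have "\<dots> = (\<Sum>y\<in>S. \<psi> y (g y))" using p PJ by (subst f_sum) (auto simp: p_def)
    also have "\<dots> \<le> (\<Sum>y\<in>S. Inf (\<psi> y ` G y) + \<delta>)" using g by (intro sum_mono) (simp add: less_imp_le)
    also have "\<dots> = (\<Sum>y\<in>S. Inf (\<psi> y ` G y)) + real (card S) * \<delta>" by (simp add: sum.distrib)
    also have "real (card S) * \<delta> \<le> \<epsilon>" using \<epsilon> by (simp add: \<delta>_def field_simps)
    finally show "C * \<nu> \<le> (\<Sum>y\<in>S. Inf (\<psi> y ` G y)) + \<epsilon>" by simp
  qed
  also have "\<dots> \<le> (2 * (real m + 1) * (A + 1)) ^ card S * \<nu>"
    by (rule functional_bound[OF _ sel dim])
      (use G Gne lin bddG le\<nu> f_sum K_J in \<open>auto simp: subset_iff\<close>)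
  finally show False using C \<open>\<nu> > 0\<close> by simp
qed

end

section \<open>Iterated partial derivatives\<close>

lemma partial_differentiable_cong_deriv:
  assumes "((\<lambda>t. f (x + t *\<^sub>R axis i 1)) has_real_derivative D) (at 0)"
  shows "partial_differentiable i f x" and "partial_deriv i f x = D"
  using assms
  by (auto simp: partial_differentiable_def partial_deriv_def DERIV_imp_deriv
      intro: differentiableI has_field_derivative_imp_has_derivative)

lemma partial_differentiable_DERIV:
  assumes "partial_differentiable i f x"
  shows "((\<lambda>t. f (x + t *\<^sub>R axis i 1)) has_real_derivative partial_deriv i f x) (at 0)"
  using assms unfolding partial_differentiable_def partial_deriv_def
  by (simp add: DERIV_deriv_iff_real_differentiable)

lemma DERIV_along_axis:
  assumes "\<And>x. partial_differentiable i f x"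
  shows "((\<lambda>t. f (x + t *\<^sub>R axis i 1)) has_real_derivative partial_deriv i f (x + t *\<^sub>R axis i 1)) (at t)"
proof -
  have "((\<lambda>u. f ((x + t *\<^sub>R axis i 1) + u *\<^sub>R axis i 1)) has_real_derivative
      partial_deriv i f (x + t *\<^sub>R axis i 1)) (at 0)"
    by (rule partial_differentiable_DERIV[OF assms])
  then have "((\<lambda>u. f (x + (t + u) *\<^sub>R axis i 1)) has_real_derivative
      partial_deriv i f (x + t *\<^sub>R axis i 1)) (at 0)"
    by (simp add: algebra_simps)
  then show ?thesis
    using DERIV_shift[of "\<lambda>u. f (x + u *\<^sub>R axis i 1)" "partial_deriv i f (x + t *\<^sub>R axis i 1)" 0 t]
    by (simp add: add.commute)
qed

lemma Ck_continuous: "Ck k f \<Longrightarrow> continuous_on UNIV f"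
  by (cases k) auto

lemma Ck_Suc: "Ck (Suc k) f \<Longrightarrow> Ck k f"
  by (induction k arbitrary: f) (auto simp: Ck_continuous)

lemma Ck_mono: "j \<le> k \<Longrightarrow> Ck k f \<Longrightarrow> Ck j f"
  by (induction k rule: dec_induct) (use Ck_Suc in blast)+

lemma iter_partial_append: "iter_partial (js @ is) f = iter_partial is (iter_partial js f)"
  by (induction js arbitrary: f) auto

lemma Ck_iter_partial: "Ck (length js + k) f \<Longrightarrow> Ck k (iter_partial js f)"
  by (induction js arbitrary: f) auto

lemma iter_partial_differentiable:
  assumes "Ck k f" "length js < k"
  shows "partial_differentiable i (iter_partial js f) x"
proof -
  have "Ck (length js + Suc 0) f" using assms by (intro Ck_mono[OF _ assms(1)]) auto
  then have "Ck (Suc 0) (iter_partial js f)" by (rule Ck_iter_partial)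
  then show ?thesis by simp
qed

lemma partial_deriv_linear:
  assumes "partial_differentiable i f x" "partial_differentiable i g x"
  shows "partial_differentiable i (\<lambda>y. a * f y + b * g y) x"
    and "partial_deriv i (\<lambda>y. a * f y + b * g y) x = a * partial_deriv i f x + b * partial_deriv i g x"
proof -
  have "((\<lambda>t. a * f (x + t *\<^sub>R axis i 1) + b * g (x + t *\<^sub>R axis i 1)) has_real_derivative
     a * partial_deriv i f x + b * partial_deriv i g x) (at 0)"
    by (intro DERIV_add DERIV_cmult partial_differentiable_DERIV assms)
  from partial_differentiable_cong_deriv[OF this]
  show "partial_differentiable i (\<lambda>y. a * f y + b * g y) x"
    "partial_deriv i (\<lambda>y. a * f y + b * g y) x = a * partial_deriv i f x + b * partial_deriv i g x" .
qed

lemma Ck_linear: "Ck k f \<Longrightarrow> Ck k g \<Longrightarrow> Ck k (\<lambda>y. a * f y + b * g y)"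
proof (induction k arbitrary: f g)
  case (Suc k)
  have "partial_deriv i (\<lambda>y. a * f y + b * g y) = (\<lambda>x. a * partial_deriv i f x + b * partial_deriv i g x)" for i
    using Suc.prems by (intro ext partial_deriv_linear(2)) auto
  then show ?case
    using Suc by (auto intro!: continuous_intros partial_deriv_linear(1))
qed (auto intro!: continuous_intros)

lemma iter_partial_linear:
  assumes "Ck k f" "Ck k g" "length js \<le> k"
  shows "iter_partial js (\<lambda>y. a * f y + b * g y) = (\<lambda>x. a * iter_partial js f x + b * iter_partial js g x)"
  using assms
proof (induction js arbitrary: f g k)
  case (Cons i js)
  then obtain k' where k: "k = Suc k'" by (cases k) auto
  have "partial_deriv i (\<lambda>y. a * f y + b * g y) = (\<lambda>x. a * partial_deriv i f x + b * partial_deriv i g x)"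
    using Cons.prems k by (intro ext partial_deriv_linear(2)) auto
  then show ?case using Cons.IH[of k' "partial_deriv i f" "partial_deriv i g"] Cons.prems k by auto
qed auto

lemma partial_deriv_zero: "partial_deriv i (\<lambda>_. 0) = (\<lambda>_. 0)"
  by (simp add: partial_deriv_def fun_eq_iff)

lemma Ck_zero: "Ck k (\<lambda>_. 0)"
  by (induction k) (auto simp: partial_differentiable_def partial_deriv_zero)

lemma iter_partial_zero: "iter_partial js (\<lambda>_. 0) = (\<lambda>_. 0)"
  by (induction js) (auto simp: partial_deriv_zero)

lemma Ck_iter_partial_sum:
  fixes f :: "'a \<Rightarrow> real ^ 'n::finite \<Rightarrow> real"
  assumes "\<And>a. a \<in> A \<Longrightarrow> Ck k (f a)"
  shows "Ck k (\<lambda>y. \<Sum>a\<in>A. c a * f a y) \<and> (\<forall>js. length js \<le> k \<longrightarrow>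
    iter_partial js (\<lambda>y. \<Sum>a\<in>A. c a * f a y) = (\<lambda>x. \<Sum>a\<in>A. c a * iter_partial js (f a) x))"
  using assms
proof (induction A rule: infinite_finite_induct)
  case (insert a A)
  then have IH: "Ck k (\<lambda>y. \<Sum>a\<in>A. c a * f a y)" "\<And>js. length js \<le> k \<Longrightarrow>
    iter_partial js (\<lambda>y. \<Sum>a\<in>A. c a * f a y) = (\<lambda>x. \<Sum>a\<in>A. c a * iter_partial js (f a) x)"
    and fa: "Ck k (f a)" by auto
  have eq: "(\<lambda>y. \<Sum>a\<in>insert a A. c a * f a y) = (\<lambda>y. c a * f a y + 1 * (\<Sum>a\<in>A. c a * f a y))"
    using insert by (simp add: fun_eq_iff)
  show ?case
    unfolding eq
  proof (intro conjI allI impI)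
    show "Ck k (\<lambda>y. c a * f a y + 1 * (\<Sum>a\<in>A. c a * f a y))" by (rule Ck_linear[OF fa IH(1)])
    fix js :: "'n list" assume js: "length js \<le> k"
    show "iter_partial js (\<lambda>y. c a * f a y + 1 * (\<Sum>a\<in>A. c a * f a y)) =
        (\<lambda>x. \<Sum>a\<in>insert a A. c a * iter_partial js (f a) x)"
      unfolding iter_partial_linear[OF fa IH(1) js] IH(2)[OF js] using insert(1,2) by simp
  qed
qed (auto simp: Ck_zero iter_partial_zero)

lemmas Ck_sum = Ck_iter_partial_sum[THEN conjunct1]
lemmas iter_partial_sum = Ck_iter_partial_sum[THEN conjunct2, rule_format]

lemma length_mi_list: "length (mi_list \<alpha>) = mi_order \<alpha>"
proof -
  have "length js = (\<Sum>i\<in>UNIV. count_list js i)" for js :: "'a list"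
  proof (induction js)
    case (Cons a js)
    have "(\<Sum>i\<in>UNIV. count_list (a # js) i) = (\<Sum>i\<in>UNIV. (if a = i then 1 else 0) + count_list js i)"
      by (intro sum.cong) auto
    then show ?case using Cons by (simp add: sum.distrib)
  qed simp
  then show ?thesis by (simp add: mi_order_def count_mi_list)
qed

lemma tensor_partial_deriv:
  fixes g :: "'n::finite \<Rightarrow> real \<Rightarrow> real"
  assumes "(g i has_real_derivative d) (at (x $ i))"
  shows "((\<lambda>t. \<Prod>j\<in>UNIV. g j ((x + t *\<^sub>R axis i 1) $ j)) has_real_derivative
    (\<Prod>j\<in>UNIV. if j = i then d else g j (x $ j))) (at 0)"
proof -
  have comp: "(x + t *\<^sub>R axis i 1) $ j = (if j = i then x $ i + t else x $ j)" for t j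
    by (auto simp: axis_def)
  have split: "(\<Prod>j\<in>UNIV. if j = i then a else g j (x $ j)) = a * (\<Prod>j\<in>UNIV - {i}. g j (x $ j))" for a
    by (subst prod.remove[of _ i]) auto
  have eq: "(\<lambda>t. \<Prod>j\<in>UNIV. g j ((x + t *\<^sub>R axis i 1) $ j)) = (\<lambda>t. g i (x $ i + t) * (\<Prod>j\<in>UNIV - {i}. g j (x $ j)))"
  proof
    fix t
    have "(\<Prod>j\<in>UNIV. g j ((x + t *\<^sub>R axis i 1) $ j)) = (\<Prod>j\<in>UNIV. if j = i then g i (x $ i + t) else g j (x $ j))"
      by (intro prod.cong) (auto simp: axis_def)
    then show "(\<Prod>j\<in>UNIV. g j ((x + t *\<^sub>R axis i 1) $ j)) = g i (x $ i + t) * (\<Prod>j\<in>UNIV - {i}. g j (x $ j))"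
      by (simp add: split)
  qed
  have "((\<lambda>t. g i (x $ i + t)) has_real_derivative d) (at 0)"
    using assms DERIV_shift[of "g i" d 0 "x $ i"] by (simp add: add.commute)
  then show ?thesis
    unfolding eq split by (rule DERIV_cmult_right)
qed

text \<open>\<open>g i b\<close> plays the \<open>b\<close>-th derivative of the \<open>i\<close>-th
  factor, so differentiating the product only raises the entries of \<open>\<beta>\<close>. This
  serves monomials and bump functions alike.\<close>

lemma tensor_smooth:
  fixes g :: "'n::finite \<Rightarrow> nat \<Rightarrow> real \<Rightarrow> real"
  assumes deriv: "\<And>i b u. b < m \<Longrightarrow> (g i b has_real_derivative g i (Suc b) u) (at u)"
    and cont: "\<And>i b. b \<le> m \<Longrightarrow> continuous_on UNIV (g i b)"
    and le: "\<And>i. \<beta> i + k \<le> m"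
  shows "Ck k (\<lambda>x. \<Prod>i\<in>UNIV. g i (\<beta> i) (x $ i))"
    and "length js \<le> k \<Longrightarrow> iter_partial js (\<lambda>x. \<Prod>i\<in>UNIV. g i (\<beta> i) (x $ i)) =
      (\<lambda>x. \<Prod>i\<in>UNIV. g i (\<beta> i + count_list js i) (x $ i))"
proof -
  have step: "partial_differentiable i (\<lambda>x. \<Prod>i\<in>UNIV. g i (\<beta> i) (x $ i)) x"
    "partial_deriv i (\<lambda>x. \<Prod>i\<in>UNIV. g i (\<beta> i) (x $ i)) =
      (\<lambda>x. \<Prod>j\<in>UNIV. g j ((\<beta>(i := Suc (\<beta> i))) j) (x $ j))"
    if "\<beta> i < m" for i x and \<beta> :: "'n \<Rightarrow> nat"
  proof -
    have "((\<lambda>t. \<Prod>j\<in>UNIV. g j (\<beta> j) ((x + t *\<^sub>R axis i 1) $ j)) has_real_derivative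
       (\<Prod>j\<in>UNIV. if j = i then g i (Suc (\<beta> i)) (x $ i) else g j (\<beta> j) (x $ j))) (at 0)" for x
      by (rule tensor_partial_deriv[where g = "\<lambda>j. g j (\<beta> j)", OF deriv[OF that]])
    moreover have "(\<Prod>j\<in>UNIV. if j = i then g i (Suc (\<beta> i)) (x $ i) else g j (\<beta> j) (x $ j)) =
      (\<Prod>j\<in>UNIV. g j ((\<beta>(i := Suc (\<beta> i))) j) (x $ j))" for x :: "real ^ 'n"
      by (intro prod.cong) auto
    ultimately have *: "((\<lambda>t. \<Prod>j\<in>UNIV. g j (\<beta> j) ((x + t *\<^sub>R axis i 1) $ j)) has_real_derivative
       (\<Prod>j\<in>UNIV. g j ((\<beta>(i := Suc (\<beta> i))) j) (x $ j))) (at 0)" for x by simp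
    show "partial_differentiable i (\<lambda>x. \<Prod>i\<in>UNIV. g i (\<beta> i) (x $ i)) x"
      by (rule partial_differentiable_cong_deriv(1)[OF *])
    show "partial_deriv i (\<lambda>x. \<Prod>i\<in>UNIV. g i (\<beta> i) (x $ i)) =
      (\<lambda>x. \<Prod>j\<in>UNIV. g j ((\<beta>(i := Suc (\<beta> i))) j) (x $ j))"
      by (rule ext, rule partial_differentiable_cong_deriv(2)[OF *])
  qed
  have cont': "continuous_on UNIV (\<lambda>x :: real ^ 'n. \<Prod>i\<in>UNIV. g i (\<beta> i) (x $ i))"
    if "\<And>i. \<beta> i \<le> m" for \<beta> :: "'n \<Rightarrow> nat"
    using that
    by (intro continuous_on_prod continuous_on_compose2[OF cont] continuous_intros) auto
  show "Ck k (\<lambda>x. \<Prod>i\<in>UNIV. g i (\<beta> i) (x $ i))"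
    using le
  proof (induction k arbitrary: \<beta>)
    case 0
    then show ?case using cont' by simp
  next
    case (Suc k)
    have lt: "\<beta> i < m" for i using Suc.prems[of i] by simp
    have "Ck k (\<lambda>x. \<Prod>j\<in>UNIV. g j ((\<beta>(i := Suc (\<beta> i))) j) (x $ j))" for i
    proof (rule Suc.IH)
      show "(\<beta>(i := Suc (\<beta> i))) j + k \<le> m" for j using Suc.prems[of j] by auto
    qed
    then show ?case using step[OF lt] cont'[of \<beta>] lt by (simp add: less_imp_le)
  qed
  show "iter_partial js (\<lambda>x. \<Prod>i\<in>UNIV. g i (\<beta> i) (x $ i)) =
      (\<lambda>x. \<Prod>i\<in>UNIV. g i (\<beta> i + count_list js i) (x $ i))" if "length js \<le> k"
    using le that
  proof (induction js arbitrary: \<beta> k)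
    case (Cons i js)
    then obtain k' where k: "k = Suc k'" by (cases k) auto
    have lt: "\<beta> i < m" using Cons.prems(1)[of i] k by simp
    have "(\<beta>(i := Suc (\<beta> i))) j + k' \<le> m" for j using Cons.prems(1)[of j] k by auto
    from Cons.IH[OF this] Cons.prems(2) k show ?case
      unfolding iter_partial.simps step(2)[where \<beta> = \<beta>, OF lt] by (auto intro!: ext prod.cong)
  qed auto
qed

section \<open>Mean value estimates and symmetry of mixed derivatives\<close>

lemma along_axis_bound:
  assumes diff: "\<And>x. partial_differentiable i f x"
    and le: "\<And>u. \<bar>u\<bar> \<le> \<bar>t\<bar> \<Longrightarrow> \<bar>partial_deriv i f (x + u *\<^sub>R axis i 1)\<bar> \<le> L"
  shows "\<bar>f (x + t *\<^sub>R axis i 1) - f x\<bar> \<le> L * \<bar>t\<bar>"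
proof -
  let ?h = "\<lambda>u. f (x + u *\<^sub>R axis i 1)"
  have "norm (?h t - ?h 0) \<le> L * norm (t - 0)"
  proof (rule field_differentiable_bound[of "{- \<bar>t\<bar>..\<bar>t\<bar>}"])
    show "(?h has_field_derivative partial_deriv i f (x + u *\<^sub>R axis i 1)) (at u within {- \<bar>t\<bar>..\<bar>t\<bar>})" for u
      by (rule has_field_derivative_at_within[OF DERIV_along_axis[OF diff]])
  qed (use le in auto)
  then show ?thesis by simp
qed

text \<open>The path from \<open>y\<close> to \<open>x\<close> changes one coordinate at a time.
  Each of its points is componentwise no farther from \<open>y\<close> than \<open>x\<close> is, so
  it stays in the ball on which the derivatives are bounded.\<close>

lemma coordinate_path_bound:
  fixes f :: "real ^ 'n::finite \<Rightarrow> real"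
  assumes diff: "\<And>i x. partial_differentiable i f x"
    and le: "\<And>i v. norm (v - y) \<le> norm (x - y) \<Longrightarrow> \<bar>partial_deriv i f v\<bar> \<le> L"
  shows "\<bar>f x - f y\<bar> \<le> real CARD('n) * L * norm (x - y)"
proof -
  have L: "L \<ge> 0" using le[of y] by (metis abs_ge_zero diff_self norm_ge_zero norm_zero order_trans)
  define p where "p U = (\<chi> i. if i \<in> U then x $ i else y $ i)" for U
  have "\<bar>f (p U) - f y\<bar> \<le> real (card U) * (L * norm (x - y))" for U
  proof (induction U rule: finite_induct[OF finite])
    case 1
    then show ?case by (simp add: p_def)
  next
    case (2 i U)
    define t where "t = x $ i - y $ i"
    have p_insert: "p (insert i U) = p U + t *\<^sub>R axis i 1"
      using 2 by (auto simp: p_def vec_eq_iff axis_def t_def)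
    have "\<bar>f (p U + t *\<^sub>R axis i 1) - f (p U)\<bar> \<le> L * \<bar>t\<bar>"
    proof (rule along_axis_bound[OF diff])
      fix u :: real assume u: "\<bar>u\<bar> \<le> \<bar>t\<bar>"
      show "\<bar>partial_deriv i f (p U + u *\<^sub>R axis i 1)\<bar> \<le> L"
      proof (rule le, rule norm_le_componentwise_cart)
        show "norm ((p U + u *\<^sub>R axis i 1 - y) $ j) \<le> norm ((x - y) $ j)" for j
          using u 2 by (auto simp: p_def axis_def t_def)
      qed
    qed
    also have "\<dots> \<le> L * norm (x - y)"
      using L component_le_norm_cart[of "x - y" i] by (intro mult_left_mono) (auto simp: t_def)
    finally show ?case
      using 2 unfolding p_insert by (simp add: algebra_simps)
  qed
  from this[of UNIV] show ?thesis by (simp add: p_def mult.assoc vec_nth_inverse)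
qed

text \<open>Key to the symmetry of mixed derivatives: the second difference is symmetric in
  \<open>i\<close> and \<open>j\<close>, while the expression for it by the mean value theorem
  depends on the order.\<close>

lemma mixed_difference_mean_value:
  fixes f :: "real ^ 'n::finite \<Rightarrow> real"
  assumes "Ck 2 f" "h > 0"
  shows "\<exists>s t. 0 < s \<and> s < h \<and> 0 < t \<and> t < h \<and>
    f (x + h *\<^sub>R axis i 1 + h *\<^sub>R axis j 1) - f (x + h *\<^sub>R axis i 1) - f (x + h *\<^sub>R axis j 1) + f x =
    h * h * partial_deriv j (partial_deriv i f) (x + s *\<^sub>R axis i 1 + t *\<^sub>R axis j 1)"
proof -
  have d1: "partial_differentiable i f z" and d2: "partial_differentiable j (partial_deriv i f) z" for z
    using assms(1) by (auto simp: numeral_2_eq_2)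
  define g where "g u = f ((x + h *\<^sub>R axis j 1) + u *\<^sub>R axis i 1) - f (x + u *\<^sub>R axis i 1)" for u
  have g': "(g has_real_derivative partial_deriv i f ((x + h *\<^sub>R axis j 1) + u *\<^sub>R axis i 1) - partial_deriv i f (x + u *\<^sub>R axis i 1)) (at u)" for u
    unfolding g_def by (intro DERIV_diff DERIV_along_axis d1)
  obtain s where s: "0 < s" "s < h" "g h - g 0 = (h - 0) *
      (partial_deriv i f ((x + h *\<^sub>R axis j 1) + s *\<^sub>R axis i 1) - partial_deriv i f (x + s *\<^sub>R axis i 1))"
    using MVT2[OF assms(2) g'] by auto
  obtain t where t: "0 < t" "t < h"
     "partial_deriv i f ((x + s *\<^sub>R axis i 1) + h *\<^sub>R axis j 1) - partial_deriv i f ((x + s *\<^sub>R axis i 1) + 0 *\<^sub>R axis j 1)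
        = (h - 0) * partial_deriv j (partial_deriv i f) ((x + s *\<^sub>R axis i 1) + t *\<^sub>R axis j 1)"
    using MVT2[OF assms(2) DERIV_along_axis[OF d2]] by metis
  have gh: "g h - g 0 = f (x + h *\<^sub>R axis i 1 + h *\<^sub>R axis j 1) - f (x + h *\<^sub>R axis i 1) - f (x + h *\<^sub>R axis j 1) + f x"
  proof -
    have "f (x + h *\<^sub>R axis j 1 + h *\<^sub>R axis i 1) = f (x + h *\<^sub>R axis i 1 + h *\<^sub>R axis j 1)"
      by (rule arg_cong) simp
    then show ?thesis by (simp add: g_def)
  qed
  show ?thesis
  proof -
    have "partial_deriv i f (x + h *\<^sub>R axis j 1 + s *\<^sub>R axis i 1) = partial_deriv i f (x + s *\<^sub>R axis i 1 + h *\<^sub>R axis j 1)"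
      by (rule arg_cong) simp
    then show ?thesis unfolding gh[symmetric] using s t by - (rule exI[of _ s], rule exI[of _ t], simp)
  qed
qed

lemma partial_deriv_commute:
  fixes f :: "real ^ 'n::finite \<Rightarrow> real"
  assumes "Ck 2 f"
  shows "partial_deriv i (partial_deriv j f) = partial_deriv j (partial_deriv i f)"
proof
  fix x
  let ?F = "partial_deriv j (partial_deriv i f)" and ?G = "partial_deriv i (partial_deriv j f)"
  have cont: "continuous_on UNIV ?F" "continuous_on UNIV ?G"
    using assms by (auto simp: numeral_2_eq_2)
  have "\<bar>?F x - ?G x\<bar> \<le> e" if e: "e > 0" for e
  proof -
    have "\<exists>d>0. \<forall>y. dist y x < d \<longrightarrow> dist (H y) (H x) < e / 2" if "continuous_on UNIV H" for H :: "real ^ 'n \<Rightarrow> real"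
      using that e unfolding continuous_on_iff by (metis UNIV_I half_gt_zero)
    then obtain d1 d2 where d: "d1 > 0" "\<And>y. dist y x < d1 \<Longrightarrow> dist (?F y) (?F x) < e / 2"
       "d2 > 0" "\<And>y. dist y x < d2 \<Longrightarrow> dist (?G y) (?G x) < e / 2"
      using cont by metis
    define h where "h = min d1 d2 / 3"
    have h: "h > 0" "2 * h < d1" "2 * h < d2" using d by (auto simp: h_def)
    have near: "dist (x + s *\<^sub>R axis k 1 + t *\<^sub>R axis l 1) x \<le> 2 * h" if "0 < s" "s < h" "0 < t" "t < h" for s t :: real and k l :: 'n
    proof -
      have "dist (x + s *\<^sub>R axis k 1 + t *\<^sub>R axis l 1) x = norm (s *\<^sub>R axis k (1::real) + t *\<^sub>R axis l 1)"
        by (simp add: dist_norm)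
      also have "\<dots> \<le> norm (s *\<^sub>R axis k (1::real)) + norm (t *\<^sub>R axis l (1::real))" by (rule norm_triangle_ineq)
      finally show ?thesis using that by simp
    qed
    obtain s t where st: "0 < s" "s < h" "0 < t" "t < h"
      "f (x + h *\<^sub>R axis i 1 + h *\<^sub>R axis j 1) - f (x + h *\<^sub>R axis i 1) - f (x + h *\<^sub>R axis j 1) + f x =
       h * h * ?F (x + s *\<^sub>R axis i 1 + t *\<^sub>R axis j 1)"
      using mixed_difference_mean_value[OF assms h(1)] by blast
    obtain s' t' where st': "0 < s'" "s' < h" "0 < t'" "t' < h"
      "f (x + h *\<^sub>R axis j 1 + h *\<^sub>R axis i 1) - f (x + h *\<^sub>R axis j 1) - f (x + h *\<^sub>R axis i 1) + f x =
       h * h * ?G (x + s' *\<^sub>R axis j 1 + t' *\<^sub>R axis i 1)"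
      using mixed_difference_mean_value[OF assms h(1)] by blast
    have swap: "f (x + h *\<^sub>R axis i 1 + h *\<^sub>R axis j 1) = f (x + h *\<^sub>R axis j 1 + h *\<^sub>R axis i 1)"
      by (rule arg_cong) simp
    have "h * h * ?F (x + s *\<^sub>R axis i 1 + t *\<^sub>R axis j 1) = h * h * ?G (x + s' *\<^sub>R axis j 1 + t' *\<^sub>R axis i 1)"
      unfolding st(5)[symmetric] st'(5)[symmetric] using swap by simp
    then have "?F (x + s *\<^sub>R axis i 1 + t *\<^sub>R axis j 1) = ?G (x + s' *\<^sub>R axis j 1 + t' *\<^sub>R axis i 1)"
      using h(1) by simp
    moreover have "dist (?F (x + s *\<^sub>R axis i 1 + t *\<^sub>R axis j 1)) (?F x) < e / 2"
      using near[OF st(1-4)] h by (intro d(2)) (rule le_less_trans)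
    moreover have "dist (?G (x + s' *\<^sub>R axis j 1 + t' *\<^sub>R axis i 1)) (?G x) < e / 2"
      using near[OF st'(1-4)] h by (intro d(4)) (rule le_less_trans)
    ultimately show ?thesis unfolding dist_real_def by linarith
  qed
  then show "?G x = ?F x" using dense_ge[of 0 "\<bar>?F x - ?G x\<bar>"] by fastforce
qed

lemma iter_partial_remove1:
  assumes "i \<in> set js" "Ck (length js) f"
  shows "iter_partial js f = iter_partial (i # remove1 i js) f"
  using assms
proof (induction js arbitrary: f)
  case (Cons j js)
  show ?case
  proof (cases "i = j")
    case False
    then have i: "i \<in> set js" using Cons.prems by simp
    then obtain m where "length js = Suc m" by (cases js) auto
    then have C2: "Ck 2 f" using Cons.prems(2) by (intro Ck_mono[of 2 "length (j # js)" f]) auto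
    show ?thesis
      using Cons.IH[OF i, of "partial_deriv j f"] Cons.prems(2) False partial_deriv_commute[OF C2, of i j] by simp
  qed simp
qed simp

lemma iter_partial_perm:
  assumes "mset js = mset js'" "Ck (length js) f"
  shows "iter_partial js f = iter_partial js' f"
  using assms
proof (induction js arbitrary: js' f)
  case (Cons i js)
  have i: "i \<in> set js'" using Cons.prems(1) by (metis list.set_intros(1) mset_eq_setD)
  have len: "length js' = length (i # js)" using Cons.prems(1) by (metis mset_eq_length)
  have "mset js = mset (remove1 i js')" using Cons.prems(1) by (metis mset_remove1 remove1.simps(2))
  then have "iter_partial js (partial_deriv i f) = iter_partial (remove1 i js') (partial_deriv i f)"
    using Cons.prems(2) by (intro Cons.IH) auto
  then show ?case using iter_partial_remove1[OF i, of f] Cons.prems(2) len by simp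
qed simp

text \<open>The order chosen in \<open>mi_list\<close> is immaterial, so derivatives can be indexed
  by lists, which suit induction on the order of differentiation.\<close>

lemma iter_partial_eq_mi_deriv:
  assumes "Ck k f" "length js \<le> k"
  shows "iter_partial js f = mi_deriv (count_list js) f"
  unfolding mi_deriv_def
proof (rule iter_partial_perm)
  show "mset js = mset (mi_list (count_list js))"
    by (intro multiset_eqI) (simp add: count_mset count_mi_list)
  show "Ck (length js) f" by (rule Ck_mono[OF assms(2,1)])
qed

lemma mi_order_count_list: "mi_order (count_list js) = length js"
proof -
  have "length js = length (mi_list (count_list js))"
    by (rule mset_eq_length, rule multiset_eqI) (simp add: count_mset count_mi_list)
  then show ?thesis by (simp add: length_mi_list)
qed

section \<open>Taylor polynomials\<close>

lemma Ck_diff: "Ck k f \<Longrightarrow> Ck k g \<Longrightarrow> Ck k (f - g)"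
  using Ck_linear[of k f g 1 "-1"] by (simp add: fun_diff_def)

lemma Ck_add: "Ck k f \<Longrightarrow> Ck k g \<Longrightarrow> Ck k (f + g)"
  using Ck_linear[of k f g 1 1] by (simp add: plus_fun_def)

lemma Ck_scaleR: "Ck k f \<Longrightarrow> Ck k (c *\<^sub>R f)"
  using Ck_linear[of k f f c 0] by (simp add: scaleR_fun_def)

lemma iter_partial_diff:
  "Ck k f \<Longrightarrow> Ck k g \<Longrightarrow> length js \<le> k \<Longrightarrow> iter_partial js (f - g) x = iter_partial js f x - iter_partial js g x"
  using iter_partial_linear[of k f g js 1 "-1"] by (simp add: fun_diff_def)

lemma iter_partial_add:
  "Ck k f \<Longrightarrow> Ck k g \<Longrightarrow> length js \<le> k \<Longrightarrow> iter_partial js (f + g) x = iter_partial js f x + iter_partial js g x"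
  using iter_partial_linear[of k f g js 1 1] by (simp add: plus_fun_def)

lemma iter_partial_scaleR:
  "Ck k f \<Longrightarrow> length js \<le> k \<Longrightarrow> iter_partial js (c *\<^sub>R f) x = c * iter_partial js f x"
  using iter_partial_linear[of k f f js c 0] by (simp add: scaleR_fun_def)

lemma partial_deriv_shift: "partial_deriv i (\<lambda>y. f (y + v)) x = partial_deriv i f (x + v)"
  by (simp add: partial_deriv_def algebra_simps)

lemma Ck_shift: "Ck k f \<Longrightarrow> Ck k (\<lambda>y. f (y + v))"
proof (induction k arbitrary: f)
  case 0
  then show ?case by (auto intro!: continuous_on_compose2[of UNIV f] continuous_intros)
next
  case (Suc k)
  have "partial_deriv i (\<lambda>y. f (y + v)) = (\<lambda>y. partial_deriv i f (y + v))" for i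
    by (rule ext) (rule partial_deriv_shift)
  moreover have "partial_differentiable i (\<lambda>y. f (y + v)) x" for i x
  proof -
    have "partial_differentiable i f (x + v)" using Suc.prems by simp
    then show ?thesis by (simp add: partial_differentiable_def algebra_simps)
  qed
  ultimately show ?case
    using Suc by (auto intro!: continuous_on_compose2[of UNIV f] continuous_intros)
qed

lemma iter_partial_shift: "iter_partial js (\<lambda>y. f (y + v)) = (\<lambda>y. iter_partial js f (y + v))"
proof (induction js arbitrary: f)
  case (Cons i js)
  have "partial_deriv i (\<lambda>y. f (y + v)) = (\<lambda>y. partial_deriv i f (y + v))"
    by (rule ext) (rule partial_deriv_shift)
  then show ?case using Cons[of "partial_deriv i f"] by simp
qed simp

text \<open>Descent from order \<open>k\<close> to lower orders. Each step moves from
  \<open>y\<close> to \<open>v\<close> along a coordinate path, which costs a factor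
  \<open>CARD('n)\<close> and gains \<open>\<delta>\<close>, and adds the value at \<open>y\<close>;
  hence \<open>CARD('n) + 1\<close> per order.\<close>

lemma derivative_descent:
  fixes g :: "real ^ 'n::finite \<Rightarrow> real"
  assumes g: "Ck k g" and \<delta>: "\<delta> \<ge> 0"
    and top: "\<And>js v. length js = k \<Longrightarrow> norm (v - y) \<le> \<delta> \<Longrightarrow> \<bar>iter_partial js g v\<bar> \<le> M"
    and low: "\<And>js. length js < k \<Longrightarrow> \<bar>iter_partial js g y\<bar> \<le> M * \<delta> ^ (k - length js)"
    and js: "length js \<le> k" and v: "norm (v - y) \<le> \<delta>"
  shows "\<bar>iter_partial js g v\<bar> \<le> (real CARD('n) + 1) ^ (k - length js) * M * \<delta> ^ (k - length js)"
  using js v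
proof (induction "k - length js" arbitrary: js v)
  case 0
  then show ?case using top[of js v] by simp
next
  case (Suc d)
  let ?n = "real CARD('n)" and ?j = "length js"
  have kj: "k - ?j = Suc d" using Suc.hyps(2) by simp
  have "M \<ge> 0"
  proof -
    obtain js0 :: "'n list" where "length js0 = k" using Ex_list_of_length by blast
    then show ?thesis using top[of js0 y] \<delta> by (metis abs_ge_zero diff_self norm_zero order_trans)
  qed
  have step: "\<bar>partial_deriv i (iter_partial js g) z\<bar> \<le> (?n + 1) ^ d * M * \<delta> ^ d" if "norm (z - y) \<le> norm (v - y)" for i z
  proof -
    have "d = k - length (js @ [i])" using kj by simp
    then show ?thesis
      using Suc.hyps(1)[of "js @ [i]" z] that Suc.prems kj by (simp add: iter_partial_append)
  qed
  have "\<bar>iter_partial js g v - iter_partial js g y\<bar> \<le> ?n * ((?n + 1) ^ d * M * \<delta> ^ d) * norm (v - y)"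
    using kj by (intro coordinate_path_bound step iter_partial_differentiable[OF g]) auto
  also have "\<dots> \<le> ?n * ((?n + 1) ^ d * M * \<delta> ^ d) * \<delta>"
    using Suc.prems \<open>M \<ge> 0\<close> \<delta> by (intro mult_left_mono) auto
  finally have "\<bar>iter_partial js g v\<bar> \<le> \<bar>iter_partial js g y\<bar> + ?n * (?n + 1) ^ d * (M * \<delta> ^ Suc d)"
    by (simp add: algebra_simps)
  also have "\<bar>iter_partial js g y\<bar> \<le> 1 * (M * \<delta> ^ Suc d)" using low[of js] kj by simp
  also have "\<dots> \<le> (?n + 1) ^ d * (M * \<delta> ^ Suc d)"
    using \<open>M \<ge> 0\<close> \<delta> by (intro mult_right_mono one_le_power) auto
  finally show ?case by (simp add: kj algebra_simps)
qed

text \<open>The \<open>b\<close>-th derivative of \<open>(u - c) ^ a\<close>, with the order as an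
  argument as \<open>tensor_smooth\<close> expects.\<close>

definition falling_power :: "nat \<Rightarrow> real \<Rightarrow> nat \<Rightarrow> real \<Rightarrow> real" where
  "falling_power a c b u = (if b \<le> a then fact a / fact (a - b) * (u - c) ^ (a - b) else 0)"

lemma falling_power_deriv:
  "(falling_power a c b has_real_derivative falling_power a c (Suc b) u) (at u)"
proof (cases "b < a")
  case True
  then obtain d where d: "a - b = Suc d" by (cases "a - b") auto
  then have d': "a - Suc b = d" by simp
  have "((\<lambda>u. fact a / fact (Suc d) * (u - c) ^ Suc d) has_real_derivative
      fact a / fact (Suc d) * (real (Suc d) * (u - c) ^ d)) (at u)"
    by (auto intro!: derivative_eq_intros simp del: power_Suc fact_Suc)
  moreover have "fact a / fact (Suc d) * (real (Suc d) * (u - c) ^ d) = fact a / fact d * (u - c) ^ d"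
    by (simp add: fact_Suc del: of_nat_Suc)
  ultimately show ?thesis using True d d' by (simp add: falling_power_def[abs_def])
next
  case False
  then show ?thesis by (cases "a = b") (auto simp: falling_power_def[abs_def])
qed

lemma falling_power_cont: "continuous_on UNIV (falling_power a c b)"
  by (intro continuous_at_imp_continuous_on ballI DERIV_isCont[OF falling_power_deriv])

lemma mi_power_smooth:
  fixes x :: "real ^ 'n::finite"
  shows "Ck m (\<lambda>y. mi_power (y - x) \<alpha>)"
    and "iter_partial js (\<lambda>y. mi_power (y - x) \<alpha>) = (\<lambda>y. \<Prod>i\<in>UNIV. falling_power (\<alpha> i) (x $ i) (count_list js i) (y $ i))"
proof -
  let ?g = "\<lambda>i. falling_power (\<alpha> i) (x $ i)"
  have eq: "(\<lambda>y. mi_power (y - x) \<alpha>) = (\<lambda>y. \<Prod>i\<in>UNIV. ?g i ((\<lambda>_. 0) i) (y $ i))"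
    by (simp add: mi_power_def falling_power_def)
  show "Ck m (\<lambda>y. mi_power (y - x) \<alpha>)"
    unfolding eq by (rule tensor_smooth(1)[of m ?g]) (auto intro: falling_power_deriv falling_power_cont)
  show "iter_partial js (\<lambda>y. mi_power (y - x) \<alpha>) = (\<lambda>y. \<Prod>i\<in>UNIV. ?g i (count_list js i) (y $ i))"
    unfolding eq using tensor_smooth(2)[of "length js" ?g "\<lambda>_. 0" "length js" js] falling_power_deriv falling_power_cont by simp
qed

lemma iter_partial_mi_power_center:
  "iter_partial js (\<lambda>y. mi_power (y - x) \<alpha>) x = (if count_list js = \<alpha> then mi_fact \<alpha> else 0)"
proof (cases "count_list js = \<alpha>")
  case True
  then show ?thesis by (auto simp: mi_power_smooth(2) falling_power_def mi_fact_def)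
next
  case False
  then obtain i where "count_list js i \<noteq> \<alpha> i" by auto
  then have "falling_power (\<alpha> i) (x $ i) (count_list js i) (x $ i) = 0"
    by (auto simp: falling_power_def)
  then have "(\<Prod>i\<in>UNIV. falling_power (\<alpha> i) (x $ i) (count_list js i) (x $ i)) = 0"
    by (intro prod_zero) auto
  then show ?thesis using False by (simp add: mi_power_smooth(2))
qed

lemma iter_partial_mi_power_top:
  assumes "mi_order \<alpha> \<le> length js"
  shows "iter_partial js (\<lambda>y. mi_power (y - x) \<alpha>) y = iter_partial js (\<lambda>y. mi_power (y - x) \<alpha>) x"
proof (cases "count_list js = \<alpha>")
  case True
  then show ?thesis by (auto simp: mi_power_smooth(2) falling_power_def)
next
  case False
  have "\<exists>i. \<alpha> i < count_list js i"
  proof (rule ccontr)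
    assume none: "\<not> ?thesis"
    then have le: "count_list js i \<le> \<alpha> i" for i by (simp add: not_less)
    obtain i where "count_list js i \<noteq> \<alpha> i" using False by auto
    then have "count_list js i < \<alpha> i" using le[of i] by simp
    then have "(\<Sum>i\<in>UNIV. count_list js i) < (\<Sum>i\<in>UNIV. \<alpha> i)"
      using le by (intro sum_strict_mono_ex1) auto
    then show False using assms mi_order_count_list[of js] by (simp add: mi_order_def)
  qed
  then obtain i where "\<alpha> i < count_list js i" by blast
  then have "(\<Prod>i\<in>UNIV. falling_power (\<alpha> i) (x $ i) (count_list js i) (z $ i)) = 0" for z :: "real ^ 'a"
    by (intro prod_zero) (auto simp: falling_power_def intro!: exI[of _ i])
  then show ?thesis by (simp only: mi_power_smooth(2))
qed

definition jet_poly :: "nat \<Rightarrow> real ^ 'n \<Rightarrow> (('n::finite \<Rightarrow> nat) \<Rightarrow> real) \<Rightarrow> real ^ 'n \<Rightarrow> real" where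
  "jet_poly k x c = (\<lambda>y. \<Sum>\<alpha> | mi_order \<alpha> \<le> k. c \<alpha> * mi_power (y - x) \<alpha>)"

lemma taylor_poly_jet_poly: "taylor_poly k x f = jet_poly k x (\<lambda>\<alpha>. 1 / mi_fact \<alpha> * mi_deriv \<alpha> f x)"
  by (simp add: taylor_poly_def jet_poly_def)

lemma mi_fact_pos: "mi_fact \<alpha> > 0"
  by (auto simp: mi_fact_def intro!: prod_pos)

lemma Ck_jet_poly: "Ck m (jet_poly k x c)"
  unfolding jet_poly_def by (intro Ck_sum mi_power_smooth(1))

lemma iter_partial_jet_poly:
  "iter_partial js (jet_poly k x c) y = (\<Sum>\<alpha> | mi_order \<alpha> \<le> k. c \<alpha> * iter_partial js (\<lambda>y. mi_power (y - x) \<alpha>) y)"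
  unfolding jet_poly_def by (subst iter_partial_sum[of _ "length js"]) (auto intro: mi_power_smooth(1))

lemma iter_partial_jet_poly_center:
  assumes "length js \<le> k"
  shows "iter_partial js (jet_poly k x c) x = c (count_list js) * mi_fact (count_list js)"
proof -
  have "iter_partial js (jet_poly k x c) x = (\<Sum>\<alpha> | mi_order \<alpha> \<le> k. if \<alpha> = count_list js then c \<alpha> * mi_fact \<alpha> else 0)"
    unfolding iter_partial_jet_poly by (intro sum.cong) (auto simp: iter_partial_mi_power_center)
  also have "\<dots> = c (count_list js) * mi_fact (count_list js)"
    using assms by (subst sum.delta) (auto simp: finite_mi_order_le mi_order_count_list)
  finally show ?thesis .
qed

lemma iter_partial_jet_poly_top:
  assumes "k \<le> length js"
  shows "iter_partial js (jet_poly k x c) y = iter_partial js (jet_poly k x c) z"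
proof -
  have "iter_partial js (jet_poly k x c) y = iter_partial js (jet_poly k x c) x" for y
    unfolding iter_partial_jet_poly
    using assms by (intro sum.cong refl arg_cong2[of _ _ _ _ "(*)"] iter_partial_mi_power_top) auto
  then show ?thesis by metis
qed

lemma taylor_poly_center:
  assumes "Ck k f" "length js \<le> k"
  shows "iter_partial js (taylor_poly k x f) x = iter_partial js f x"
  using assms mi_fact_pos[of "count_list js"]
  by (simp add: taylor_poly_jet_poly iter_partial_jet_poly_center iter_partial_eq_mi_deriv)

lemma taylor_poly_cong:
  assumes "\<And>js. length js \<le> k \<Longrightarrow> iter_partial js f x = iter_partial js g x"
  shows "taylor_poly k x f = taylor_poly k x g"
  unfolding taylor_poly_def mi_deriv_def
  by (intro ext sum.cong) (use assms in \<open>auto simp: length_mi_list\<close>)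

text \<open>Polynomials of degree at most \<open>k\<close> seen through their derivatives, as
  \<open>polys_upto_iff\<close> shows. Constancy at order \<open>k\<close> is the form in which the
  descent estimate can use the degree.\<close>

definition poly_like :: "nat \<Rightarrow> (real ^ 'n::finite \<Rightarrow> real) \<Rightarrow> bool" where
  "poly_like k f \<longleftrightarrow> (\<forall>m. Ck m f) \<and> (\<forall>js x y. length js = k \<longrightarrow> iter_partial js f x = iter_partial js f y)"

lemma poly_like_jet_poly: "poly_like k (jet_poly k x c)"
  unfolding poly_like_def by (intro conjI allI impI Ck_jet_poly iter_partial_jet_poly_top) auto

lemma poly_like_taylor: "poly_like k (taylor_poly k x f)"
  unfolding taylor_poly_jet_poly by (rule poly_like_jet_poly)

lemma poly_like_add: "poly_like k f \<Longrightarrow> poly_like k g \<Longrightarrow> poly_like k (f + g)"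
  unfolding poly_like_def by (auto simp: Ck_add iter_partial_add[of k]) metis

lemma poly_like_diff: "poly_like k f \<Longrightarrow> poly_like k g \<Longrightarrow> poly_like k (f - g)"
  unfolding poly_like_def by (auto simp: Ck_diff iter_partial_diff[of k]) metis

lemma poly_like_scaleR: "poly_like k f \<Longrightarrow> poly_like k (c *\<^sub>R f)"
  unfolding poly_like_def by (auto simp: Ck_scaleR iter_partial_scaleR[of k])

lemma poly_like_Ck: "poly_like k f \<Longrightarrow> Ck m f"
  by (simp add: poly_like_def)

lemma poly_like_top: "poly_like k f \<Longrightarrow> length js = k \<Longrightarrow> iter_partial js f x = iter_partial js f y"
  by (simp add: poly_like_def)

lemma poly_like_descent:
  fixes R :: "real ^ 'n::finite \<Rightarrow> real"
  assumes R: "poly_like k R" and low: "\<And>js. length js \<le> k \<Longrightarrow> \<bar>iter_partial js R y\<bar> \<le> M * \<delta> ^ (k - length js)"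
    and js: "length js \<le> k" and v: "norm (v - y) \<le> \<delta>"
  shows "\<bar>iter_partial js R v\<bar> \<le> (real CARD('n) + 1) ^ (k - length js) * M * \<delta> ^ (k - length js)"
proof (rule derivative_descent[OF poly_like_Ck[OF R]])
  show "\<delta> \<ge> 0" using v norm_ge_zero order_trans by blast
  show "\<bar>iter_partial js R v\<bar> \<le> M" if "length js = k" for js v
    using low[of js] that poly_like_top[OF R that, of v y] by simp
qed (use low js v in auto)

text \<open>The remainder has zero jet at \<open>x\<close>, so the descent estimate with
  \<open>M = 0\<close> makes it vanish everywhere.\<close>

lemma taylor_poly_poly_like:
  fixes R :: "real ^ 'n::finite \<Rightarrow> real"
  assumes R: "poly_like k R"
  shows "taylor_poly k x R = R"
proof
  fix y
  let ?D = "R - taylor_poly k x R"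
  have "\<bar>iter_partial [] ?D y\<bar> \<le> (real CARD('n) + 1) ^ (k - length ([] :: 'n list)) * 0 * norm (y - x) ^ (k - length ([] :: 'n list))"
    by (rule poly_like_descent[where y = x])
      (auto simp: poly_like_diff[OF R poly_like_taylor] iter_partial_diff[of k] poly_like_Ck[OF R]
         poly_like_Ck[OF poly_like_taylor] taylor_poly_center)
  then show "taylor_poly k x R y = R y" by simp
qed

lemma polys_upto_iff: "f \<in> polys_upto k \<longleftrightarrow> poly_like k f"
proof
  assume "f \<in> polys_upto k"
  then show "poly_like k f"
    unfolding polys_upto_def
  proof (induction rule: span_induct_alt)
    case base
    then show ?case by (simp add: poly_like_def zero_fun_def Ck_zero iter_partial_zero)
  next
    case (step c p q)
    then obtain \<alpha> where \<alpha>: "p = (\<lambda>y. mi_power y \<alpha>)" "mi_order \<alpha> \<le> k" by blast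
    have "iter_partial js p x = iter_partial js p y" if "length js = k" for js x y
      using iter_partial_mi_power_top[of \<alpha> js 0 x] iter_partial_mi_power_top[of \<alpha> js 0 y] \<alpha> that by simp
    moreover have "Ck m p" for m
      using mi_power_smooth(1)[of m 0 \<alpha>] by (simp add: \<alpha>(1))
    ultimately have "poly_like k p"
      unfolding poly_like_def by blast
    then show ?case using step by (intro poly_like_add poly_like_scaleR)
  qed
next
  assume "poly_like k f"
  then have "f = jet_poly k 0 (\<lambda>\<alpha>. 1 / mi_fact \<alpha> * mi_deriv \<alpha> f 0)"
    using taylor_poly_poly_like[of k f 0] by (simp add: taylor_poly_jet_poly)
  also have "\<dots> = (\<Sum>\<alpha> | mi_order \<alpha> \<le> k. (1 / mi_fact \<alpha> * mi_deriv \<alpha> f 0) *\<^sub>R (\<lambda>y. mi_power y \<alpha>))"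
    by (rule ext) (simp add: sum_fun_apply jet_poly_def scaleR_fun_def)
  also have "\<dots> \<in> polys_upto k"
    unfolding polys_upto_def by (intro span_sum span_scale span_base) auto
  finally show "f \<in> polys_upto k" .
qed

section \<open>Whitney conditions and interpolation inequalities\<close>

text \<open>The estimate is proved for \<open>F - taylor_poly k y F\<close>: its derivatives at
  \<open>y\<close> vanish, its top derivatives are oscillations of \<open>F\<close>, and at
  \<open>x\<close> it has the same jet as the difference of the two Taylor polynomials.\<close>

lemma whitney_condition:
  fixes F :: "real ^ 'n::finite \<Rightarrow> real"
  assumes F: "Ck k F"
    and osc: "\<And>js v. length js = k \<Longrightarrow> norm (v - y) \<le> norm (x - y) \<Longrightarrow> \<bar>iter_partial js F v - iter_partial js F y\<bar> \<le> M"
    and js: "length js \<le> k"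
  shows "\<bar>iter_partial js (taylor_poly k x F - taylor_poly k y F) x\<bar> \<le>
    (real CARD('n) + 1) ^ (k - length js) * M * norm (x - y) ^ (k - length js)"
proof -
  let ?g = "F - taylor_poly k y F"
  have T: "Ck k (taylor_poly k z F)" for z using poly_like_Ck[OF poly_like_taylor] .
  have g: "iter_partial js ?g v = iter_partial js F v - iter_partial js (taylor_poly k y F) v" if "length js \<le> k" for js v
    using that by (rule iter_partial_diff[OF F T])
  have M: "M \<ge> 0"
  proof -
    obtain js0 :: "'n list" where "length js0 = k" using Ex_list_of_length by blast
    then show ?thesis using osc[of js0 y] by simp
  qed
  have "\<bar>iter_partial js ?g x\<bar> \<le> (real CARD('n) + 1) ^ (k - length js) * M * norm (x - y) ^ (k - length js)"
  proof (rule derivative_descent[where y = y, OF Ck_diff[OF F T] _ _ _ js])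
    fix js :: "'n list" and v
    assume js: "length js = k" and v: "norm (v - y) \<le> norm (x - y)"
    have "iter_partial js (taylor_poly k y F) v = iter_partial js F y"
      using poly_like_top[OF poly_like_taylor js, of y F v y] taylor_poly_center[OF F, of js y] js by simp
    then show "\<bar>iter_partial js ?g v\<bar> \<le> M" using osc[OF js v] js by (simp add: g)
  next
    fix js :: "'n list" assume "length js < k"
    then show "\<bar>iter_partial js ?g y\<bar> \<le> M * norm (x - y) ^ (k - length js)"
      using M by (simp add: g taylor_poly_center[OF F])
  qed auto
  moreover have "iter_partial js (taylor_poly k x F - taylor_poly k y F) x = iter_partial js ?g x"
    using js by (simp add: g iter_partial_diff[OF T T] taylor_poly_center[OF F])
  ultimately show ?thesis by simp
qed

text \<open>An iterated difference of a bounded function is at most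
  \<open>2 ^ length js * M\<close>, and the mean value theorem turns it into
  \<open>h ^ length js\<close> times the derivative at some nearby point.\<close>

lemma iterated_difference_quotient:
  fixes f :: "real ^ 'n::finite \<Rightarrow> real"
  assumes "Ck (length js) f" "h > 0" "\<And>y. \<bar>f y\<bar> \<le> M"
  shows "\<exists>\<xi>. \<bar>iter_partial js f \<xi>\<bar> \<le> 2 ^ length js * M / h ^ length js \<and> norm (\<xi> - x) \<le> real (length js) * h"
  using assms
proof (induction js arbitrary: f M rule: rev_induct)
  case Nil
  then show ?case by (intro exI[of _ x]) auto
next
  case (snoc i js)
  let ?v = "h *\<^sub>R axis i 1 :: real ^ 'n"
  define f1 where "f1 = (\<lambda>y. f (y + ?v)) - f"
  have f: "Ck (length js) f" using snoc.prems(1) by (simp add: Ck_Suc)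
  have fv: "Ck (length js) (\<lambda>y. f (y + ?v))" by (rule Ck_shift[OF f])
  have "\<bar>f1 y\<bar> \<le> 2 * M" for y
    using snoc.prems(3)[of "y + ?v"] snoc.prems(3)[of y] by (simp add: f1_def)
  then obtain \<xi> where \<xi>: "\<bar>iter_partial js f1 \<xi>\<bar> \<le> 2 ^ length js * (2 * M) / h ^ length js"
      "norm (\<xi> - x) \<le> real (length js) * h"
    using snoc.IH[of f1 "2 * M"] Ck_diff[OF fv f, folded f1_def] snoc.prems(2) by blast
  have d: "partial_differentiable i (iter_partial js f) z" for z
    by (rule iter_partial_differentiable[OF snoc.prems(1)]) simp
  obtain s where s: "0 < s" "s < h"
    "iter_partial js f (\<xi> + ?v) - iter_partial js f (\<xi> + 0 *\<^sub>R axis i 1) =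
      (h - 0) * partial_deriv i (iter_partial js f) (\<xi> + s *\<^sub>R axis i 1)"
    using MVT2[OF snoc.prems(2) DERIV_along_axis[OF d]] by metis
  have "iter_partial js f1 \<xi> = iter_partial js f (\<xi> + ?v) - iter_partial js f \<xi>"
    unfolding f1_def by (subst iter_partial_diff[OF fv f]) (auto simp: iter_partial_shift)
  then have "h * \<bar>iter_partial (js @ [i]) f (\<xi> + s *\<^sub>R axis i 1)\<bar> \<le> 2 ^ length js * (2 * M) / h ^ length js"
    using \<xi>(1) s snoc.prems(2) by (simp add: iter_partial_append abs_mult)
  then have "\<bar>iter_partial (js @ [i]) f (\<xi> + s *\<^sub>R axis i 1)\<bar> \<le> 2 ^ length (js @ [i]) * M / h ^ length (js @ [i])"
    using snoc.prems(2) by (simp add: field_simps)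
  moreover have "norm (\<xi> + s *\<^sub>R axis i 1 - x) \<le> real (length (js @ [i])) * h"
  proof -
    have "norm (\<xi> + s *\<^sub>R axis i 1 - x) \<le> norm (\<xi> - x) + norm (s *\<^sub>R axis i (1::real) :: real ^ 'n)"
      using norm_triangle_ineq[of "\<xi> - x" "s *\<^sub>R axis i 1"] by (simp add: algebra_simps)
    then show ?thesis using \<xi>(2) s by (simp add: algebra_simps)
  qed
  ultimately show ?case by blast
qed

text \<open>A Landau-Kolmogorov inequality at the scale \<open>t\<close>. At every order some nearby
  point has a good bound. At top order the oscillation transports it to \<open>x\<close>; at lower
  orders the bound for the next order does, which costs the factor
  \<open>1 + CARD('n) * k\<close>.\<close>

lemma interpolation_bound:
  fixes F :: "real ^ 'n::finite \<Rightarrow> real"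
  assumes F: "Ck k F" and t: "t > 0" and bound: "\<And>y. \<bar>F y\<bar> \<le> 1" and c: "c \<ge> 0"
    and osc: "\<And>js u v. length js = k \<Longrightarrow> norm (u - v) \<le> real k * t \<Longrightarrow> \<bar>iter_partial js F u - iter_partial js F v\<bar> \<le> c / t ^ k"
    and js: "length js \<le> k"
  shows "\<bar>iter_partial js F x\<bar> \<le> (2 ^ k + c) * (1 + real CARD('n) * real k) ^ (k - length js) / t ^ length js"
  using js
proof (induction "k - length js" arbitrary: js x)
  case 0
  then have len: "length js = k" by simp
  obtain \<xi> where \<xi>: "\<bar>iter_partial js F \<xi>\<bar> \<le> 2 ^ k * 1 / t ^ k" "norm (\<xi> - x) \<le> real k * t"
    using iterated_difference_quotient[of js F t 1 x] F t bound len by auto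
  have "\<bar>iter_partial js F \<xi> - iter_partial js F x\<bar> \<le> c / t ^ k" by (rule osc[OF len \<xi>(2)])
  then have "\<bar>iter_partial js F x\<bar> \<le> 2 ^ k * 1 / t ^ k + c / t ^ k" using \<xi>(1) by linarith
  then show ?case using len by (simp add: add_divide_distrib)
next
  case (Suc d)
  let ?n = "real CARD('n)" and ?j = "length js"
  define L where "L = (2 ^ k + c) * (1 + ?n * real k) ^ d"
  have kj: "k - ?j = Suc d" "?j < k" using Suc.hyps(2) by simp_all
  have L: "2 ^ k + c \<le> L"
  proof -
    have "(2 ^ k + c) * 1 \<le> L" unfolding L_def using c by (intro mult_left_mono one_le_power) auto
    then show ?thesis by simp
  qed
  have "(0::real) < 2 ^ k" by simp
  then have L0: "L \<ge> 0" using L c by linarith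
  obtain \<xi> where \<xi>: "\<bar>iter_partial js F \<xi>\<bar> \<le> 2 ^ ?j * 1 / t ^ ?j" "norm (\<xi> - x) \<le> real ?j * t"
    using iterated_difference_quotient[of js F t 1 x] Ck_mono[OF Suc.prems F] t bound by auto
  have "\<bar>iter_partial js F x - iter_partial js F \<xi>\<bar> \<le> ?n * (L / t ^ Suc ?j) * norm (x - \<xi>)"
  proof (rule coordinate_path_bound)
    show "\<bar>partial_deriv i (iter_partial js F) v\<bar> \<le> L / t ^ Suc ?j" for i v
    proof -
      have "d = k - length (js @ [i])" using kj by simp
      then show ?thesis
        using Suc.hyps(1)[of "js @ [i]" v] kj by (simp add: iter_partial_append L_def)
    qed
  qed (rule iter_partial_differentiable[OF F kj(2)])
  also have "\<dots> \<le> ?n * (L / t ^ Suc ?j) * (real k * t)"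
  proof (intro mult_left_mono)
    have "norm (x - \<xi>) \<le> real ?j * t" using \<xi>(2) by (simp add: norm_minus_commute)
    also have "\<dots> \<le> real k * t" using kj t by (intro mult_right_mono) auto
    finally show "norm (x - \<xi>) \<le> real k * t" .
  qed (use L0 t in auto)
  also have "\<dots> = ?n * real k * L / t ^ ?j" using t by simp
  finally have "\<bar>iter_partial js F x\<bar> \<le> 2 ^ ?j * 1 / t ^ ?j + ?n * real k * L / t ^ ?j"
    using \<xi>(1) by linarith
  also have "\<dots> = (2 ^ ?j + ?n * real k * L) / t ^ ?j" by (simp add: add_divide_distrib)
  also have "\<dots> \<le> (L + ?n * real k * L) / t ^ ?j"
  proof (intro divide_right_mono add_right_mono)
    have "(2::real) ^ ?j \<le> 2 ^ k" using kj by (intro power_increasing) auto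
    then show "2 ^ ?j \<le> L" using L c by linarith
  qed (use t in auto)
  also have "L + ?n * real k * L = (2 ^ k + c) * (1 + ?n * real k) ^ (k - ?j)"
    unfolding kj L_def by (simp add: algebra_simps)
  finally show ?case .
qed

section \<open>Bump functions\<close>

text \<open>Exponent 1 would leave a corner at 0; this is why \<open>bump_fun_deriv\<close> stops at
  order \<open>k\<close>.\<close>

lemma DERIV_pos_part_power:
  assumes "j \<ge> 2"
  shows "((\<lambda>v::real. max 0 v ^ j) has_real_derivative real j * max 0 v ^ (j - 1)) (at v)"
proof -
  consider "v > 0" | "v < 0" | "v = 0" by linarith
  then show ?thesis
  proof cases
    case 1
    have "((\<lambda>v. v ^ j) has_real_derivative real j * v ^ (j - 1)) (at v)"
      by (auto intro!: derivative_eq_intros)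
    then have "((\<lambda>v. max 0 v ^ j) has_real_derivative real j * v ^ (j - 1)) (at v)"
      by (rule has_field_derivative_transform_within_open[of _ _ _ "{0<..}"]) (use 1 in auto)
    then show ?thesis using 1 by simp
  next
    case 2
    have "((\<lambda>v. 0) has_real_derivative 0) (at v)" by simp
    then have "((\<lambda>v. max 0 v ^ j) has_real_derivative 0) (at v)"
      by (rule has_field_derivative_transform_within_open[of _ _ _ "{..<0}"]) (use 2 assms in auto)
    moreover have "real j * max 0 v ^ (j - 1) = 0" using 2 assms by (simp add: max_def power_0_left)
    ultimately show ?thesis by (simp only:)
  next
    case 3
    have "(\<lambda>h::real. max 0 h ^ j / h) \<midarrow>0\<rightarrow> 0"
    proof (rule Lim_null_comparison)
      have "norm (max 0 h ^ j / h) \<le> \<bar>h\<bar>" if "\<bar>h\<bar> \<le> 1" "h \<noteq> 0" for h :: real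
      proof (cases "h > 0")
        case True
        then have "h ^ j \<le> h ^ 2" using that assms by (intro power_decreasing) auto
        then show ?thesis using True by (simp add: field_simps power2_eq_square)
      qed (use assms that in \<open>auto simp: max_def power_0_left\<close>)
      then show "\<forall>\<^sub>F h in at 0. norm (max 0 h ^ j / h) \<le> \<bar>h\<bar>"
        unfolding eventually_at by (intro exI[of _ 1]) (auto simp: dist_real_def)
      show "((\<lambda>h::real. \<bar>h\<bar>) \<longlongrightarrow> 0) (at 0)"
        by (rule tendsto_eq_intros refl | simp)+
    qed
    then show ?thesis using 3 assms by (simp add: DERIV_def power_0_left)
  qed
qed

context
  fixes k :: nat
begin

text \<open>The polynomial factor that remains when the \<open>b\<close>-th derivative of
  \<open>u ^ a * (1 - u ^ (2 * k + 2)) ^ (k + 2)\<close> is divided by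
  \<open>(1 - u ^ (2 * k + 2)) ^ (k + 2 - b)\<close>.\<close>

primrec bump_poly :: "nat \<Rightarrow> nat \<Rightarrow> real poly" where
  "bump_poly a 0 = [:0, 1:] ^ a"
| "bump_poly a (Suc b) = pderiv (bump_poly a b) * (1 - [:0, 1:] ^ (2 * k + 2)) -
     smult (real (k + 2 - b) * real (2 * k + 2)) (bump_poly a b * [:0, 1:] ^ (2 * k + 1))"

text \<open>The \<open>b\<close>-th derivative of \<open>u ^ a * (1 - u ^ (2 * k + 2)) ^ (k + 2)\<close> on \<open>[-1, 1]\<close>, extended by
  0. The exponent \<open>2 * k + 2\<close> makes the Taylor polynomial of order \<open>k\<close> at 0 equal to \<open>u ^ a\<close>.\<close>

definition bump_fun :: "nat \<Rightarrow> nat \<Rightarrow> real \<Rightarrow> real" where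
  "bump_fun a b u = poly (bump_poly a b) u * max 0 (1 - u ^ (2 * k + 2)) ^ (k + 2 - b)"

lemma bump_fun_deriv:
  assumes "b \<le> k"
  shows "(bump_fun a b has_real_derivative bump_fun a (Suc b) u) (at u)"
proof -
  define j where "j = k + 1 - b"
  define p where "p = 2 * k + 1"
  have j: "k + 2 - b = Suc j" "k + 2 - Suc b = j" "Suc j \<ge> 2" using assms by (auto simp: j_def)
  let ?m = "\<lambda>u. max 0 (1 - u ^ Suc p)"
  have "((\<lambda>u. 1 - u ^ Suc p) has_real_derivative - (real (Suc p) * u ^ p)) (at u)"
    by (auto intro!: derivative_eq_intros simp del: power_Suc)
  from DERIV_chain2[OF DERIV_pos_part_power[OF j(3)] this]
  have "((\<lambda>u. ?m u ^ Suc j) has_real_derivative real (Suc j) * ?m u ^ j * - (real (Suc p) * u ^ p)) (at u)"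
    by simp
  from DERIV_mult[OF poly_DERIV this, of "bump_poly a b"]
  have "((\<lambda>u. poly (bump_poly a b) u * ?m u ^ Suc j) has_real_derivative
     poly (pderiv (bump_poly a b)) u * ?m u ^ Suc j + real (Suc j) * ?m u ^ j * - (real (Suc p) * u ^ p) * poly (bump_poly a b) u) (at u)"
    by (simp add: mult.commute)
  moreover have A: "?m u ^ Suc j = (1 - u ^ Suc p) * ?m u ^ j"
    using j(3) by (cases "1 - u ^ Suc p \<ge> 0") (auto simp: max_def)
  have "poly (pderiv (bump_poly a b)) u * ?m u ^ Suc j + real (Suc j) * ?m u ^ j * - (real (Suc p) * u ^ p) * poly (bump_poly a b) u
      = (poly (pderiv (bump_poly a b)) u * (1 - u ^ Suc p) - real (Suc j) * real (Suc p) * (poly (bump_poly a b) u * u ^ p)) * ?m u ^ j"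
    unfolding A by (simp add: algebra_simps del: power_Suc of_nat_Suc)
  ultimately have "((\<lambda>u. poly (bump_poly a b) u * ?m u ^ Suc j) has_real_derivative
     (poly (pderiv (bump_poly a b)) u * (1 - u ^ Suc p) - real (Suc j) * real (Suc p) * (poly (bump_poly a b) u * u ^ p)) * ?m u ^ j) (at u)"
    by (simp only:)
  moreover have "Suc p = 2 * k + 2" by (simp add: p_def)
  ultimately show ?thesis
    unfolding bump_fun_def[abs_def] j(1,2) bump_poly.simps by (simp add: p_def poly_power j del: power_Suc)
qed

lemma bump_fun_cont: "continuous_on UNIV (bump_fun a b)"
  unfolding bump_fun_def[abs_def] by (intro continuous_intros)

lemma bump_fun_support:
  assumes "b \<le> k + 1" "\<bar>u\<bar> \<ge> 1"
  shows "bump_fun a b u = 0"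
proof -
  have "1 \<le> \<bar>u\<bar> ^ (2 * k + 2)" using assms(2) by (rule one_le_power)
  also have "\<bar>u\<bar> ^ (2 * k + 2) = u ^ (2 * k + 2)" by (simp add: power_even_abs)
  finally have "max 0 (1 - u ^ (2 * k + 2)) = 0" by linarith
  then show ?thesis using assms(1) by (simp add: bump_fun_def del: power_Suc)
qed

lemma pderiv_power_mult:
  fixes p :: "real poly"
  shows "pderiv (p ^ Suc s * r) = p ^ s * (p * pderiv r + smult (of_nat (Suc s)) (pderiv p * r))"
  by (simp only: pderiv_mult pderiv_power_Suc) (simp add: algebra_simps)

text \<open>Differentiation lowers the order of vanishing of the error by one, and all further terms
  contain a high power of the variable. For \<open>b \<le> k\<close> a positive power is left, so
  the error is invisible at 0.\<close>

lemma bump_poly_low_order: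
  assumes "b \<le> 2 * k + 1"
  shows "[:0, 1:] ^ (2 * k + 2 - b) dvd bump_poly a b - (pderiv ^^ b) ([:0, 1:] ^ a)"
  using assms
proof (induction b)
  case (Suc b)
  let ?X = "[:0, 1:] :: real poly"
  define s where "s = 2 * k + 1 - b"
  have s: "2 * k + 2 - b = Suc s" "2 * k + 2 - Suc b = s" using Suc.prems by (auto simp: s_def)
  let ?m = "(pderiv ^^ b) (?X ^ a)"
  obtain r where r: "bump_poly a b - ?m = ?X ^ Suc s * r"
    using Suc s by (auto simp: dvd_def)
  have dX: "?X ^ s dvd ?X ^ (2 * k + 2)" "?X ^ s dvd ?X ^ (2 * k + 1)"
    by (rule le_imp_power_dvd, simp add: s_def)+
  have "pderiv (bump_poly a b) - pderiv ?m = pderiv (?X ^ Suc s * r)"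
    unfolding r[symmetric] by (rule pderiv_diff[symmetric])
  also have "\<dots> = ?X ^ s * (?X * pderiv r + smult (of_nat (Suc s)) (pderiv ?X * r))"
    by (rule pderiv_power_mult)
  finally have D: "?X ^ s dvd pderiv (bump_poly a b) - pderiv ?m" by simp
  have "?X ^ s dvd (pderiv (bump_poly a b) - pderiv ?m) - pderiv (bump_poly a b) * ?X ^ (2 * k + 2) -
     smult (real (k + 2 - b) * real (2 * k + 2)) (bump_poly a b * ?X ^ (2 * k + 1))"
    by (rule dvd_diff[OF dvd_diff[OF D dvd_mult[OF dX(1)]] dvd_smult[OF dvd_mult[OF dX(2)]]])
  moreover have "bump_poly a (Suc b) - (pderiv ^^ Suc b) (?X ^ a) = (pderiv (bump_poly a b) - pderiv ?m)
    - pderiv (bump_poly a b) * ?X ^ (2 * k + 2) -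
     smult (real (k + 2 - b) * real (2 * k + 2)) (bump_poly a b * ?X ^ (2 * k + 1))"
    by (simp add: algebra_simps)
  ultimately show ?case unfolding s(2) by (simp only:)
qed simp

lemma pderiv_power_X:
  "(pderiv ^^ b) ([:0, 1:] ^ a) = (if b \<le> a then smult (fact a / fact (a - b)) ([:0, 1:] ^ (a - b)) else (0 :: real poly))"
proof (induction b)
  case (Suc b)
  show ?case
  proof (cases "Suc b \<le> a")
    case True
    then obtain d where d: "a - b = Suc d" by (cases "a - b") auto
    then have d': "a - Suc b = d" by simp
    have c: "fact a / fact (Suc d) * real (Suc d) = (fact a / fact d :: real)"
      by (simp add: fact_Suc del: of_nat_Suc)
    have "(pderiv ^^ Suc b) ([:0, 1:] ^ a) = pderiv (smult (fact a / fact (Suc d)) ([:0, 1:] ^ Suc d :: real poly))"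
      using Suc True d by simp
    also have "\<dots> = smult (fact a / fact (Suc d) * real (Suc d)) ([:0, 1:] ^ d)"
      by (simp add: pderiv_smult pderiv_power_Suc pderiv_pCons del: power_Suc of_nat_Suc fact_Suc)
    finally show ?thesis using True d' c by simp
  qed (use Suc in \<open>auto simp: not_le less_Suc_eq_le pderiv_smult\<close>)
qed simp

lemma bump_fun_center:
  assumes "b \<le> k"
  shows "bump_fun a b 0 = (if a = b then fact a else 0)"
proof -
  obtain r where r: "bump_poly a b - (pderiv ^^ b) ([:0, 1:] ^ a) = [:0, 1:] ^ (2 * k + 2 - b) * r"
    using bump_poly_low_order[of b a] assms by (auto simp: dvd_def)
  have "poly (bump_poly a b - (pderiv ^^ b) ([:0, 1:] ^ a)) 0 = 0"
    unfolding r using assms by (simp add: poly_power)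
  then have "poly (bump_poly a b) 0 = (if a = b then fact a else 0)"
    by (auto simp: pderiv_power_X poly_power power_0_left split: if_splits)
  then show ?thesis using assms by (simp add: bump_fun_def)
qed

lemma bump_fun_bounded:
  assumes "b \<le> k + 1"
  shows "\<exists>B. \<forall>u. \<bar>bump_fun a b u\<bar> \<le> B"
proof -
  have c: "compact (bump_fun a b ` {-1..1})"
    by (intro compact_continuous_image continuous_on_subset[OF bump_fun_cont]) auto
  then obtain B where B: "\<And>u. u \<in> {-1..1} \<Longrightarrow> norm (bump_fun a b u) \<le> B"
    using compact_imp_bounded[OF c] unfolding bounded_iff by blast
  have "\<bar>bump_fun a b u\<bar> \<le> B" for u
  proof (cases "u \<in> {-1..1}")
    case False
    then have "bump_fun a b u = 0" by (intro bump_fun_support[OF assms]) auto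
    then show ?thesis using B[of 0] norm_ge_zero[of "bump_fun a b 0"] by auto
  qed (use B in auto)
  then show ?thesis by blast
qed

end

lemma bump_fun_bound: "\<exists>B\<ge>1. \<forall>a\<le>k. \<forall>b\<le>k + 1. \<forall>u. \<bar>bump_fun k a b u\<bar> \<le> B"
proof -
  have "\<forall>a. \<forall>b\<in>{..k + 1}. \<exists>B. \<forall>u. \<bar>bump_fun k a b u\<bar> \<le> B"
    using bump_fun_bounded by auto
  then obtain B where B: "\<And>a b u. b \<le> k + 1 \<Longrightarrow> \<bar>bump_fun k a b u\<bar> \<le> B a b"
    by (metis atMost_iff)
  define B' where "B' = 1 + (\<Sum>a\<le>k. \<Sum>b\<le>k + 1. \<bar>B a b\<bar>)"
  have "\<bar>bump_fun k a b u\<bar> \<le> B'" if "a \<le> k" "b \<le> k + 1" for a b u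
  proof -
    have "\<bar>B a b\<bar> \<le> (\<Sum>b\<le>k + 1. \<bar>B a b\<bar>)" using that by (intro member_le_sum) auto
    also have "\<dots> \<le> (\<Sum>a\<le>k. \<Sum>b\<le>k + 1. \<bar>B a b\<bar>)"
      using that by (intro member_le_sum[of a "{..k}" "\<lambda>a. \<Sum>b\<le>k + 1. \<bar>B a b\<bar>"] sum_nonneg) auto
    finally show ?thesis using B[of b a u] that by (simp add: B'_def)
  qed
  moreover have "B' \<ge> 1" by (auto simp: B'_def intro!: sum_nonneg)
  ultimately show ?thesis by blast
qed

section \<open>Whitney extension from finite sets\<close>

lemma scaled_bump:
  fixes x :: "real ^ 'n::finite"
  assumes "\<rho> > 0"
  shows "Ck (Suc k) (\<lambda>y. \<Prod>i\<in>UNIV. bump_fun k (\<alpha> i) 0 ((y $ i - x $ i) / \<rho>))"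
    and "length js \<le> Suc k \<Longrightarrow> iter_partial js (\<lambda>y. \<Prod>i\<in>UNIV. bump_fun k (\<alpha> i) 0 ((y $ i - x $ i) / \<rho>)) y =
      (\<Prod>i\<in>UNIV. bump_fun k (\<alpha> i) (count_list js i) ((y $ i - x $ i) / \<rho>)) / \<rho> ^ length js"
proof -
  define g where "g i b u = bump_fun k (\<alpha> i) b ((u - x $ i) / \<rho>) / \<rho> ^ b" for i b u
  have deriv: "(g i b has_real_derivative g i (Suc b) u) (at u)" if "b < Suc k" for i b u
  proof -
    have inner: "((\<lambda>u. (u - x $ i) / \<rho>) has_real_derivative 1 / \<rho>) (at u)"
      using assms by (auto intro!: derivative_eq_intros)
    have "((\<lambda>u. bump_fun k (\<alpha> i) b ((u - x $ i) / \<rho>) / \<rho> ^ b) has_real_derivative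
      bump_fun k (\<alpha> i) (Suc b) ((u - x $ i) / \<rho>) * (1 / \<rho>) / \<rho> ^ b) (at u)"
      using that by (intro DERIV_cdivide DERIV_chain2[OF bump_fun_deriv inner]) auto
    then show ?thesis by (simp add: g_def[abs_def])
  qed
  have cont: "continuous_on UNIV (g i b)" for i b
    unfolding g_def[abs_def] using assms
    by (intro continuous_intros continuous_on_compose2[OF bump_fun_cont]) auto
  have eq: "(\<lambda>y. \<Prod>i\<in>UNIV. bump_fun k (\<alpha> i) 0 ((y $ i - x $ i) / \<rho>)) = (\<lambda>y. \<Prod>i\<in>UNIV. g i ((\<lambda>_. 0) i) (y $ i))"
    by (simp add: g_def)
  show "Ck (Suc k) (\<lambda>y. \<Prod>i\<in>UNIV. bump_fun k (\<alpha> i) 0 ((y $ i - x $ i) / \<rho>))"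
    unfolding eq by (rule tensor_smooth(1)[of "Suc k" g]) (use deriv cont in auto)
  assume js: "length js \<le> Suc k"
  have "iter_partial js (\<lambda>y. \<Prod>i\<in>UNIV. bump_fun k (\<alpha> i) 0 ((y $ i - x $ i) / \<rho>)) y = (\<Prod>i\<in>UNIV. g i (0 + count_list js i) (y $ i))"
    unfolding eq by (subst tensor_smooth(2)[of "Suc k" g _ "Suc k"]) (use deriv cont js in auto)
  also have "\<dots> = (\<Prod>i\<in>UNIV. bump_fun k (\<alpha> i) (count_list js i) ((y $ i - x $ i) / \<rho>)) / (\<Prod>i\<in>UNIV. \<rho> ^ count_list js i)"
    by (simp add: g_def prod_dividef)
  also have "(\<Prod>i\<in>UNIV. \<rho> ^ count_list js i) = \<rho> ^ length js"
    by (simp add: power_sum[symmetric] mi_order_count_list[symmetric] mi_order_def)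
  finally show "iter_partial js (\<lambda>y. \<Prod>i\<in>UNIV. bump_fun k (\<alpha> i) 0 ((y $ i - x $ i) / \<rho>)) y =
      (\<Prod>i\<in>UNIV. bump_fun k (\<alpha> i) (count_list js i) ((y $ i - x $ i) / \<rho>)) / \<rho> ^ length js" .
qed

lemma count_list_le_length: "count_list js i \<le> length js"
  by (induction js) auto

text \<open>A copy of the jet of \<open>R\<close> at \<open>x\<close> confined to the cube of
  half-side \<open>\<rho>\<close>. The bound at order \<open>k + 1\<close> controls the oscillation
  of the top derivatives at distances below \<open>\<rho>\<close>.\<close>

definition localizes ::
    "nat \<Rightarrow> (real ^ 'n \<Rightarrow> real) \<Rightarrow> real ^ 'n \<Rightarrow> real \<Rightarrow> real \<Rightarrow> (real ^ 'n::finite \<Rightarrow> real) \<Rightarrow> bool" where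
  "localizes k R x \<rho> M g \<longleftrightarrow> Ck (Suc k) g \<and>
     (\<forall>js y. length js \<le> k \<longrightarrow> \<bar>iter_partial js g y\<bar> \<le> M * \<rho> ^ (k - length js)) \<and>
     (\<forall>js y. length js = Suc k \<longrightarrow> \<bar>iter_partial js g y\<bar> \<le> M / \<rho>) \<and>
     (\<forall>js. length js \<le> k \<longrightarrow> iter_partial js g x = iter_partial js R x) \<and>
     (\<forall>js y. length js \<le> k \<longrightarrow> (\<exists>i. \<bar>y $ i - x $ i\<bar> \<ge> \<rho>) \<longrightarrow> iter_partial js g y = 0)"

text \<open>Instead of multiplying \<open>R\<close> by a cut-off, each monomial of its Taylor
  polynomial at \<open>x\<close> is replaced by a rescaled bump with the same \<open>k\<close>-jet
  there. This avoids the Leibniz rule and makes the jet at \<open>x\<close> exact.\<close>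

lemma localized_jet:
  "\<exists>C\<ge>1. \<forall>(R :: real ^ 'n::finite \<Rightarrow> real) x \<rho> M. poly_like k R \<longrightarrow> \<rho> > 0 \<longrightarrow>
     (\<forall>js. length js \<le> k \<longrightarrow> \<bar>iter_partial js R x\<bar> \<le> M * \<rho> ^ (k - length js)) \<longrightarrow> (\<exists>g. localizes k R x \<rho> (C * M) g)"
proof -
  obtain B where B: "B \<ge> 1" "\<And>a b u. a \<le> k \<Longrightarrow> b \<le> k + 1 \<Longrightarrow> \<bar>bump_fun k a b u\<bar> \<le> B"
    using bump_fun_bound[of k] by blast
  define A where "A = {\<alpha> :: 'n \<Rightarrow> nat. mi_order \<alpha> \<le> k}"
  have finA: "finite A" by (simp add: A_def finite_mi_order_le)
  have "(\<lambda>_. 0) \<in> A" by (simp add: A_def mi_order_def)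
  then have cardA: "card A \<ge> 1" using finA by (metis One_nat_def Suc_leI card_gt_0_iff empty_iff)
  define C where "C = real (card A) * B ^ CARD('n)"
  have C: "C \<ge> 1"
  proof -
    have "1 * 1 \<le> real (card A) * B ^ CARD('n)"
      using cardA B(1) by (intro mult_mono one_le_power) auto
    then show ?thesis by (simp add: C_def)
  qed
  show ?thesis
  proof (intro exI[of _ C] conjI allI impI C)
    fix R :: "real ^ 'n \<Rightarrow> real" and x \<rho> M
    assume R: "poly_like k R" and \<rho>: "\<rho> > 0"
      and low: "\<forall>js. length js \<le> k \<longrightarrow> \<bar>iter_partial js R x\<bar> \<le> M * \<rho> ^ (k - length js)"
    define c where "c \<alpha> = \<rho> ^ mi_order \<alpha> * (mi_deriv \<alpha> R x / mi_fact \<alpha>)" for \<alpha>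
    define b where "b \<alpha> = (\<lambda>y :: real ^ 'n. \<Prod>i\<in>UNIV. bump_fun k (\<alpha> i) 0 ((y $ i - x $ i) / \<rho>))" for \<alpha>
    have bCk: "Ck (Suc k) (b \<alpha>)" for \<alpha> unfolding b_def by (rule scaled_bump(1)[OF \<rho>])
    have b_iter: "iter_partial js (b \<alpha>) y =
      (\<Prod>i\<in>UNIV. bump_fun k (\<alpha> i) (count_list js i) ((y $ i - x $ i) / \<rho>)) / \<rho> ^ length js" if "length js \<le> Suc k" for js \<alpha> y
      unfolding b_def by (rule scaled_bump(2)[OF \<rho> that])
    define g where "g = (\<lambda>y. \<Sum>\<alpha>\<in>A. c \<alpha> * b \<alpha> y)"
    have g_iter: "iter_partial js g y = (\<Sum>\<alpha>\<in>A. c \<alpha> * iter_partial js (b \<alpha>) y)" if "length js \<le> Suc k" for js y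
      unfolding g_def by (subst iter_partial_sum[OF bCk that]) simp
    have M: "M * \<rho> ^ k \<ge> 0" using low[rule_format, of "[]"] by simp
    have c_le: "\<bar>c \<alpha>\<bar> \<le> M * \<rho> ^ k" if "\<alpha> \<in> A" for \<alpha>
    proof -
      have ord: "mi_order \<alpha> \<le> k" using that by (simp add: A_def)
      have "\<bar>mi_deriv \<alpha> R x\<bar> \<le> M * \<rho> ^ (k - mi_order \<alpha>)"
        using low[rule_format, of "mi_list \<alpha>"] ord by (simp add: mi_deriv_def length_mi_list)
      moreover have "mi_fact \<alpha> \<ge> 1" unfolding mi_fact_def by (intro prod_ge_1) (simp add: fact_ge_1)
      then have "\<bar>mi_deriv \<alpha> R x / mi_fact \<alpha>\<bar> \<le> \<bar>mi_deriv \<alpha> R x\<bar> / 1"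
        unfolding abs_divide by (intro divide_mono) auto
      ultimately have "\<bar>c \<alpha>\<bar> \<le> \<rho> ^ mi_order \<alpha> * (M * \<rho> ^ (k - mi_order \<alpha>))"
        unfolding c_def abs_mult using \<rho> by (intro mult_mono) auto
      also have "\<dots> = M * (\<rho> ^ mi_order \<alpha> * \<rho> ^ (k - mi_order \<alpha>))" by simp
      also have "\<rho> ^ mi_order \<alpha> * \<rho> ^ (k - mi_order \<alpha>) = \<rho> ^ k"
        using ord by (simp flip: power_add)
      finally show ?thesis .
    qed
    have g_le: "\<bar>iter_partial js g y\<bar> \<le> C * (M * \<rho> ^ k) / \<rho> ^ length js" if js: "length js \<le> Suc k" for js y
    proof -
      have "\<bar>c \<alpha> * iter_partial js (b \<alpha>) y\<bar> \<le> (M * \<rho> ^ k) * (B ^ CARD('n) / \<rho> ^ length js)" if \<alpha>: "\<alpha> \<in> A" for \<alpha>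
      proof -
        have "\<bar>\<Prod>i\<in>UNIV. bump_fun k (\<alpha> i) (count_list js i) ((y $ i - x $ i) / \<rho>)\<bar> \<le> (\<Prod>i\<in>(UNIV :: 'n set). B)"
          unfolding abs_prod
        proof (rule prod_mono, intro conjI B(2))
          fix i :: 'n
          show "\<alpha> i \<le> k" using \<alpha> mi_component_le_order[of \<alpha> i] by (simp add: A_def)
          show "count_list js i \<le> k + 1" using count_list_le_length[of js i] js by simp
        qed auto
        then have "\<bar>iter_partial js (b \<alpha>) y\<bar> \<le> B ^ CARD('n) / \<rho> ^ length js"
          unfolding b_iter[OF js] abs_divide using \<rho> by (intro divide_mono) auto
        then show ?thesis unfolding abs_mult using c_le[OF \<alpha>] M by (intro mult_mono) auto
      qed
      then have "(\<Sum>\<alpha>\<in>A. \<bar>c \<alpha> * iter_partial js (b \<alpha>) y\<bar>) \<le> (\<Sum>\<alpha>\<in>A. (M * \<rho> ^ k) * (B ^ CARD('n) / \<rho> ^ length js))"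
        by (rule sum_mono)
      then have "\<bar>iter_partial js g y\<bar> \<le> (\<Sum>\<alpha>\<in>A. (M * \<rho> ^ k) * (B ^ CARD('n) / \<rho> ^ length js))"
        unfolding g_iter[OF js] by (rule order_trans[OF sum_abs])
      then show ?thesis by (simp add: C_def mult_ac)
    qed
    show "\<exists>g. localizes k R x \<rho> (C * M) g"
      unfolding localizes_def
    proof (intro exI[of _ g] conjI allI impI)
      show "Ck (Suc k) g" unfolding g_def by (rule Ck_sum[OF bCk])
    next
      fix js :: "'n list" and y assume js: "length js \<le> k"
      then have "\<rho> ^ k / \<rho> ^ length js = \<rho> ^ (k - length js)" using \<rho> by (simp add: power_diff)
      then have "C * (M * \<rho> ^ k) / \<rho> ^ length js = C * M * \<rho> ^ (k - length js)" by (simp add: mult.assoc flip: times_divide_eq_right)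
      then show "\<bar>iter_partial js g y\<bar> \<le> C * M * \<rho> ^ (k - length js)"
        using g_le[of js y] js by simp
    next
      fix js :: "'n list" and y assume js: "length js = Suc k"
      then have "C * (M * \<rho> ^ k) / \<rho> ^ length js = C * M / \<rho>" using \<rho> by simp
      then show "\<bar>iter_partial js g y\<bar> \<le> C * M / \<rho>" using g_le[of js y] js by simp
    next
      fix js :: "'n list" assume js: "length js \<le> k"
      have center: "iter_partial js (b \<alpha>) x = (if \<alpha> = count_list js then mi_fact \<alpha> / \<rho> ^ length js else 0)" for \<alpha>
      proof -
        have cnt: "count_list js i \<le> k" for i using count_list_le_length[of js i] js by simp
        have "iter_partial js (b \<alpha>) x = (\<Prod>i\<in>UNIV. bump_fun k (\<alpha> i) (count_list js i) 0) / \<rho> ^ length js"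
          using js by (simp add: b_iter)
        also have "(\<Prod>i\<in>UNIV. bump_fun k (\<alpha> i) (count_list js i) 0) = (if \<alpha> = count_list js then mi_fact \<alpha> else 0)"
        proof (cases "\<alpha> = count_list js")
          case True
          then show ?thesis using cnt by (simp add: bump_fun_center mi_fact_def)
        next
          case False
          then obtain i where "\<alpha> i \<noteq> count_list js i" by auto
          then have "bump_fun k (\<alpha> i) (count_list js i) 0 = 0" using cnt by (simp add: bump_fun_center)
          then show ?thesis using False by (auto intro!: prod_zero)
        qed
        finally show ?thesis by simp
      qed
      have mem: "count_list js \<in> A" using js by (simp add: A_def mi_order_count_list)
      have "iter_partial js g x = (\<Sum>\<alpha>\<in>A. if \<alpha> = count_list js then c \<alpha> * (mi_fact \<alpha> / \<rho> ^ length js) else 0)"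
        using js by (subst g_iter) (auto simp: center intro!: sum.cong)
      also have "\<dots> = c (count_list js) * (mi_fact (count_list js) / \<rho> ^ length js)"
        using finA mem by (simp add: sum.delta)
      also have "\<dots> = mi_deriv (count_list js) R x"
        using \<rho> mi_fact_pos[of "count_list js"] by (simp add: c_def mi_order_count_list)
      also have "\<dots> = iter_partial js R x"
        using iter_partial_eq_mi_deriv[OF poly_like_Ck[OF R] js] by simp
      finally show "iter_partial js g x = iter_partial js R x" .
    next
      fix js :: "'n list" and y assume js: "length js \<le> k" and "\<exists>i. \<bar>y $ i - x $ i\<bar> \<ge> \<rho>"
      then obtain i where i: "\<bar>y $ i - x $ i\<bar> \<ge> \<rho>" by blast
      have "iter_partial js (b \<alpha>) y = 0" for \<alpha>
      proof -
        have "bump_fun k (\<alpha> i) (count_list js i) ((y $ i - x $ i) / \<rho>) = 0"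
          using i \<rho> count_list_le_length[of js i] js by (intro bump_fun_support) (auto simp: abs_divide)
        then have "(\<Prod>i\<in>UNIV. bump_fun k (\<alpha> i) (count_list js i) ((y $ i - x $ i) / \<rho>)) = 0"
          by (intro prod_zero) auto
        then show ?thesis using js by (simp add: b_iter)
      qed
      then show "iter_partial js g y = 0" using js by (simp add: g_iter)
    qed
  qed
qed

section \<open>Moduli of continuity and extension at the scale \<open>t\<close>\<close>

text \<open>What is kept of concavity after truncation at 1: the last condition says that
  \<open>w t / t\<close> does not increase.\<close>

definition modulus :: "(real \<Rightarrow> real) \<Rightarrow> bool" where
  "modulus w \<longleftrightarrow> (\<forall>t>0. w t > 0) \<and> w 0 \<ge> 0 \<and> (\<forall>s t. 0 \<le> s \<longrightarrow> s \<le> t \<longrightarrow> w s \<le> w t) \<and>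
     (\<forall>c t. 1 \<le> c \<longrightarrow> 0 \<le> t \<longrightarrow> w (c * t) \<le> c * w t)"

lemma modulusD:
  assumes "modulus w"
  shows "t > 0 \<Longrightarrow> w t > 0" "t \<ge> 0 \<Longrightarrow> w t \<ge> 0" "0 \<le> s \<Longrightarrow> s \<le> t \<Longrightarrow> w s \<le> w t"
    "1 \<le> c \<Longrightarrow> 0 \<le> t \<Longrightarrow> w (c * t) \<le> c * w t"
  using assms by (auto simp: modulus_def less_eq_real_def)

definition jet_bounded :: "nat \<Rightarrow> (real \<Rightarrow> real) \<Rightarrow> real \<Rightarrow> real \<Rightarrow> (real ^ 'n::finite \<Rightarrow> real) \<Rightarrow> bool" where
  "jet_bounded k w t C F \<longleftrightarrow> Ck k F \<and> (\<forall>js y. length js \<le> k \<longrightarrow> \<bar>iter_partial js F y\<bar> \<le> C / t ^ length js) \<and>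
     (\<forall>js u v. length js = k \<longrightarrow> \<bar>iter_partial js F u - iter_partial js F v\<bar> \<le> C * w (norm (u - v)))"

definition whitney_field ::
    "nat \<Rightarrow> (real \<Rightarrow> real) \<Rightarrow> real \<Rightarrow> real \<Rightarrow> (real ^ 'n) set \<Rightarrow> (real ^ 'n \<Rightarrow> real ^ 'n::finite \<Rightarrow> real) \<Rightarrow> bool" where
  "whitney_field k w t C S q \<longleftrightarrow> (\<forall>x\<in>S. poly_like k (q x)) \<and>
     (\<forall>x\<in>S. \<forall>js. length js \<le> k \<longrightarrow> \<bar>iter_partial js (q x) x\<bar> \<le> C / t ^ length js) \<and>
     (\<forall>x\<in>S. \<forall>y\<in>S. x \<noteq> y \<longrightarrow> (\<forall>js. length js \<le> k \<longrightarrow>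
        \<bar>iter_partial js (q x - q y) x\<bar> \<le> C * w (norm (x - y)) * norm (x - y) ^ (k - length js)))"

lemma jet_bounded_zero: "jet_bounded k w t 0 (\<lambda>_. 0)"
  by (simp add: jet_bounded_def Ck_zero iter_partial_zero)

lemma jet_bounded_add:
  assumes "jet_bounded k w t C F" "jet_bounded k w t D g"
  shows "jet_bounded k w t (C + D) (F + g)"
proof -
  have F: "Ck k F" and g: "Ck k g" using assms by (auto simp: jet_bounded_def)
  have *: "iter_partial js (F + g) y = iter_partial js F y + iter_partial js g y" if "length js \<le> k" for js y
    by (rule iter_partial_add[OF F g that])
  show ?thesis
    unfolding jet_bounded_def
  proof (intro conjI allI impI)
    show "Ck k (F + g)" by (rule Ck_add[OF F g])
    fix js :: "'a list" and y assume js: "length js \<le> k"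
    then have "\<bar>iter_partial js F y\<bar> \<le> C / t ^ length js" "\<bar>iter_partial js g y\<bar> \<le> D / t ^ length js"
      using assms by (auto simp: jet_bounded_def)
    then show "\<bar>iter_partial js (F + g) y\<bar> \<le> (C + D) / t ^ length js"
      unfolding *[OF js] add_divide_distrib by linarith
  next
    fix js :: "'a list" and u v assume js: "length js = k"
    then have "\<bar>iter_partial js F u - iter_partial js F v\<bar> \<le> C * w (norm (u - v))"
      "\<bar>iter_partial js g u - iter_partial js g v\<bar> \<le> D * w (norm (u - v))"
      using assms by (auto simp: jet_bounded_def)
    then show "\<bar>iter_partial js (F + g) u - iter_partial js (F + g) v\<bar> \<le> (C + D) * w (norm (u - v))"
      unfolding *[OF eq_refl[OF js]] distrib_right by linarith
  qed
qed

text \<open>For points at distance at least \<open>\<rho>\<close> the sizes of the top derivatives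
  suffice, since \<open>w\<close> is monotone. For points at distance \<open>d < \<rho>\<close> the
  order \<open>k + 1\<close> bound gives a multiple of \<open>w \<rho> * d / \<rho>\<close>, which
  is at most \<open>w d\<close> because \<open>w t / t\<close> does not increase.\<close>

lemma jet_bounded_localized:
  fixes g :: "real ^ 'n::finite \<Rightarrow> real"
  assumes w: "modulus w" and t: "t > 0" "w t * t ^ k = 1" and \<rho>: "0 < \<rho>" "\<rho> \<le> t" and M: "M \<ge> 0"
    and g: "Ck (Suc k) g"
    and low: "\<And>js y. length js \<le> k \<Longrightarrow> \<bar>iter_partial js g y\<bar> \<le> M * w \<rho> * \<rho> ^ (k - length js)"
    and top: "\<And>js y. length js = Suc k \<Longrightarrow> \<bar>iter_partial js g y\<bar> \<le> M * w \<rho> / \<rho>"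
  shows "jet_bounded k w t ((real CARD('n) + 2) * M) g"
  unfolding jet_bounded_def
proof (intro conjI allI impI)
  let ?n = "real CARD('n)"
  have M': "M \<le> (?n + 2) * M" "2 * M \<le> (?n + 2) * M" "?n * M \<le> (?n + 2) * M"
    using M by (auto simp: algebra_simps intro!: add_increasing)
  have w\<rho>: "0 \<le> w \<rho>" using modulusD(2)[OF w] \<rho> by simp
  show "Ck k g" by (rule Ck_Suc[OF g])
  fix js :: "'n list" and y assume js: "length js \<le> k"
  have "w \<rho> * \<rho> ^ (k - length js) \<le> w t * t ^ (k - length js)"
    using \<rho> w w\<rho> modulusD(2)[OF w, of t] by (intro mult_mono modulusD(3)[OF w] power_mono) auto
  also have "\<dots> = w t * t ^ k / t ^ length js" using js t by (simp add: power_diff)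
  finally have "w \<rho> * \<rho> ^ (k - length js) \<le> 1 / t ^ length js" unfolding t(2) .
  then have "M * (w \<rho> * \<rho> ^ (k - length js)) \<le> M * (1 / t ^ length js)" using M by (intro mult_left_mono)
  then have "\<bar>iter_partial js g y\<bar> \<le> M / t ^ length js" using low[OF js, of y] by (simp add: mult.assoc)
  also have "\<dots> \<le> (?n + 2) * M / t ^ length js" using M' t by (intro divide_right_mono) auto
  finally show "\<bar>iter_partial js g y\<bar> \<le> (?n + 2) * M / t ^ length js" .
next
  let ?n = "real CARD('n)"
  have M': "2 * M \<le> (?n + 2) * M" "?n * M \<le> (?n + 2) * M"
    using M by (auto simp: algebra_simps intro!: add_increasing)
  have w\<rho>: "0 \<le> w \<rho>" using modulusD(2)[OF w] \<rho> by simp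
  fix js :: "'n list" and u v :: "real ^ 'n" assume js: "length js = k"
  let ?d = "norm (u - v)"
  consider "u = v" | "?d \<ge> \<rho>" | "u \<noteq> v" "?d < \<rho>" by linarith
  then show "\<bar>iter_partial js g u - iter_partial js g v\<bar> \<le> (?n + 2) * M * w ?d"
  proof cases
    case 1
    then show ?thesis using M modulusD(2)[OF w, of 0] by simp
  next
    case 2
    have "\<bar>iter_partial js g u - iter_partial js g v\<bar> \<le> 2 * M * w \<rho>"
      using low[of js u] low[of js v] js by simp
    also have "\<dots> \<le> (?n + 2) * M * w ?d"
      using M M' w\<rho> 2 \<rho> by (intro mult_mono modulusD(3)[OF w]) auto
    finally show ?thesis .
  next
    case 3
    then have d: "0 < ?d" by simp
    have "\<bar>iter_partial js g u - iter_partial js g v\<bar> \<le> ?n * (M * w \<rho> / \<rho>) * ?d"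
    proof (rule coordinate_path_bound)
      show "partial_differentiable i (iter_partial js g) z" for i z
        by (rule iter_partial_differentiable[OF g]) (simp add: js)
      show "\<bar>partial_deriv i (iter_partial js g) z\<bar> \<le> M * w \<rho> / \<rho>" for i z
        using top[of "js @ [i]" z] js by (simp add: iter_partial_append)
    qed
    also have "\<dots> = ?n * M * (w \<rho> * (?d / \<rho>))" by simp
    also have "w \<rho> * (?d / \<rho>) \<le> w ?d"
    proof -
      have "w \<rho> \<le> (\<rho> / ?d) * w ?d"
        using modulusD(4)[OF w, of "\<rho> / ?d" ?d] 3 d by simp
      then show ?thesis using \<rho>(1) d by (simp add: field_simps)
    qed
    then have "?n * M * (w \<rho> * (?d / \<rho>)) \<le> ?n * M * w ?d" using M by (intro mult_left_mono) auto
    also have "\<dots> \<le> (?n + 2) * M * w ?d"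
      by (rule mult_right_mono[OF M'(2) modulusD(2)[OF w norm_ge_zero]])
    finally show ?thesis .
  qed
qed

text \<open>The constant grows with each added point but does not see the configuration or
  \<open>w\<close>. The correction at a new point is small because it can be compared with the
  nearest earlier point, where the extension already has the right jet.\<close>

lemma whitney_extension_finite:
  "\<exists>C\<ge>0. \<forall>w t (S :: (real ^ 'n::finite) set) q. modulus w \<longrightarrow> t > 0 \<longrightarrow> w t * t ^ k = 1 \<longrightarrow>
     finite S \<longrightarrow> card S = N \<longrightarrow> whitney_field k w t C0 S q \<longrightarrow>
     (\<exists>F. jet_bounded k w t C F \<and> (\<forall>x\<in>S. taylor_poly k x F = q x))"
proof (induction N)
  case 0
  show ?case by (intro exI[of _ 0]) (auto intro!: exI[of _ "\<lambda>_. 0"] jet_bounded_zero)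
next
  case (Suc N)
  let ?n = "real CARD('n)"
  obtain C1 where C1: "C1 \<ge> 0" "\<And>w t (S :: (real ^ 'n) set) q. modulus w \<Longrightarrow> t > 0 \<Longrightarrow> w t * t ^ k = 1 \<Longrightarrow>
     finite S \<Longrightarrow> card S = N \<Longrightarrow> whitney_field k w t C0 S q \<Longrightarrow>
     \<exists>F. jet_bounded k w t C1 F \<and> (\<forall>x\<in>S. taylor_poly k x F = q x)"
    using Suc.IH by blast
  obtain Cb where Cb1: "Cb \<ge> 1" and Cb: "\<forall>(R :: real ^ 'n \<Rightarrow> real) x \<rho> M. poly_like k R \<longrightarrow> \<rho> > 0 \<longrightarrow>
     (\<forall>js. length js \<le> k \<longrightarrow> \<bar>iter_partial js R x\<bar> \<le> M * \<rho> ^ (k - length js)) \<longrightarrow>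
     (\<exists>g. localizes k R x \<rho> (Cb * M) g)"
    using localized_jet[where 'n = 'n, of k] by (elim exE conjE)
  define C2 where "C2 = \<bar>C0\<bar> + (?n + 1) ^ k * C1"
  define C3 where "C3 = Cb * (C2 * ?n ^ (k + 1))"
  have C2: "C2 \<ge> 0" using C1(1) by (simp add: C2_def)
  have C3: "C3 \<ge> 0" using Cb1 C2 by (simp add: C3_def)
  show ?case
  proof (intro exI[of _ "C1 + (?n + 2) * C3"] conjI allI impI)
    show "0 \<le> C1 + (?n + 2) * C3" using C1(1) C3 by simp
    fix w t and S :: "(real ^ 'n) set" and q
    assume w: "modulus w" and t: "t > 0" "w t * t ^ k = 1" and S: "finite S" "card S = Suc N"
      and q: "whitney_field k w t C0 S q"
    obtain x S' where xS: "S = insert x S'" "x \<notin> S'" "card S' = N" "finite S'"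
      using S by (metis card_Suc_eq_finite)
    have "whitney_field k w t C0 S' q" using q by (auto simp: whitney_field_def xS(1))
    then obtain F1 where F1: "jet_bounded k w t C1 F1" "\<And>z. z \<in> S' \<Longrightarrow> taylor_poly k z F1 = q z"
      using C1(2)[OF w t xS(4,3)] by blast
    have F1Ck: "Ck k F1" using F1(1) by (simp add: jet_bounded_def)
    have qx: "poly_like k (q x)" using q by (simp add: whitney_field_def xS(1))
    define R where "R = q x - taylor_poly k x F1"
    have R: "poly_like k R" unfolding R_def by (intro poly_like_diff qx poly_like_taylor)
    have T: "Ck k (taylor_poly k z F1)" for z by (rule poly_like_Ck[OF poly_like_taylor])
    \<comment> \<open>\<open>t\<close> is counted among the distances: if all earlier points are
      farther away, the one-point bounds replace the comparison with an earlier point.\<close>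
    define D where "D = insert t ((\<lambda>z. norm (x - z)) ` S')"
    define r where "r = Min D"
    have D: "finite D" "D \<noteq> {}" using xS by (auto simp: D_def)
    have r_le: "r \<le> t" "\<And>z. z \<in> S' \<Longrightarrow> r \<le> norm (x - z)"
      unfolding r_def using D(1) by (auto intro!: Min_le simp: D_def)
    have r_mem: "r \<in> D" unfolding r_def by (rule Min_in[OF D])
    have r: "r > 0" using r_mem t xS by (auto simp: D_def)
    have wr: "w r \<ge> 0" using modulusD(2)[OF w] r by simp
    have n1: "1 \<le> ?n" using card_gt_0_iff[of "UNIV :: 'n set"] by (simp add: Suc_le_eq)
    have p1: "1 \<le> (?n + 1) ^ j" for j by (rule one_le_power) simp
    have R_le: "\<bar>iter_partial js R x\<bar> \<le> C2 * w r * r ^ (k - length js)" if js: "length js \<le> k" for js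
      using r_mem unfolding D_def
    proof (rule insertE)
      assume rt: "r = t"
      have "w t * t ^ (k - length js) = w t * t ^ k / t ^ length js" using js t(1) by (simp add: power_diff)
      then have wt: "w t * t ^ (k - length js) = 1 / t ^ length js" unfolding t(2) .
      have "iter_partial js R x = iter_partial js (q x) x - iter_partial js F1 x"
        unfolding R_def by (subst iter_partial_diff[OF poly_like_Ck[OF qx] T js]) (simp add: taylor_poly_center[OF F1Ck js])
      moreover have "\<bar>iter_partial js (q x) x\<bar> \<le> C0 / t ^ length js"
        using q js by (simp add: whitney_field_def xS(1))
      moreover have "C0 / t ^ length js \<le> \<bar>C0\<bar> / t ^ length js" using t by (intro divide_right_mono) auto
      moreover have "\<bar>iter_partial js F1 x\<bar> \<le> C1 / t ^ length js"
        using F1(1) js by (simp add: jet_bounded_def)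
      moreover have "C1 / t ^ length js \<le> (?n + 1) ^ k * C1 / t ^ length js"
        using mult_right_mono[OF p1[of k] C1(1)] t by (intro divide_right_mono) auto
      ultimately have "\<bar>iter_partial js R x\<bar> \<le> \<bar>C0\<bar> / t ^ length js + (?n + 1) ^ k * C1 / t ^ length js"
        by linarith
      also have "\<dots> = C2 * (w t * t ^ (k - length js))" unfolding wt C2_def by (simp add: add_divide_distrib)
      finally show ?thesis by (simp add: rt mult.assoc)
    next
      assume "r \<in> (\<lambda>z. norm (x - z)) ` S'"
      then obtain z where z: "z \<in> S'" "r = norm (x - z)" by blast
      have qz: "poly_like k (q z)" using q z by (simp add: whitney_field_def xS(1))
      have xz: "x \<noteq> z" using z xS by auto
      \<comment> \<open>\<open>F1\<close> has the jet \<open>q z\<close> at \<open>z\<close>, so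
        only two differences remain, controlled by the Whitney conditions for \<open>q\<close> and
        for \<open>F1\<close>.\<close>
      have Req: "R = (q x - q z) - (taylor_poly k x F1 - taylor_poly k z F1)"
        unfolding R_def F1(2)[OF z(1)] by simp
      have "iter_partial js R x = iter_partial js (q x - q z) x - iter_partial js (taylor_poly k x F1 - taylor_poly k z F1) x"
        unfolding Req by (rule iter_partial_diff[OF Ck_diff Ck_diff[OF T T] js]) (rule poly_like_Ck[OF qx] poly_like_Ck[OF qz])+
      moreover have "\<bar>iter_partial js (q x - q z) x\<bar> \<le> C0 * w r * r ^ (k - length js)"
        using q js z xz by (simp add: whitney_field_def xS(1))
      moreover have "C0 * w r * r ^ (k - length js) \<le> \<bar>C0\<bar> * (w r * r ^ (k - length js))"
        using wr r by (simp add: mult.assoc mult_right_mono)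
      moreover have "\<bar>iter_partial js (taylor_poly k x F1 - taylor_poly k z F1) x\<bar> \<le>
         (?n + 1) ^ (k - length js) * (C1 * w r) * r ^ (k - length js)"
        unfolding z(2)
      proof (rule whitney_condition[OF F1Ck _ js])
        fix js :: "'n list" and v assume "length js = k" and v: "norm (v - z) \<le> norm (x - z)"
        then have "\<bar>iter_partial js F1 v - iter_partial js F1 z\<bar> \<le> C1 * w (norm (v - z))"
          using F1(1) by (simp add: jet_bounded_def)
        also have "\<dots> \<le> C1 * w (norm (x - z))"
          using C1(1) v by (intro mult_left_mono modulusD(3)[OF w]) auto
        finally show "\<bar>iter_partial js F1 v - iter_partial js F1 z\<bar> \<le> C1 * w (norm (x - z))" .
      qed
      moreover have "(?n + 1) ^ (k - length js) * (C1 * w r) * r ^ (k - length js) \<le> (?n + 1) ^ k * C1 * (w r * r ^ (k - length js))"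
      proof -
        have "(?n + 1) ^ (k - length js) \<le> (?n + 1) ^ k" by (intro power_increasing) auto
        then have "(?n + 1) ^ (k - length js) * (C1 * (w r * r ^ (k - length js))) \<le> (?n + 1) ^ k * (C1 * (w r * r ^ (k - length js)))"
          using C1(1) wr r by (intro mult_right_mono) auto
        then show ?thesis by (simp add: mult.assoc)
      qed
      ultimately have "\<bar>iter_partial js R x\<bar> \<le> \<bar>C0\<bar> * (w r * r ^ (k - length js)) + (?n + 1) ^ k * C1 * (w r * r ^ (k - length js))"
        by linarith
      then show ?thesis by (simp add: C2_def algebra_simps)
    qed
    \<comment> \<open>The open cube of half-side \<open>r / CARD('n)\<close> misses every point at
      distance at least \<open>r\<close>, because the norm is at most the sum of the absolute values
      of the coordinates.\<close>
    define \<rho> where "\<rho> = r / ?n"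
    have \<rho>: "\<rho> > 0" "\<rho> \<le> t" "r = ?n * \<rho>"
    proof -
      show "\<rho> > 0" "r = ?n * \<rho>" using r n1 by (auto simp: \<rho>_def)
      have "\<rho> \<le> r / 1" unfolding \<rho>_def using r n1 by (intro divide_left_mono) auto
      then show "\<rho> \<le> t" using r_le(1) by simp
    qed
    have w\<rho>: "w \<rho> \<ge> 0" using modulusD(2)[OF w] \<rho> by simp
    define M where "M = C2 * ?n ^ (k + 1) * w \<rho>"
    have R_le': "\<bar>iter_partial js R x\<bar> \<le> M * \<rho> ^ (k - length js)" if js: "length js \<le> k" for js
    proof -
      have "w r \<le> ?n * w \<rho>" unfolding \<rho>(3) using n1 \<rho> by (intro modulusD(4)[OF w]) auto
      moreover have "r ^ (k - length js) \<le> ?n ^ k * \<rho> ^ (k - length js)"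
        unfolding \<rho>(3) power_mult_distrib using n1 \<rho> by (intro mult_right_mono power_increasing) auto
      ultimately have "C2 * (w r * r ^ (k - length js)) \<le> C2 * ((?n * w \<rho>) * (?n ^ k * \<rho> ^ (k - length js)))"
        using C2 w\<rho> r wr by (intro mult_left_mono mult_mono) auto
      also have "\<dots> = M * \<rho> ^ (k - length js)" by (simp add: M_def)
      finally show ?thesis using R_le[OF js] by (simp add: mult.assoc)
    qed
    obtain g where g: "Ck (Suc k) g"
       "\<And>js y. length js \<le> k \<Longrightarrow> \<bar>iter_partial js g y\<bar> \<le> Cb * M * \<rho> ^ (k - length js)"
       "\<And>js y. length js = Suc k \<Longrightarrow> \<bar>iter_partial js g y\<bar> \<le> Cb * M / \<rho>"
       "\<And>js. length js \<le> k \<Longrightarrow> iter_partial js g x = iter_partial js R x"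
       "\<And>js y i. length js \<le> k \<Longrightarrow> \<bar>y $ i - x $ i\<bar> \<ge> \<rho> \<Longrightarrow> iter_partial js g y = 0"
      using Cb[rule_format, OF R \<rho>(1) R_le'] unfolding localizes_def by blast
    have CbM: "Cb * M = C3 * w \<rho>" by (simp add: M_def C3_def)
    have gCk: "Ck k g" by (rule Ck_Suc[OF g(1)])
    have gb: "jet_bounded k w t ((?n + 2) * C3) g"
      by (rule jet_bounded_localized[OF w t \<rho>(1,2) C3 g(1)]) (use g(2,3) CbM in auto)
    show "\<exists>F. jet_bounded k w t (C1 + (?n + 2) * C3) F \<and> (\<forall>x\<in>S. taylor_poly k x F = q x)"
    proof (intro exI[of _ "F1 + g"] conjI ballI)
      show "jet_bounded k w t (C1 + (?n + 2) * C3) (F1 + g)" by (rule jet_bounded_add[OF F1(1) gb])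
      fix z assume "z \<in> S"
      then consider "z = x" | "z \<in> S'" using xS(1) by blast
      then have "iter_partial js (F1 + g) z = iter_partial js (q z) z" if js: "length js \<le> k" for js
      proof cases
        case 1
        have "iter_partial js R x = iter_partial js (q x) x - iter_partial js F1 x"
          unfolding R_def by (subst iter_partial_diff[OF poly_like_Ck[OF qx] T js]) (simp add: taylor_poly_center[OF F1Ck js])
        then show ?thesis unfolding 1 by (simp add: iter_partial_add[OF F1Ck gCk js] g(4)[OF js])
      next
        case 2
        have "\<exists>i. \<bar>z $ i - x $ i\<bar> \<ge> \<rho>"
        proof (rule ccontr)
          assume "\<not> ?thesis"
          then have lt: "\<bar>(x - z) $ i\<bar> < \<rho>" for i by (simp add: not_le abs_minus_commute)
          have "norm (x - z) \<le> (\<Sum>i\<in>UNIV. \<bar>(x - z) $ i\<bar>)" by (rule norm_le_l1_cart)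
          also have "\<dots> < (\<Sum>i\<in>(UNIV :: 'n set). \<rho>)" using lt by (intro sum_strict_mono) auto
          finally show False using r_le(2)[OF 2] \<rho>(3) by simp
        qed
        then obtain i where "\<bar>z $ i - x $ i\<bar> \<ge> \<rho>" by blast
        from g(5)[OF js this] have "iter_partial js (F1 + g) z = iter_partial js F1 z"
          by (simp add: iter_partial_add[OF F1Ck gCk js])
        also have "\<dots> = iter_partial js (taylor_poly k z F1) z" by (simp add: taylor_poly_center[OF F1Ck js])
        finally show ?thesis by (simp add: F1(2)[OF 2])
      qed
      then have "taylor_poly k z (F1 + g) = taylor_poly k z (q z)" by (rule taylor_poly_cong)
      also have "\<dots> = q z" using q \<open>z \<in> S\<close> by (intro taylor_poly_poly_like) (simp add: whitney_field_def)
      finally show "taylor_poly k z (F1 + g) = q z" .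
    qed
  qed
qed

section \<open>Jets of functions with bounded norm\<close>

lemma concave_scaled_le:
  assumes "concave_on {0..} \<omega>" "\<omega> 0 = 0" "1 \<le> c" "0 \<le> t"
  shows "\<omega> (c * t) \<le> c * \<omega> (t::real)"
proof -
  have "(1 - 1 / c) * \<omega> 0 + (1 / c) * \<omega> (c * t) \<le> \<omega> ((1 - 1 / c) *\<^sub>R 0 + (1 / c) *\<^sub>R (c * t))"
    using assms by (intro concave_onD[OF assms(1)]) auto
  then show ?thesis using assms by (simp add: field_simps)
qed

lemma concave_nonneg_mono:
  assumes conc: "concave_on {0..} \<omega>" and nonneg: "\<And>t. t \<ge> 0 \<Longrightarrow> \<omega> t \<ge> 0" and st: "0 \<le> s" "s \<le> (t::real)"
  shows "\<omega> s \<le> \<omega> t"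
proof (rule ccontr)
  assume "\<not> ?thesis"
  then have lt: "\<omega> t < \<omega> s" by simp
  then have "s < t" using st by (cases "s = t") auto
  \<comment> \<open>At \<open>T\<close> the line through the two points of the graph has the value
    -1, so concavity would push \<open>\<omega> T\<close> below zero.\<close>
  define T where "T = t + (t - s) * (\<omega> t + 1) / (\<omega> s - \<omega> t)"
  have "T > t" using lt \<open>s < t\<close> nonneg[of t] st by (simp add: T_def)
  define u where "u = (t - s) / (T - s)"
  have u: "0 \<le> u" "u \<le> 1" using \<open>s < t\<close> \<open>T > t\<close> by (auto simp: u_def)
  have "(1 - u) * \<omega> s + u * \<omega> T \<le> \<omega> ((1 - u) *\<^sub>R s + u *\<^sub>R T)"
    using u st \<open>T > t\<close> by (intro concave_onD[OF conc]) auto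
  also have "(1 - u) *\<^sub>R s + u *\<^sub>R T = s + u * (T - s)" by (simp add: algebra_simps)
  also have "\<dots> = t" using \<open>s < t\<close> \<open>T > t\<close> by (simp add: u_def)
  finally have "(1 - u) * \<omega> s \<le> \<omega> t" using u nonneg[of T] \<open>T > t\<close> st by (smt (verit) mult_nonneg_nonneg)
  moreover have "1 - u = (T - t) / (T - s)" using \<open>s < t\<close> \<open>T > t\<close> by (simp add: u_def field_simps)
  ultimately have "(T - t) * \<omega> s \<le> \<omega> t * (T - s)" using \<open>s < t\<close> \<open>T > t\<close> by (simp add: field_simps)
  then have "(T - t) * (\<omega> s - \<omega> t) \<le> \<omega> t * (t - s)" by (simp add: algebra_simps)
  moreover have "(T - t) * (\<omega> s - \<omega> t) = (t - s) * (\<omega> t + 1)" using lt by (simp add: T_def)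
  ultimately show False using \<open>s < t\<close> by (simp add: algebra_simps)
qed

lemma truncated_modulus:
  assumes conc: "concave_on {0..} \<omega>" and nonneg: "\<forall>t\<ge>0. \<omega> t \<ge> 0" and zero: "\<omega> 0 = 0" and nz: "\<exists>t\<ge>0. \<omega> t \<noteq> 0"
  shows "\<And>t. t > 0 \<Longrightarrow> \<omega> t > (0::real)" and "modulus (\<lambda>t. min 1 (\<omega> t))"
proof -
  have mono: "\<omega> s \<le> \<omega> t" if "0 \<le> s" "s \<le> t" for s t
    using nonneg that by (intro concave_nonneg_mono[OF conc]) auto
  obtain a where a: "a > 0" "\<omega> a > 0" using nz nonneg zero by (metis less_eq_real_def)
  show pos: "\<omega> t > 0" if "t > 0" for t
  proof (cases "a \<le> t")
    case True
    then show ?thesis using mono[of a t] a by simp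
  next
    case False
    then have "\<omega> ((a / t) * t) \<le> (a / t) * \<omega> t"
      using that a by (intro concave_scaled_le[OF conc zero]) auto
    then have "0 < (a / t) * \<omega> t" using that a by simp
    then show ?thesis using that a by (simp add: zero_less_mult_iff zero_less_divide_iff)
  qed
  have scale: "min 1 (\<omega> (c * t)) \<le> c * min 1 (\<omega> t)" if "1 \<le> c" "0 \<le> t" for c t
  proof (cases "\<omega> t \<le> 1")
    case True
    then show ?thesis using concave_scaled_le[OF conc zero that] by simp
  qed (use that in auto)
  show "modulus (\<lambda>t. min 1 (\<omega> t))"
    unfolding modulus_def using pos zero mono scale by (auto simp: min_le_iff_disj)
qed

text \<open>Intermediate value theorem on \<open>[1, 1 / w 1]\<close>. Truncation at 1 gives
  \<open>w 1 \<le> 1\<close> and thereby \<open>t \<ge> 1\<close>, so that later a bound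
  \<open>C / t ^ j\<close> implies the bound \<open>C\<close>.\<close>

lemma natural_scale:
  assumes "k \<ge> 1" "continuous_on {0..} \<omega>" "modulus w" "w = (\<lambda>t. min 1 (\<omega> t))"
  shows "\<exists>t\<ge>1. w t * t ^ k = (1::real)"
proof -
  have w1: "0 < w 1" "w 1 \<le> 1" using modulusD(1)[OF assms(3), of 1] by (auto simp: assms(4))
  define T where "T = 1 / w 1"
  have T: "T \<ge> 1" using w1 by (simp add: T_def)
  have "continuous_on {1..T} (\<lambda>t. w t * t ^ k)"
    unfolding assms(4) by (intro continuous_intros continuous_on_subset[OF assms(2)]) auto
  moreover have "w 1 * 1 ^ k \<le> 1" using w1 by simp
  moreover have "1 \<le> w T * T ^ k"
  proof -
    have "w 1 * T ^ 1 \<le> w T * T ^ k"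
      using T w1 assms(1) by (intro mult_mono modulusD(3)[OF assms(3)] power_increasing modulusD(2)[OF assms(3)]) auto
    then show ?thesis using w1 by (simp add: T_def)
  qed
  ultimately show ?thesis using IVT'[of "\<lambda>t. w t * t ^ k" 1 1 T] T by auto
qed

lemma Ck_omega_norm_le_oneD:
  assumes "Ck_omega_norm k \<omega> f \<le> 1"
  shows "mi_order \<alpha> \<le> k \<Longrightarrow> \<bar>mi_deriv \<alpha> f x\<bar> \<le> 1"
    and "mi_order \<alpha> = k \<Longrightarrow> x \<noteq> y \<Longrightarrow> \<bar>mi_deriv \<alpha> f x - mi_deriv \<alpha> f y\<bar> / \<omega> (norm (x - y)) \<le> 1"
proof -
  let ?A = "\<lambda>\<alpha>. SUP x. ennreal \<bar>mi_deriv \<alpha> f x\<bar>"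
  let ?B = "\<lambda>\<alpha>. SUP (x, y)\<in>{(x, y). x \<noteq> y}. ennreal (\<bar>mi_deriv \<alpha> f x - mi_deriv \<alpha> f y\<bar> / \<omega> (norm (x - y)))"
  have le: "(\<Sum>\<alpha> | mi_order \<alpha> \<le> k. ?A \<alpha>) \<le> 1" "(\<Sum>\<alpha> | mi_order \<alpha> = k. ?B \<alpha>) \<le> 1"
    using order_trans[OF add_increasing2[OF zero_le order_refl] assms[unfolded Ck_omega_norm_def]]
      order_trans[OF add_increasing[OF zero_le order_refl] assms[unfolded Ck_omega_norm_def]] by blast+
  show "\<bar>mi_deriv \<alpha> f x\<bar> \<le> 1" if "mi_order \<alpha> \<le> k"
  proof -
    have "ennreal \<bar>mi_deriv \<alpha> f x\<bar> \<le> ?A \<alpha>" by (rule SUP_upper) simp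
    also have "\<dots> \<le> (\<Sum>\<alpha> | mi_order \<alpha> \<le> k. ?A \<alpha>)"
      using that by (intro member_le_sum) (auto simp: finite_mi_order_le)
    finally have "ennreal \<bar>mi_deriv \<alpha> f x\<bar> \<le> 1" using le(1) by (rule order_trans)
    then show ?thesis by simp
  qed
  show "\<bar>mi_deriv \<alpha> f x - mi_deriv \<alpha> f y\<bar> / \<omega> (norm (x - y)) \<le> 1" if "mi_order \<alpha> = k" "x \<noteq> y"
  proof -
    have "ennreal (\<bar>mi_deriv \<alpha> f x - mi_deriv \<alpha> f y\<bar> / \<omega> (norm (x - y))) \<le> ?B \<alpha>"
      by (rule SUP_upper2[of "(x, y)"]) (use that in auto)
    also have "\<dots> \<le> (\<Sum>\<alpha> | mi_order \<alpha> = k. ?B \<alpha>)"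
      using that by (intro member_le_sum) (auto simp: finite_mi_order_eq)
    finally have "ennreal (\<bar>mi_deriv \<alpha> f x - mi_deriv \<alpha> f y\<bar> / \<omega> (norm (x - y))) \<le> 1" using le(2) by (rule order_trans)
    then show ?thesis by simp
  qed
qed

text \<open>The two summands of \<open>C\<close> are the constants of
  \<open>interpolation_bound\<close>, with \<open>c = 2 * k\<close>, and of
  \<open>whitney_condition\<close>, with oscillation \<open>2 * w\<close>.\<close>

lemma taylor_field_whitney:
  fixes F :: "real ^ 'n::finite \<Rightarrow> real"
  assumes k: "k \<ge> 1" and \<omega>: "\<And>t. t > 0 \<Longrightarrow> \<omega> t > 0" and w: "modulus w" "w = (\<lambda>t. min 1 (\<omega> t))"
    and t: "t \<ge> 1" "w t * t ^ k = 1"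
    and F: "Ck k F" "Ck_omega_norm k \<omega> F \<le> 1"
    and C: "C = (2 ^ k + 2 * real k) * (1 + real CARD('n) * real k) ^ k + 2 * (real CARD('n) + 1) ^ k"
  shows "whitney_field k w t C S (\<lambda>x. taylor_poly k x F)"
proof -
  let ?n = "real CARD('n)"
  have bound: "\<bar>iter_partial js F x\<bar> \<le> 1" if "length js \<le> k" for js x
    using Ck_omega_norm_le_oneD(1)[OF F(2), of "count_list js" x] that
    by (simp add: iter_partial_eq_mi_deriv[OF F(1)] mi_order_count_list)
  \<comment> \<open>The difference is at most \<open>\<omega>\<close> by the seminorm and at most 2
    by the sup bounds; twice the truncation covers both.\<close>
  have osc: "\<bar>iter_partial js F u - iter_partial js F v\<bar> \<le> 2 * w (norm (u - v))" if js: "length js = k" for js u v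
  proof (cases "u = v")
    case True
    then show ?thesis using modulusD(2)[OF w(1), of 0] by simp
  next
    case False
    then have "\<omega> (norm (u - v)) > 0" by (intro \<omega>) simp
    then have "\<bar>iter_partial js F u - iter_partial js F v\<bar> \<le> \<omega> (norm (u - v))"
      using Ck_omega_norm_le_oneD(2)[OF F(2), of "count_list js" u v] js False
      by (simp add: iter_partial_eq_mi_deriv[OF F(1)] mi_order_count_list)
    moreover have "\<bar>iter_partial js F u - iter_partial js F v\<bar> \<le> 2"
      using bound[of js u] bound[of js v] js by linarith
    ultimately show ?thesis unfolding w(2) by (auto simp: min_def)
  qed
  have T: "poly_like k (taylor_poly k x F)" for x by (rule poly_like_taylor)
  have C': "(2 ^ k + 2 * real k) * (1 + ?n * real k) ^ k \<le> C" "2 * (?n + 1) ^ k \<le> C" by (auto simp: C)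
  show ?thesis
    unfolding whitney_field_def
  proof (intro conjI ballI allI impI T)
    fix x :: "real ^ 'n" and js :: "'n list" assume js: "length js \<le> k"
    have "\<bar>iter_partial js F x\<bar> \<le> (2 ^ k + 2 * real k) * (1 + ?n * real k) ^ (k - length js) / t ^ length js"
    proof (rule interpolation_bound[OF F(1) _ _ _ _ js])
      show "\<bar>F y\<bar> \<le> 1" for y using bound[of "[]" y] by simp
      fix js :: "'n list" and u v :: "real ^ 'n" assume "length js = k" and uv: "norm (u - v) \<le> real k * t"
      then have "\<bar>iter_partial js F u - iter_partial js F v\<bar> \<le> 2 * w (norm (u - v))" by (intro osc)
      also have "w (norm (u - v)) \<le> w (real k * t)" using uv by (intro modulusD(3)[OF w(1)]) auto
      \<comment> \<open>An iterated difference makes up to \<open>k\<close> steps of length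
        \<open>t\<close>, so points at distance \<open>k * t\<close> occur; hence the factor
        \<open>k\<close>.\<close>
      also have "\<dots> \<le> real k * w t" using k t by (intro modulusD(4)[OF w(1)]) auto
      also have "w t = 1 / t ^ k" using t by (simp add: field_simps)
      finally show "\<bar>iter_partial js F u - iter_partial js F v\<bar> \<le> 2 * real k / t ^ k" by simp
    qed (use t in auto)
    also have "(1 + ?n * real k) ^ (k - length js) \<le> (1 + ?n * real k) ^ k" by (intro power_increasing) auto
    then have "(2 ^ k + 2 * real k) * (1 + ?n * real k) ^ (k - length js) / t ^ length js \<le> C / t ^ length js"
      using t by (intro divide_right_mono order_trans[OF _ C'(1)] mult_left_mono) auto
    finally show "\<bar>iter_partial js (taylor_poly k x F) x\<bar> \<le> C / t ^ length js"
      by (simp add: taylor_poly_center[OF F(1) js])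
  next
    fix x y :: "real ^ 'n" and js :: "'n list" assume js: "length js \<le> k"
    let ?d = "norm (x - y)"
    have "\<bar>iter_partial js (taylor_poly k x F - taylor_poly k y F) x\<bar> \<le> (?n + 1) ^ (k - length js) * (2 * w ?d) * ?d ^ (k - length js)"
    proof (rule whitney_condition[OF F(1) _ js])
      fix js :: "'n list" and v assume h: "length js = k" "norm (v - y) \<le> ?d"
      show "\<bar>iter_partial js F v - iter_partial js F y\<bar> \<le> 2 * w ?d"
        using osc[OF h(1), of v y] modulusD(3)[OF w(1) norm_ge_zero h(2)] by linarith
    qed
    also have "\<dots> = 2 * (?n + 1) ^ (k - length js) * (w ?d * ?d ^ (k - length js))" by simp
    also have "\<dots> \<le> C * (w ?d * ?d ^ (k - length js))"
    proof (rule mult_right_mono)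
      have "(?n + 1) ^ (k - length js) \<le> (?n + 1) ^ k" by (intro power_increasing) auto
      then show "2 * (?n + 1) ^ (k - length js) \<le> C" using C'(2) by linarith
    qed (use modulusD(2)[OF w(1)] in auto)
    finally show "\<bar>iter_partial js (taylor_poly k x F - taylor_poly k y F) x\<bar> \<le> C * w ?d * ?d ^ (k - length js)"
      by (simp add: mult.assoc)
  qed
qed

lemma jet_bounded_norm_le:
  fixes F :: "real ^ 'n::finite \<Rightarrow> real"
  assumes F: "jet_bounded k w t C F" and t: "t \<ge> 1" and C: "C \<ge> 0" and \<omega>: "\<And>t. t > 0 \<Longrightarrow> \<omega> t > 0"
    and w: "w = (\<lambda>t. min 1 (\<omega> t))"
  shows "Ck_omega_norm k \<omega> F \<le> ennreal (2 * real (card {\<alpha> :: 'n \<Rightarrow> nat. mi_order \<alpha> \<le> k}) * C)"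
proof -
  let ?A = "{\<alpha> :: 'n \<Rightarrow> nat. mi_order \<alpha> \<le> k}" and ?B = "{\<alpha> :: 'n \<Rightarrow> nat. mi_order \<alpha> = k}"
  have bound: "\<bar>iter_partial js F x\<bar> \<le> C / t ^ length js" if "length js \<le> k" for js x
    using F that by (simp add: jet_bounded_def)
  have osc: "\<bar>iter_partial js F x - iter_partial js F y\<bar> \<le> C * w (norm (x - y))" if "length js = k" for js x y
    using F that by (simp add: jet_bounded_def)
  have "\<bar>mi_deriv \<alpha> F x\<bar> \<le> C" if "mi_order \<alpha> \<le> k" for \<alpha> x
  proof -
    have "\<bar>mi_deriv \<alpha> F x\<bar> \<le> C / t ^ length (mi_list \<alpha>)"
      unfolding mi_deriv_def using that by (intro bound) (simp add: length_mi_list)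
    also have "\<dots> \<le> C / 1" using t C by (intro divide_left_mono one_le_power) auto
    finally show ?thesis by simp
  qed
  then have "(\<Sum>\<alpha>\<in>?A. SUP x. ennreal \<bar>mi_deriv \<alpha> F x\<bar>) \<le> (\<Sum>\<alpha>\<in>?A. ennreal C)"
    by (intro sum_mono SUP_least ennreal_leI) auto
  moreover have "\<bar>mi_deriv \<alpha> F x - mi_deriv \<alpha> F y\<bar> / \<omega> (norm (x - y)) \<le> C" if "mi_order \<alpha> = k" "x \<noteq> y" for \<alpha> x y
  proof -
    have pos: "\<omega> (norm (x - y)) > 0" using that by (intro \<omega>) simp
    have "\<bar>mi_deriv \<alpha> F x - mi_deriv \<alpha> F y\<bar> \<le> C * w (norm (x - y))"
      unfolding mi_deriv_def using that by (intro osc) (simp add: length_mi_list)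
    also have "\<dots> \<le> C * \<omega> (norm (x - y))" using C unfolding w by (intro mult_left_mono) auto
    finally show ?thesis using pos by (simp add: field_simps)
  qed
  then have "(\<Sum>\<alpha>\<in>?B. SUP (x, y)\<in>{(x, y). x \<noteq> y}. ennreal (\<bar>mi_deriv \<alpha> F x - mi_deriv \<alpha> F y\<bar> / \<omega> (norm (x - y))))
      \<le> (\<Sum>\<alpha>\<in>?B. ennreal C)"
    by (intro sum_mono SUP_least) (auto intro!: ennreal_leI)
  moreover have "(\<Sum>\<alpha>\<in>?B. ennreal C) \<le> (\<Sum>\<alpha>\<in>?A. ennreal C)"
    by (intro sum_mono2) (auto simp: finite_mi_order_le)
  ultimately have "Ck_omega_norm k \<omega> F \<le> (\<Sum>\<alpha>\<in>?A. ennreal C) + (\<Sum>\<alpha>\<in>?A. ennreal C)"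
    unfolding Ck_omega_norm_def by (meson add_mono order_trans)
  also have "(\<Sum>\<alpha>\<in>?A. ennreal C) = ennreal (real (card ?A) * C)" using C by (subst sum_ennreal) auto
  finally show ?thesis using C by (simp add: mult_ac flip: ennreal_plus)
qed

section \<open>Metric clusters of a finite set\<close>

text \<open>The ratio \<open>card S + 1\<close> is the number of intervals in the pigeonhole
  argument below. \<open>S\<close> itself and all singletons satisfy the condition
  trivially.\<close>

definition metric_clusters :: "(real ^ 'n) set \<Rightarrow> (real ^ 'n) set set" where
  "metric_clusters S = {Q. Q \<subseteq> S \<and> (\<forall>x\<in>Q. \<forall>y\<in>Q. \<forall>z\<in>S - Q. norm (x - y) \<le> (real (card S) + 1) * norm (y - z))}"

text \<open>The distances to an endpoint \<open>a\<close> of a diameter of \<open>Q\<close> miss one of \<open>card S + 1\<close> intervals of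
  equal length, and \<open>Q\<close> is split at this gap.\<close>

lemma split_metric_cluster:
  assumes S: "finite S" and Q: "Q \<in> metric_clusters S" "2 \<le> card Q"
  shows "\<exists>Q1\<in>metric_clusters S. \<exists>Q2\<in>metric_clusters S.
    Q1 \<noteq> {} \<and> Q2 \<noteq> {} \<and> Q1 \<inter> Q2 = {} \<and> Q1 \<union> Q2 = Q"
proof -
  have QS: "Q \<subseteq> S" using Q by (simp add: metric_clusters_def)
  have finQ: "finite Q" using QS S finite_subset by blast
  define m where "m = card S + 1"
  define D where "D = (\<lambda>(x, y). norm (x - y)) ` (Q \<times> Q)"
  define d where "d = Max D"
  have "Q \<noteq> {}" using Q(2) by auto
  then have D: "finite D" "D \<noteq> {}" using finQ by (auto simp: D_def)
  have d_le: "norm (x - y) \<le> d" if "x \<in> Q" "y \<in> Q" for x y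
    unfolding d_def using D(1) by (rule Max_ge) (use that in \<open>auto simp: D_def\<close>)
  obtain a b where ab: "a \<in> Q" "b \<in> Q" "d = norm (a - b)"
    using Max_in[OF D] unfolding d_def D_def by auto
  have "d > 0"
  proof (rule ccontr)
    assume "\<not> d > 0"
    then have "norm (x - y) \<le> 0" if "x \<in> Q" "y \<in> Q" for x y using d_le[OF that] by linarith
    then have "x = y" if "x \<in> Q" "y \<in> Q" for x y using that by simp
    then have "Q \<subseteq> {a}" using ab by blast
    then have "card Q \<le> card {a}" by (intro card_mono) auto
    then show False using Q(2) by simp
  qed
  define f where "f y = norm (y - a)" for y
  \<comment> \<open>The number of the interval containing \<open>f y\<close>. The endpoint
    \<open>a\<close> has number 0 and \<open>b\<close> has number \<open>m\<close>, so a missed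
    number in \<open>{1..m}\<close> has points on both sides.\<close>
  define g where "g y = nat \<lceil>f y * real m / d\<rceil>" for y
  have m: "m > 0" by (simp add: m_def)
  have "card (g ` Q) \<le> card S" using card_image_le[OF finQ, of g] card_mono[OF S QS] by simp
  then have "\<not> {1..m} \<subseteq> g ` Q" using card_mono[of "g ` Q" "{1..m}"] finQ by (auto simp: m_def)
  then obtain j where "j \<in> {1..m}" "j \<notin> g ` Q" by blast
  then have j: "1 \<le> j" "j \<le> m" "j \<notin> g ` Q" by auto
  define Q1 where "Q1 = {y \<in> Q. g y < j}"
  define Q2 where "Q2 = {y \<in> Q. j < g y}"
  have gap: "d \<le> real m * norm (y - z)" if "y \<in> Q1" "z \<in> Q2" for y z
  proof -
    have "g y \<le> j - 1" "j + 1 \<le> g z" using that by (auto simp: Q1_def Q2_def)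
    then have "\<lceil>f y * real m / d\<rceil> \<le> int (j - 1)" unfolding g_def by linarith
    then have "f y * real m / d \<le> real j - 1" using j(1) by (simp only: ceiling_le_iff)
    moreover have "int j < \<lceil>f z * real m / d\<rceil>" using \<open>j + 1 \<le> g z\<close> unfolding g_def by linarith
    then have "real j < f z * real m / d" by (simp add: less_ceiling_iff)
    ultimately have "f y * real m / d \<le> real j - 1" "real j < f z * real m / d" .
    then have "1 < (f z - f y) * real m / d" by (simp add: left_diff_distrib diff_divide_distrib)
    then have "d \<le> (f z - f y) * real m" using \<open>d > 0\<close> by (simp add: field_simps)
    also have "f z - f y \<le> norm (z - y)" using norm_triangle_ineq2[of "z - a" "y - a"] by (simp add: f_def)
    then have "(f z - f y) * real m \<le> norm (z - y) * real m" by (intro mult_right_mono) auto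
    finally show ?thesis by (simp add: mult.commute norm_minus_commute)
  qed
  have Un: "Q1 \<union> Q2 = Q" using j(3) by (auto simp: Q1_def Q2_def image_iff)
  have ga: "g a = 0" by (simp add: g_def f_def)
  have gb: "g b = m" using ab \<open>d > 0\<close> by (simp add: g_def f_def norm_minus_commute)
  have a1: "a \<in> Q1" using ga ab j by (simp add: Q1_def)
  have "j \<noteq> m" using j(3) gb ab by blast
  then have b2: "b \<in> Q2" using gb ab j by (simp add: Q2_def)
  \<comment> \<open>Points of \<open>Q\<close> outside \<open>Q'\<close> are kept away by the gap,
    which is compared with the diameter of all of \<open>Q\<close>; points outside \<open>Q\<close>
    by the cluster property of \<open>Q\<close>.\<close>
  have cluster: "Q' \<in> metric_clusters S" if sub: "Q' \<subseteq> Q" and g: "\<And>y z. y \<in> Q' \<Longrightarrow> z \<in> Q - Q' \<Longrightarrow> d \<le> real m * norm (y - z)" for Q'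
    unfolding metric_clusters_def
  proof (intro CollectI conjI ballI)
    show "Q' \<subseteq> S" using sub QS by blast
    fix x y z assume xyz: "x \<in> Q'" "y \<in> Q'" "z \<in> S - Q'"
    then have xy: "x \<in> Q" "y \<in> Q" using sub by auto
    show "norm (x - y) \<le> (real (card S) + 1) * norm (y - z)"
    proof (cases "z \<in> Q")
      case True
      then show ?thesis using g[of y z] d_le[OF xy] xyz by (simp add: m_def add.commute)
    next
      case False
      then show ?thesis using Q(1) xy xyz by (auto simp: metric_clusters_def)
    qed
  qed
  have disj: "Q1 \<inter> Q2 = {}" by (auto simp: Q1_def Q2_def)
  have "Q1 \<in> metric_clusters S"
    by (rule cluster) (use gap Un disj in \<open>auto\<close>)
  moreover have "Q2 \<in> metric_clusters S"
  proof (rule cluster)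
    fix y z assume "y \<in> Q2" "z \<in> Q - Q2"
    then show "d \<le> real m * norm (y - z)" using gap[of z y] Un by (auto simp: norm_minus_commute)
  qed (use Un in auto)
  ultimately show ?thesis using Un disj a1 b2 by blast
qed

lemma subspace_polys_upto: "subspace (polys_upto k)"
  by (simp add: polys_upto_def)

lemma polys_upto_Ck: "p \<in> polys_upto k \<Longrightarrow> Ck m p"
  by (simp add: polys_upto_iff poly_like_Ck)

lemma polys_upto_diff_Ck: "p \<in> polys_upto k \<Longrightarrow> q \<in> polys_upto k \<Longrightarrow> Ck m (p - q)"
  by (intro Ck_diff polys_upto_Ck)

lemma iter_partial_combination:
  "p \<in> polys_upto k \<Longrightarrow> q \<in> polys_upto k \<Longrightarrow>
    iter_partial js (u *\<^sub>R p + v *\<^sub>R q) x = u * iter_partial js p x + v * iter_partial js q x"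
  by (simp add: iter_partial_add[of "length js"] iter_partial_scaleR[of "length js"] Ck_scaleR polys_upto_Ck)

section \<open>Constraint sets for families of jets\<close>

text \<open>Vanishing off \<open>S\<close> makes the space of families finite-dimensional when
  \<open>S\<close> is finite.\<close>

definition jet_families :: "nat \<Rightarrow> (real ^ 'n) set \<Rightarrow> (real ^ 'n \<Rightarrow> real ^ 'n::finite \<Rightarrow> real) set" where
  "jet_families k S = {q. (\<forall>x\<in>S. q x \<in> polys_upto k) \<and> (\<forall>x. x \<notin> S \<longrightarrow> q x = 0)}"

definition jet_pairs :: "nat \<Rightarrow> (real ^ 'n) set \<Rightarrow> ((real ^ 'n) \<times> (real ^ 'n) \<times> 'n::finite list) set" where
  "jet_pairs k S = {(x, y, js). x \<in> S \<and> y \<in> S \<and> x \<noteq> y \<and> length js \<le> k}"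

definition jet_eval :: "(real ^ 'n) \<times> (real ^ 'n) \<times> 'n::finite list \<Rightarrow> (real ^ 'n \<Rightarrow> real ^ 'n \<Rightarrow> real) \<Rightarrow> real" where
  "jet_eval = (\<lambda>(x, y, js) q. iter_partial js (q x - q y) x)"

definition jet_constraint_set ::
    "nat \<Rightarrow> (real \<Rightarrow> real) \<Rightarrow> real \<Rightarrow> (real ^ 'n) set \<Rightarrow> (real ^ 'n \<Rightarrow> real ^ 'n::finite \<Rightarrow> real) set" where
  "jet_constraint_set k w C S = bounded_by (jet_pairs k S) jet_eval
     (\<lambda>(x, y, js). C * w (norm (x - y)) * norm (x - y) ^ (k - length js)) (jet_families k S)"

lemma jet_constraint_set_iff:
  "q \<in> jet_constraint_set k w C S \<longleftrightarrow> (\<forall>x\<in>S. q x \<in> polys_upto k) \<and> (\<forall>x. x \<notin> S \<longrightarrow> q x = 0) \<and>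
     (\<forall>x\<in>S. \<forall>y\<in>S. x \<noteq> y \<longrightarrow> (\<forall>js. length js \<le> k \<longrightarrow>
        \<bar>iter_partial js (q x - q y) x\<bar> \<le> C * w (norm (x - y)) * norm (x - y) ^ (k - length js)))"
  by (auto simp: jet_constraint_set_def bounded_by_def jet_families_def jet_pairs_def jet_eval_def)

lemma subspace_jet_families: "subspace (jet_families k S)"
  unfolding jet_families_def using subspace_polys_upto[of k]
  by (auto simp: subspace_def scaleR_fun_def[of _ "f :: _ \<Rightarrow> _ \<Rightarrow> real" for f])

lemma jet_eval_linear:
  assumes "i \<in> jet_pairs k S" "p \<in> jet_families k S" "q \<in> jet_families k S"
  shows "jet_eval i (u *\<^sub>R p + v *\<^sub>R q) = u * jet_eval i p + v * jet_eval i q"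
proof -
  obtain x y js where i: "i = (x, y, js)" "x \<in> S" "y \<in> S" using assms(1) by (auto simp: jet_pairs_def)
  have "(u *\<^sub>R p + v *\<^sub>R q) x - (u *\<^sub>R p + v *\<^sub>R q) y = u *\<^sub>R (p x - p y) + v *\<^sub>R (q x - q y)"
    by (simp add: scaleR_fun_def[of _ p] scaleR_fun_def[of _ q] algebra_simps)
  then show ?thesis
    using assms i by (simp add: jet_eval_def jet_families_def iter_partial_combination[of _ k] subspace_diff[OF subspace_polys_upto])
qed

lemma finite_jet_pairs:
  assumes "finite S"
  shows "finite (jet_pairs k S :: ((real ^ 'n) \<times> (real ^ 'n) \<times> 'n::finite list) set)"
proof (rule finite_subset)
  show "jet_pairs k S \<subseteq> S \<times> S \<times> {js. length js \<le> k}" by (auto simp: jet_pairs_def)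
  show "finite (S \<times> S \<times> {js :: 'n list. length js \<le> k})"
    using assms finite_lists_length_le[of "UNIV :: 'n set" k] by simp
qed

text \<open>Within \<open>Q\<close> the common term \<open>q x\<close> cancels. For one point on
  each side the cluster property bounds the distance to \<open>x\<close> by
  \<open>card S + 1\<close> times their distance; this ratio enters \<open>w\<close> once and the
  power of the distance at most \<open>k\<close> times, which gives the exponent
  \<open>k + 1\<close>. The factor \<open>(CARD('n) + 1) ^ k\<close> pays for moving an estimate
  from \<open>z\<close> in \<open>Q\<close> to \<open>y\<close> outside.\<close>

lemma jet_constraint_cut:
  fixes S :: "(real ^ 'n::finite) set"
  assumes C: "C > 0" and w: "modulus w" and A: "A = (real CARD('n) + 1) ^ k * (real (card S) + 1) ^ (k + 1)"
    and Q: "Q \<in> metric_clusters S" "x \<in> Q" and q: "q \<in> jet_constraint_set k w C S"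
  shows "(1 / A) *\<^sub>R (\<lambda>y. if y \<in> Q then q x - q y else 0) \<in> jet_constraint_set k w C S"
proof -
  let ?n = "real CARD('n)" and ?N = "real (card S) + 1"
  define q' where "q' = (\<lambda>y. if y \<in> Q then q x - q y else 0)"
  have QS: "Q \<subseteq> S" and xS: "x \<in> S" using Q by (auto simp: metric_clusters_def)
  have A1: "A \<ge> 1"
  proof -
    have "1 * 1 \<le> (?n + 1) ^ k * ?N ^ (k + 1)" by (intro mult_mono one_le_power) auto
    then show ?thesis by (simp add: A)
  qed
  have qE: "q y \<in> polys_upto k" if "y \<in> S" for y using q that by (simp add: jet_constraint_set_iff)
  have q'E: "q' y \<in> polys_upto k" if "y \<in> S" for y
    unfolding q'_def using that xS qE by (auto intro: subspace_diff subspace_0 subspace_polys_upto)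
  have qb: "\<bar>iter_partial js (q u - q v) u\<bar> \<le> C * w (norm (u - v)) * norm (u - v) ^ (k - length js)"
    if "u \<in> S" "v \<in> S" "length js \<le> k" for u v js
  proof (cases "u = v")
    case True
    then show ?thesis using C modulusD(2)[OF w, of 0] by (simp add: zero_fun_def iter_partial_zero)
  qed (use q that in \<open>simp add: jet_constraint_set_iff\<close>)
  have main: "\<bar>iter_partial js (q' y - q' z) y\<bar> \<le> A * (C * w (norm (y - z)) * norm (y - z) ^ (k - length js))"
    if y: "y \<in> S" and z: "z \<in> S" and yz: "y \<noteq> z" and js: "length js \<le> k" for y z js
  proof -
    let ?d = "norm (y - z)"
    have d: "?d > 0" using yz by simp
    have wd: "w ?d > 0" using modulusD(1)[OF w d] .
    define M where "M = C * ?N ^ (k + 1) * w ?d"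
    have M: "M \<ge> 0" using C wd by (simp add: M_def)
    have far: "\<bar>iter_partial js (q u - q x) u\<bar> \<le> M * ?d ^ (k - length js)"
      if "u \<in> Q" "norm (x - u) \<le> ?N * ?d" "length js \<le> k" for u js
    proof -
      have "w (norm (u - x)) \<le> w (?N * ?d)"
        using that by (intro modulusD(3)[OF w]) (auto simp: norm_minus_commute)
      also have "\<dots> \<le> ?N * w ?d" by (intro modulusD(4)[OF w]) auto
      finally have 1: "w (norm (u - x)) \<le> ?N * w ?d" .
      have "norm (u - x) ^ (k - length js) \<le> (?N * ?d) ^ (k - length js)"
        using that by (intro power_mono) (auto simp: norm_minus_commute)
      also have "\<dots> \<le> ?N ^ k * ?d ^ (k - length js)"
        unfolding power_mult_distrib using d by (intro mult_right_mono power_increasing) auto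
      finally have 2: "norm (u - x) ^ (k - length js) \<le> ?N ^ k * ?d ^ (k - length js)" .
      have "\<bar>iter_partial js (q u - q x) u\<bar> \<le> C * (w (norm (u - x)) * norm (u - x) ^ (k - length js))"
        using qb[of u x js] that QS xS by (auto simp: mult.assoc)
      also have "\<dots> \<le> C * ((?N * w ?d) * (?N ^ k * ?d ^ (k - length js)))"
        using C 1 2 wd modulusD(2)[OF w, of "norm (u - x)"] by (intro mult_left_mono mult_mono) auto
      also have "\<dots> = M * ?d ^ (k - length js)" by (simp add: M_def)
      finally show ?thesis .
    qed
    have neg: "iter_partial js (q v - q u) y = - iter_partial js (q u - q v) y" if "u \<in> S" "v \<in> S" "length js \<le> k" for u v js
      using that by (simp add: iter_partial_diff[of k] polys_upto_Ck[OF qE])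
    have p1: "1 \<le> (?n + 1) ^ k" "1 \<le> ?N ^ (k + 1)" by (rule one_le_power, simp)+
    have AC: "A * (C * w ?d * ?d ^ (k - length js)) = (?n + 1) ^ k * (M * ?d ^ (k - length js))"
      by (simp add: A M_def)
    have M1: "M * ?d ^ (k - length js) \<le> A * (C * w ?d * ?d ^ (k - length js))"
      unfolding AC using mult_right_mono[OF p1(1), of "M * ?d ^ (k - length js)"] M d by simp
    consider "y \<in> Q" "z \<in> Q" | "y \<in> Q" "z \<notin> Q" | "y \<notin> Q" "z \<in> Q" | "y \<notin> Q" "z \<notin> Q" by blast
    then show ?thesis
    proof cases
      case 1
      then have "q' y - q' z = q z - q y" by (simp add: q'_def)
      then have "\<bar>iter_partial js (q' y - q' z) y\<bar> = \<bar>iter_partial js (q y - q z) y\<bar>"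
        using neg[OF y z js] by simp
      also have "\<dots> \<le> 1 * (C * w ?d * ?d ^ (k - length js))" using qb[OF y z js] by simp
      also have "\<dots> \<le> A * (C * w ?d * ?d ^ (k - length js))"
        using A1 C wd d by (intro mult_right_mono) auto
      finally show ?thesis .
    next
      case 2
      then have "q' y - q' z = q x - q y" by (simp add: q'_def)
      then have "\<bar>iter_partial js (q' y - q' z) y\<bar> = \<bar>iter_partial js (q y - q x) y\<bar>"
        using neg[OF y xS js] by simp
      also have "\<dots> \<le> M * ?d ^ (k - length js)"
        using Q 2 z js by (intro far) (auto simp: metric_clusters_def)
      finally show ?thesis using M1 by simp
    next
      case 3
      then have "q' y - q' z = q z - q x" by (simp add: q'_def)
      moreover have "\<bar>iter_partial js (q z - q x) y\<bar> \<le> (?n + 1) ^ (k - length js) * M * ?d ^ (k - length js)"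
      proof (rule poly_like_descent[where y = z])
        show "poly_like k (q z - q x)" using qE[OF z] qE[OF xS] by (intro poly_like_diff) (simp_all add: polys_upto_iff)
        have "norm (x - z) \<le> ?N * norm (z - y)" using Q 3 y by (auto simp: metric_clusters_def)
        then show "\<bar>iter_partial js (q z - q x) z\<bar> \<le> M * ?d ^ (k - length js)" if "length js \<le> k" for js
          using 3 that by (intro far) (auto simp: norm_minus_commute)
      qed (use js in auto)
      moreover have "(?n + 1) ^ (k - length js) * (M * ?d ^ (k - length js)) \<le> (?n + 1) ^ k * (M * ?d ^ (k - length js))"
        using M d by (intro mult_right_mono power_increasing) auto
      ultimately show ?thesis unfolding AC by (simp add: mult.assoc)
    next
      case 4
      then have "q' y - q' z = (\<lambda>_. 0)" by (simp add: q'_def zero_fun_def)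
      then show ?thesis using A1 C wd d by (simp add: iter_partial_zero)
    qed
  qed
  have eval: "((1 / A) *\<^sub>R q') y = (1 / A) *\<^sub>R q' y" for y by (simp add: scaleR_fun_def[of _ q'])
  have "(1 / A) *\<^sub>R q' \<in> jet_constraint_set k w C S"
    unfolding jet_constraint_set_iff
  proof (intro conjI ballI allI impI)
    show "((1 / A) *\<^sub>R q') y \<in> polys_upto k" if "y \<in> S" for y
      unfolding eval using q'E[OF that] by (intro subspace_scale subspace_polys_upto)
    show "((1 / A) *\<^sub>R q') y = 0" if "y \<notin> S" for y
      unfolding eval using that QS by (auto simp: q'_def)
    fix y z and js :: "'n list" assume y: "y \<in> S" and z: "z \<in> S" and yz: "y \<noteq> z" and js: "length js \<le> k"
    have "((1 / A) *\<^sub>R q') y - ((1 / A) *\<^sub>R q') z = (1 / A) *\<^sub>R (q' y - q' z)"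
      unfolding eval by (simp add: algebra_simps)
    then have "\<bar>iter_partial js (((1 / A) *\<^sub>R q') y - ((1 / A) *\<^sub>R q') z) y\<bar> = \<bar>iter_partial js (q' y - q' z) y\<bar> / A"
      using A1 js polys_upto_diff_Ck[OF q'E[OF y] q'E[OF z], of k]
      by (simp add: iter_partial_scaleR[of k])
    also have "\<dots> \<le> C * w (norm (y - z)) * norm (y - z) ^ (k - length js)"
      using main[OF y z yz js] A1 by (simp add: field_simps)
    finally show "\<bar>iter_partial js (((1 / A) *\<^sub>R q') y - ((1 / A) *\<^sub>R q') z) y\<bar> \<le> C * w (norm (y - z)) * norm (y - z) ^ (k - length js)" .
  qed
  then show ?thesis by (simp add: q'_def)
qed

lemma polys_upto_finite_span: "\<exists>B. finite B \<and> (polys_upto k :: (real ^ 'n::finite \<Rightarrow> real) set) = span B"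
proof -
  have "finite {(\<lambda>y :: real ^ 'n. mi_power y \<alpha>) | \<alpha>. mi_order \<alpha> \<le> k}"
    unfolding setcompr_eq_image by (rule finite_imageI[OF finite_mi_order_le])
  then show ?thesis unfolding polys_upto_def by blast
qed

section \<open>Dimension count and conclusion\<close>

lemma finite_basis_of_subset:
  fixes V :: "'a::real_vector set"
  assumes "finite B0" "V \<subseteq> span B0"
  shows "\<exists>B. finite B \<and> card B = dim V \<and> V \<subseteq> span B"
proof -
  obtain B where B: "B \<subseteq> V" "independent B" "V \<subseteq> span B" "card B = dim V" by (rule basis_exists)
  then have "finite B" using independent_span_bound[OF assms(1) B(2)] assms(2) by blast
  then show ?thesis using B by blast
qed

text \<open>The affine hull stays in the span of a finite set, so the \<open>dim\<close> in
  \<open>affine_dimension\<close> is a true dimension and the directions have a finite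
  basis.\<close>

lemma affine_dimension_directions:
  fixes G :: "'a::real_vector set"
  assumes "finite B0" "G \<subseteq> span B0" "affine_dimension G \<le> l"
  shows "\<exists>B. finite B \<and> card B \<le> l \<and> (\<forall>g\<in>G. \<forall>g'\<in>G. g - g' \<in> span B)"
proof -
  let ?V = "{p - q | p q. p \<in> affine hull G \<and> q \<in> affine hull G}"
  have "affine hull G \<subseteq> span B0"
    by (rule hull_minimal[OF assms(2)]) (rule subspace_imp_affine[OF subspace_span])
  then have "?V \<subseteq> span B0" by (auto intro: span_diff)
  from finite_basis_of_subset[OF assms(1) this]
  obtain B where B: "finite B" "card B = dim ?V" "?V \<subseteq> span B" by (elim exE conjE)
  have "g - g' \<in> span B" if "g \<in> G" "g' \<in> G" for g g'
    using that B(3) hull_inc[of _ G affine] by blast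
  then show ?thesis using B assms(3) unfolding affine_dimension_def by (intro exI[of _ B]) auto
qed

lemma whitney_field_selection:
  fixes S :: "(real ^ 'n::finite) set" and G :: "real ^ 'n \<Rightarrow> (real ^ 'n \<Rightarrow> real) set"
  assumes S: "finite S" and w: "modulus w" and t: "t > 0" and C0: "C0 > 0"
    and G: "\<And>x. x \<in> S \<Longrightarrow> G x \<subseteq> polys_upto k \<and> convex (G x) \<and> affine_dimension (G x) \<le> l"
    and sel: "\<And>S'. S' \<subseteq> S \<Longrightarrow> card S' \<le> 2 ^ min (l + 1) (dim (polys_upto k :: (real ^ 'n \<Rightarrow> real) set)) \<Longrightarrow>
       \<exists>q. whitney_field k w t C0 S q \<and> (\<forall>x\<in>S'. q x \<in> G x)"
    and C: "C = (2 * (real (dim (polys_upto k :: (real ^ 'n \<Rightarrow> real) set)) + 1) *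
        ((real CARD('n) + 1) ^ k * (real (card S) + 1) ^ (k + 1) + 1)) ^ card S + 1"
  shows "\<exists>q. whitney_field k w t (C * C0) S q \<and> (\<forall>x\<in>S. q x \<in> G x)"
proof -
  define D where "D = dim (polys_upto k :: (real ^ 'n \<Rightarrow> real) set)"
  define m where "m = min (l + 1) D"
  define A where "A = (real CARD('n) + 1) ^ k * (real (card S) + 1) ^ (k + 1)"
  define K where "K = jet_constraint_set k w C0 S"
  define G' where "G' x = G x \<inter> bounded_by {js. length js \<le> k} (\<lambda>js P. iter_partial js P x) (\<lambda>js. C0 / t ^ length js) (polys_upto k)" for x
  have A: "A > 0" by (simp add: A_def add_pos_nonneg)
  obtain B0 :: "(real ^ 'n \<Rightarrow> real) set" where B0: "finite B0" "polys_upto k = span B0"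
    using polys_upto_finite_span by blast
  have absorb: "\<exists>e>0. e *\<^sub>R q \<in> K" if "q \<in> jet_families k S" for q
    unfolding K_def jet_constraint_set_def
  proof (rule absorbing_bounded_by)
    show "(\<lambda>(x, y, js). C0 * w (norm (x - y)) * norm (x - y) ^ (k - length js)) i > 0" if "i \<in> jet_pairs k S" for i :: "(real ^ 'n) \<times> (real ^ 'n) \<times> 'n list"
      using that C0 by (auto simp: jet_pairs_def intro!: mult_pos_pos modulusD(1)[OF w])
  qed (use that subspace_jet_families finite_jet_pairs[OF S] in \<open>simp_all add: jet_eval_linear\<close>)
  interpret cluster_system S "polys_upto k" K "metric_clusters S" A
  proof
    show "finite S" by (rule S)
    show "subspace (polys_upto k :: (real ^ 'n \<Rightarrow> real) set)" by (rule subspace_polys_upto)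
    show "convex K" unfolding K_def jet_constraint_set_def
      by (rule convex_bounded_by) (simp_all add: subspace_jet_families jet_eval_linear)
    show "K \<noteq> {}" using absorb subspace_0[OF subspace_jet_families] by blast
    show "q x \<in> polys_upto k" if "q \<in> K" "x \<in> S" for q x using that by (simp add: K_def jet_constraint_set_iff)
    show "- q \<in> K" if "q \<in> K" for q
      using that unfolding K_def jet_constraint_set_def
      by (rule uminus_bounded_by[rotated 2]) (simp_all add: subspace_jet_families jet_eval_linear)
    show "A > 0" by (rule A)
    show "Q \<subseteq> S" if "Q \<in> metric_clusters S" for Q using that by (simp add: metric_clusters_def)
    show "S \<in> metric_clusters S" by (simp add: metric_clusters_def)
    show "{x} \<in> metric_clusters S" if "x \<in> S" for x using that by (simp add: metric_clusters_def)
    show "\<exists>Q1\<in>metric_clusters S. \<exists>Q2\<in>metric_clusters S. Q1 \<noteq> {} \<and> Q2 \<noteq> {} \<and> Q1 \<inter> Q2 = {} \<and> Q1 \<union> Q2 = Q"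
      if "Q \<in> metric_clusters S" "2 \<le> card Q" for Q
      by (rule split_metric_cluster[OF S that])
    show "(1 / A) *\<^sub>R (\<lambda>y. if y \<in> Q then q x - q y else 0) \<in> K"
      if "Q \<in> metric_clusters S" "x \<in> Q" "q \<in> K" for Q x q
      using that jet_constraint_cut[OF C0 w A_def] unfolding K_def by blast
  qed
  have conv_G': "convex (G' x)" if "x \<in> S" for x
    unfolding G'_def using G[OF that]
    by (intro convex_Int convex_bounded_by subspace_polys_upto iter_partial_combination) auto
  have sel': "\<exists>q\<in>K. \<forall>x\<in>S'. q x \<in> G' x" if S': "S' \<subseteq> S" "card S' \<le> 2 ^ m" for S'
  proof -
    obtain q where q: "whitney_field k w t C0 S q" "\<forall>x\<in>S'. q x \<in> G x"
      using sel[of S'] S' by (auto simp: m_def D_def)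
    \<comment> \<open>Families in \<open>K\<close> vanish off \<open>S\<close>, while a Whitney
      field is unrestricted there.\<close>
    define q0 where "q0 x = (if x \<in> S then q x else 0)" for x
    have "q0 \<in> K" using q(1)
      by (auto simp: K_def jet_constraint_set_iff whitney_field_def q0_def polys_upto_iff)
    moreover have "q0 x \<in> G' x" if "x \<in> S'" for x
      using q S'(1) that by (auto simp: G'_def bounded_by_def q0_def whitney_field_def polys_upto_iff)
    ultimately show ?thesis by blast
  qed
  \<comment> \<open>For \<open>l + 1 \<le> D\<close> there are more functionals than directions of a
    single \<open>G' x\<close>; otherwise \<open>m = D\<close> and a basis of all polynomials is
    available.\<close>
  have dim: "(\<forall>x\<in>S. \<exists>B. finite B \<and> card B < m \<and> (\<forall>g\<in>G' x. \<forall>g'\<in>G' x. g - g' \<in> span B)) \<or>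
       (\<exists>B. finite B \<and> card B \<le> m \<and> (polys_upto k :: (real ^ 'n \<Rightarrow> real) set) \<subseteq> span B)"
  proof (cases "l + 1 \<le> D")
    case True
    have "\<exists>B. finite B \<and> card B < m \<and> (\<forall>g\<in>G' x. \<forall>g'\<in>G' x. g - g' \<in> span B)" if x: "x \<in> S" for x
    proof -
      obtain B where "finite B" "card B \<le> l" "\<forall>g\<in>G x. \<forall>g'\<in>G x. g - g' \<in> span B"
        using affine_dimension_directions[OF B0(1), of "G x" l] G[OF x] B0(2) by auto
      then show ?thesis using True by (intro exI[of _ B]) (auto simp: m_def G'_def)
    qed
    then show ?thesis by blast
  next
    case False
    obtain B where "finite B" "card B = D" "(polys_upto k :: (real ^ 'n \<Rightarrow> real) set) \<subseteq> span B"
      using finite_basis_of_subset[OF B0(1), of "polys_upto k"] B0(2) by (auto simp: D_def)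
    then show ?thesis using False by (intro disjI2 exI[of _ B]) (auto simp: m_def)
  qed
  \<comment> \<open>\<open>m\<close> is replaced by its bound \<open>D\<close>, which removes
    \<open>l\<close> from the constant.\<close>
  have C_large: "C > (2 * (real m + 1) * (A + 1)) ^ card S"
  proof -
    have "(2 * (real m + 1) * (A + 1)) ^ card S \<le> (2 * (real D + 1) * (A + 1)) ^ card S"
      using A by (intro power_mono mult_mono) (auto simp: m_def)
    then show ?thesis unfolding C D_def[symmetric] A_def[symmetric] by linarith
  qed
  have "0 \<le> (2 * (real m + 1) * (A + 1)) ^ card S" using A by (intro zero_le_power) auto
  then have C_pos: "C > 0" using C_large by linarith
  have "\<exists>q. (1 / C) *\<^sub>R q \<in> K \<and> (\<forall>x\<in>S. q x \<in> G' x)"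
  proof (rule selection_from_small_subsets[OF jet_families_def B0 _ _ _ sel' dim C_large C_pos])
    show "K \<subseteq> jet_families k S" by (auto simp: K_def jet_constraint_set_iff jet_families_def)
    show "\<exists>e>0. e *\<^sub>R q \<in> K" if "q \<in> jet_families k S" for q by (rule absorb[OF that])
    show "G' y \<subseteq> polys_upto k \<and> convex (G' y)" if "y \<in> S" for y
      using G[OF that] conv_G'[OF that] by (auto simp: G'_def)
  qed
  then obtain q where q: "(1 / C) *\<^sub>R q \<in> K" "\<And>x. x \<in> S \<Longrightarrow> q x \<in> G' x" by blast
  have C1: "C \<ge> 1" unfolding C using A by (simp flip: A_def)
  have eval: "((1 / C) *\<^sub>R q) x = (1 / C) *\<^sub>R q x" for x by (simp add: scaleR_fun_def[of _ q])
  have qE: "q x \<in> polys_upto k" if "x \<in> S" for x using q(2)[OF that] G[OF that] by (auto simp: G'_def)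
  \<comment> \<open>Only the pair conditions lose the factor \<open>C\<close>; the one-point bounds
    hold with \<open>C0\<close>, as they are part of \<open>G'\<close>.\<close>
  have "whitney_field k w t (C * C0) S q"
    unfolding whitney_field_def
  proof (intro conjI ballI allI impI)
    show "poly_like k (q x)" if "x \<in> S" for x using qE[OF that] by (simp add: polys_upto_iff)
    fix x and js :: "'n list" assume x: "x \<in> S" and js: "length js \<le> k"
    have "\<bar>iter_partial js (q x) x\<bar> \<le> C0 / t ^ length js" using q(2)[OF x] js by (simp add: G'_def bounded_by_def)
    also have "\<dots> \<le> C * C0 / t ^ length js" using C1 C0 t by (intro divide_right_mono) auto
    finally show "\<bar>iter_partial js (q x) x\<bar> \<le> C * C0 / t ^ length js" .
  next
    fix x y and js :: "'n list" assume x: "x \<in> S" and y: "y \<in> S" and xy: "x \<noteq> y" and js: "length js \<le> k"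
    have "((1 / C) *\<^sub>R q) x - ((1 / C) *\<^sub>R q) y = (1 / C) *\<^sub>R (q x - q y)"
      unfolding eval by (simp add: algebra_simps)
    moreover have "\<bar>iter_partial js (((1 / C) *\<^sub>R q) x - ((1 / C) *\<^sub>R q) y) x\<bar> \<le> C0 * w (norm (x - y)) * norm (x - y) ^ (k - length js)"
      using q(1) x y xy js unfolding K_def jet_constraint_set_iff by blast
    ultimately have "\<bar>iter_partial js (q x - q y) x\<bar> / C \<le> C0 * w (norm (x - y)) * norm (x - y) ^ (k - length js)"
      using C_pos js polys_upto_diff_Ck[OF qE[OF x] qE[OF y], of k] by (simp add: iter_partial_scaleR[of k])
    then show "\<bar>iter_partial js (q x - q y) x\<bar> \<le> C * C0 * w (norm (x - y)) * norm (x - y) ^ (k - length js)"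
      using C_pos by (simp add: field_simps)
  qed
  then show ?thesis using q(2) by (auto simp: G'_def)
qed

theorem theorem1p8:
  fixes k N :: nat
  assumes "k \<ge> 1"
  shows "\<exists>\<gamma>::real.
    \<forall>(\<omega> :: real \<Rightarrow> real) (l :: nat) (S :: (real ^ 'n::finite) set)
      (G :: real ^ 'n \<Rightarrow> (real ^ 'n \<Rightarrow> real) set).
      continuous_on {0..} \<omega> \<longrightarrow> concave_on {0..} \<omega> \<longrightarrow>
      (\<forall>t\<ge>0. \<omega> t \<ge> 0) \<longrightarrow> \<omega> 0 = 0 \<longrightarrow> (\<exists>t\<ge>0. \<omega> t \<noteq> 0) \<longrightarrow>
      finite S \<longrightarrow> card S = N \<longrightarrow>
      (\<forall>x\<in>S. G x \<subseteq> polys_upto k \<and> convex (G x) \<and> affine_dimension (G x) \<le> l) \<longrightarrow>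
      (\<forall>S'\<subseteq>S. card S' \<le> 2 ^ min (l + 1) (dim (polys_upto k :: (real ^ 'n \<Rightarrow> real) set)) \<longrightarrow>
         (\<exists>F\<in>Ck_omega k \<omega>. Ck_omega_norm k \<omega> F \<le> 1 \<and> (\<forall>x\<in>S'. taylor_poly k x F \<in> G x))) \<longrightarrow>
      (\<exists>F\<in>Ck_omega k \<omega>. Ck_omega_norm k \<omega> F \<le> ennreal \<gamma> \<and> (\<forall>x\<in>S. taylor_poly k x F \<in> G x))"
proof -
  define C0 where "C0 = (2 ^ k + 2 * real k) * (1 + real CARD('n) * real k) ^ k + 2 * (real CARD('n) + 1) ^ k"
  define C where "C = (2 * (real (dim (polys_upto k :: (real ^ 'n \<Rightarrow> real) set)) + 1) *
        ((real CARD('n) + 1) ^ k * (real N + 1) ^ (k + 1) + 1)) ^ N + 1"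
  have C0: "C0 > 0"
    unfolding C0_def by (intro add_nonneg_pos mult_pos_pos zero_less_power mult_nonneg_nonneg) (auto simp: add_nonneg_pos)
  \<comment> \<open>The extension constant is fixed before \<open>\<omega>\<close>,
    \<open>l\<close>, \<open>S\<close> and \<open>G\<close> are introduced, so it sees
    \<open>S\<close> only through \<open>N\<close>.\<close>
  obtain C1 where C1: "C1 \<ge> 0" and ext: "\<forall>w t (S :: (real ^ 'n) set) q. modulus w \<longrightarrow> t > 0 \<longrightarrow> w t * t ^ k = 1 \<longrightarrow>
     finite S \<longrightarrow> card S = N \<longrightarrow> whitney_field k w t (C * C0) S q \<longrightarrow>
     (\<exists>F. jet_bounded k w t C1 F \<and> (\<forall>x\<in>S. taylor_poly k x F = q x))"
    using whitney_extension_finite[where 'n = 'n, of k N "C * C0"] by (elim exE conjE)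
  \<comment> \<open>The norm has one supremum for each multi-index of order at most \<open>k\<close>
    and one more for each of order \<open>k\<close>, hence at most twice the number of
    multi-indices.\<close>
  define \<gamma> where "\<gamma> = 2 * real (card {\<alpha> :: 'n \<Rightarrow> nat. mi_order \<alpha> \<le> k}) * C1"
  show ?thesis
  proof (intro exI[of _ \<gamma>] allI impI)
    fix \<omega> :: "real \<Rightarrow> real" and l and S :: "(real ^ 'n) set" and G :: "real ^ 'n \<Rightarrow> (real ^ 'n \<Rightarrow> real) set"
    assume cont: "continuous_on {0..} \<omega>" and conc: "concave_on {0..} \<omega>" and nonneg: "\<forall>t\<ge>0. \<omega> t \<ge> 0"
      and zero: "\<omega> 0 = 0" and nz: "\<exists>t\<ge>0. \<omega> t \<noteq> 0" and S: "finite S" "card S = N"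
      and G: "\<forall>x\<in>S. G x \<subseteq> polys_upto k \<and> convex (G x) \<and> affine_dimension (G x) \<le> l"
      and sel: "\<forall>S'\<subseteq>S. card S' \<le> 2 ^ min (l + 1) (dim (polys_upto k :: (real ^ 'n \<Rightarrow> real) set)) \<longrightarrow>
         (\<exists>F\<in>Ck_omega k \<omega>. Ck_omega_norm k \<omega> F \<le> 1 \<and> (\<forall>x\<in>S'. taylor_poly k x F \<in> G x))"
    note pos = truncated_modulus(1)[OF conc nonneg zero nz]
    define w where "w = (\<lambda>t. min 1 (\<omega> t))"
    have w: "modulus w" unfolding w_def by (rule truncated_modulus(2)[OF conc nonneg zero nz])
    obtain t where t: "t \<ge> 1" "w t * t ^ k = 1" using natural_scale[OF assms cont w w_def] by blast
    then have t0: "t > 0" by simp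
    have "\<exists>q. whitney_field k w t (C * C0) S q \<and> (\<forall>x\<in>S. q x \<in> G x)"
    proof (rule whitney_field_selection[OF S(1) w t0 C0, where l = l])
      fix S' assume "S' \<subseteq> S" "card S' \<le> 2 ^ min (l + 1) (dim (polys_upto k :: (real ^ 'n \<Rightarrow> real) set))"
      then obtain F where F: "F \<in> Ck_omega k \<omega>" "Ck_omega_norm k \<omega> F \<le> 1" "\<forall>x\<in>S'. taylor_poly k x F \<in> G x"
        using sel by blast
      \<comment> \<open>\<open>F\<close> is prescribed on \<open>S'\<close> only, but its jets at
        all points of \<open>S\<close> form a Whitney field; this makes the selection on
        \<open>S'\<close> part of a member of \<open>K\<close>.\<close>
      have "whitney_field k w t C0 S (\<lambda>x. taylor_poly k x F)"
        using F(1) by (intro taylor_field_whitney[OF assms pos w w_def t _ F(2) C0_def]) (simp_all add: Ck_omega_def)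
      then show "\<exists>q. whitney_field k w t C0 S q \<and> (\<forall>x\<in>S'. q x \<in> G x)" using F(3) by blast
    qed (use G in \<open>auto simp: C_def S(2)\<close>)
    then obtain q where q: "whitney_field k w t (C * C0) S q" "\<forall>x\<in>S. q x \<in> G x" by blast
    obtain F where F: "jet_bounded k w t C1 F" "\<forall>x\<in>S. taylor_poly k x F = q x"
      using ext[rule_format, OF w t0 t(2) S q(1)] by blast
    have norm: "Ck_omega_norm k \<omega> F \<le> ennreal \<gamma>"
      unfolding \<gamma>_def by (rule jet_bounded_norm_le[OF F(1) t(1) C1 pos w_def])
    moreover have "F \<in> Ck_omega k \<omega>"
      using F(1) le_less_trans[OF norm ennreal_less_top] by (simp add: Ck_omega_def jet_bounded_def)
    moreover have "\<forall>x\<in>S. taylor_poly k x F \<in> G x" using F(2) q(2) by simp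
    ultimately show "\<exists>F\<in>Ck_omega k \<omega>. Ck_omega_norm k \<omega> F \<le> ennreal \<gamma> \<and> (\<forall>x\<in>S. taylor_poly k x F \<in> G x)"
      by blast
  qed
qed

end
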